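(* Let $T$ be an oriented 2-tangle diagram, $k\in\{0,1\}$, and suppose the orientation of $T$ extends to an orientation of the closure $[T,k]$. Let $(K_{T,k},\partial_T)$ be the complex defined in the context. Then $\partial_T$ squares to zero, has bidegree $(1,1)$, and in fact $\partial_T$ consists only of the terms $\phi\otimes\mu^2(u,y)$ (all terms involving $\mu^3$ vanish). Moreover there is a chain isomorphism from $(K_{T,k},\partial_T)$ to the reduced Khovanov complex $C\mathrm{Kh}^{\mathrm{red}}([T,k])$ (reduced at the component containing $1$) carrying bidegree $(r,s)$ to Khovanov bidegree $(q,h)=(r-s,s)$. Consequently $H^{r,s}(K_{T,k},\partial_T)\cong\mathrm{Kh}^{\mathrm{red}}([T,k])^{r-s,s}$.
   Context: Work over $\mathbb F=\mathbb F_2$. Pillowcase. $P$ is the quotient of $\mathbb R^2$ by the group generated by $(\gamma,\theta)\mapsto(\gamma+2\pi,\theta)$, $(\gamma,\theta)\mapsto(\gamma,\theta+2\pi)$, $(\gamma,\theta)\mapsto(-\gamma,-\theta)$; $[\gamma,\theta]$ denotes the image of $(\gamma,\theta)$; $P^*$ is the complement of the four images of $(\pi\mathbb Z)^2$. For a small fixed $\delta>0$: $L_0(t)=[\tfrac\pi2+t+\delta\sin t,\tfrac\pi2+t-\delta\sin t]$, $L_1(t)=[\pi-2\delta\sin t,\tfrac\pi2-t-\delta\sin t]$ ($t\in\mathbb R/2\pi\mathbb Z$), and arcs $W_0(t)=[t,t]$, $W_1(t)=[\pi,-t]$ ($t\in[0,\pi]$). $C'$ denotes the image of a curve $C$ under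 the time-$s$ flow, $s>0$ small, of the Hamiltonian vector field of $f(\gamma,\theta)=-\cos\gamma\cos(\theta-\gamma)$ (further pushoffs $C^{(k)}$ at successively larger small times). For objects $X,Y$ among these curves, $(X,Y)$ is the $\mathbb F$-span of $X'\cap Y$. Polygon-counting maps: for $W\in\{W_0,W_1\}$, $C_1,\dots,C_n\in\{L_0,L_1\}$, $y\in(W,C_1)$ and $x_\ell\in(C_\ell,C_{\ell+1})$, $\mu^n(x_{n-1},\dots,x_1,y)\in(W,C_n)$ counts (mod 2) equivalence classes of orientation-preserving immersions into $P^*$ of a convex $(n+1)$-gon with counterclockwise vertices $v_0,\dots,v_n$ whose first edge lies on the pushoff of $W$, the following edges on successive pushoffs of $C_1,\dots,C_n$, with inputs at $v_1,\dots,v_n$, output $\iota(v_0)$. Labels and gradings. Intersection points are labelled $L_0'\cap L_0\ni a_0,c_0$, $L_1'\cap L_1\ni a_1,c_1$, $L_1'\cap L_0\ni p_{01}$, $L_0'\cap L_1\ni q_{10}$, $W_0'\cap L_0=\{\alpha,\beta\}$, $W_0'\cap L_1=\{\gamma\}$, $W_1'\cap L_0=\{\tau\}$, $W_1'\cap L_1=\{\rho,\sigma\}$, so that the only nonzero maps $\mu^n$ with module input are: $\mu^2(a_0,\alpha)=\alpha,\mu^2(a_0,\beta)=\beta,\mu^2(c_0,\alpha)=\beta,\mu^2(a_1,\gamma)=\gamma,\mu^2(q_{10},\alpha)=\gamma,\mu^2(p_{01},\gamma)=\beta$, $\mu^2(a_1,\rho)=\rho,\mu^2(a_1,\sigma)=\sigma,\mu^2(c_1,\rho)=\sigma,\mu^2(a_0,\tau)=\tau,\mu^2(q_{10},\tau)=\sigma,\mu^2(p_{01},\rho)=\tau$,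 and $\mu^3(b_0,p_{01},\gamma)=\alpha$, $\mu^3(q_{01},q_{10},\alpha)=\alpha$, $\mu^3(c_0,b_0,\beta)=\beta$, $\mu^3(p_{01},p_{10},\alpha)=\alpha$, $\mu^3(b_1,q_{10},\tau)=\rho$, $\mu^3(q_{10},q_{01},\sigma)=\sigma$, $\mu^3(c_1,b_1,\sigma)=\sigma$, $\mu^3(p_{10},p_{01},\rho)=\rho$, $\mu^3(p_{01},p_{10},\tau)=\tau$ (where $b_i,p_{10},q_{01}$ are the remaining intersection points of the respective hom spaces). Gradings: $p(\alpha)=0,p(\beta)=-2,p(\gamma)=-1,p(\tau)=-1,p(\rho)=0,p(\sigma)=-2$; $A=\mathbb F[x]/(x^2)$ with $p(1)=1$, $p(x)=-1$. Tangles and cube. $B=\{1,i,-1,-i\}\subset\partial D^2$; planar 2-tangles are compact properly embedded 1-manifolds in $D^2$ with boundary $B$; the earringed arc is the one containing $1$. $T_0$: arcs joining $1$ to $-i$ and $i$ to $-1$; $T_1$: arcs joining $1$ to $i$ and $-1$ to $-i$; type $T_\ell(m)$ means $m$ circles plus arcs isotopic to those of $T_\ell$. A 2-tangle diagram has $n=n^++n^-$ crossings, ordered; for $i\in I=\{0,1\}^n$, $P_i$ is the complete resolution (entry 0: turn left when arriving along the overstrand; entry 1: the other), of type $T_{\ell_i}(m_i)$; $h(i)=-n^-+\#\{\text{ones in }i\}$. The closure $[T,k]$ is the link obtained by adjoining, outside $D^2$, the reflection of $T_k$ across $\partial D^2$ (so $[T_k,k]$ has two components). Maps: $\epsilon(x)=1,\epsilon(1)=0$;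 $\dot\epsilon(1)=1,\dot\epsilon(x)=0$; $\eta(1)=1$; $\dot\eta(1)=x$; $M$ multiplication on $A$; $S(1)=1\otimes x+x\otimes1$, $S(x)=x\otimes x$. When $j$ is obtained from $i$ by changing one $0$ to $1$, $\delta_{ji}\in\Hom(A^{\otimes m_i},A^{\otimes m_j})\otimes(L_{\ell_i},L_{\ell_j})$ is (identity on uninvolved circle factors) $\otimes$: $M\otimes a_\ell$ (two circles merge); $S\otimes a_\ell$ (circle splits); $\dot\epsilon\otimes a_\ell$ (circle merges into earringed arc); $\dot\eta\otimes a_\ell$ (circle splits off earringed arc); $\dot\epsilon\otimes a_\ell+\epsilon\otimes c_\ell$ (circle merges into unearringed arc); $\dot\eta\otimes a_\ell+\eta\otimes c_\ell$ (circle splits off unearringed arc); $\mathrm{id}\otimes q_{10}$ (saddle joining the two arcs, $\ell_i=0$); $\mathrm{id}\otimes p_{01}$ (saddle joining the two arcs, $\ell_i=1$). Otherwise $\delta_{ji}=0$. The complex. $K_{T,k}=\bigoplus_{i\in I}A^{\otimes m_i}\otimes(W_k,L_{\ell_i})$, where $v\otimes y$ in the $i$-summand has bidegree $(p(v)+p(y)+n^+-n^-+2h(i),\,h(i))$. The differential is $\partial_T(v\otimes y)=\sum_j\phi(v)\otimes\mu^2(u,y)+\sum_{j,j'}\phi'\phi(v)\otimes\mu^3(u',u,y)$, where $\delta_{ji}=\sum\phi\otimes u$ and $\delta_{j'j}=\sum\phi'\otimes u'$ (extended bilinearly). The reduced Khovanov complex uses the standard conventions: generators $A^{\otimes(\text{circles})}$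 with the factor of the circle through $1$ restricted to $\langle x\rangle$, $h=r-n^-$ and $q=\deg+r+n^+-2n^-$, where $r$ is the number of $1$-resolutions and $\deg$ sums $p(1)=1,p(x)=-1$. *)

theory Defs
  imports Main
begin

text \<open>A planar tangle diagram in D^2 is presented, up to planar isotopy, as a
 stack of horizontal slices.  Levels are 0..length D; at level l the diagram
 meets the horizontal line y = l transversally in wid D l points, numbered
 0,1,... from left to right.  Level 0 has no points, the top level has 4
 points, which are the boundary points of the disk.  Slice l (between
 level l and level l+1) is a cup (a minimum creating two new adjacent points
 at positions j, j+1 of level l+1), a cap (a maximum joining positions j, j+1
 of level l) or a crossing between strands at positions j and j+1; in
 Cross j ov, ov is True iff the strand from (l,j) to (l+1,j+1) (south-west to
 north-east) is the over-strand.  Top positions 3,2,1,0 (right to left, i.e.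
 counterclockwise) are identified with the boundary points 1, i, -1, -i.\<close>

datatype slice = Cup nat | Cap nat | Cross nat bool

type_synonym node = "nat \<times> nat"
type_synonym comp = "node set"

fun swidth :: "slice \<Rightarrow> nat \<Rightarrow> nat" where
  "swidth (Cup j) w = w + 2"
| "swidth (Cap j) w = w - 2"
| "swidth (Cross j ov) w = w"

fun wid :: "slice list \<Rightarrow> nat \<Rightarrow> nat" where
  "wid D 0 = 0"
| "wid D (Suc l) = swidth (D ! l) (wid D l)"

fun slice_ok :: "slice \<Rightarrow> nat \<Rightarrow> bool" where
  "slice_ok (Cup j) w = (j \<le> w)"
| "slice_ok (Cap j) w = (j + 2 \<le> w)"
| "slice_ok (Cross j ov) w = (j + 2 \<le> w)"

definition valid_diagram :: "slice list \<Rightarrow> bool" where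
  "valid_diagram D = ((\<forall>l < length D. slice_ok (D ! l) (wid D l)) \<and> wid D (length D) = 4)"

definition nodes :: "slice list \<Rightarrow> node set" where
  "nodes D = {(l, p). l \<le> length D \<and> p < wid D l}"

text \<open>Edges of the resolved diagram in slice l; r is the resolution bit of
 the crossing (False = 0-resolution, True = 1-resolution).  The 0-resolution
 (turn left when arriving along the over-strand) is the vertical smoothing
 if ov, the horizontal one otherwise.\<close>

fun sedge :: "slice \<Rightarrow> bool \<Rightarrow> nat \<Rightarrow> nat \<Rightarrow> node \<Rightarrow> node \<Rightarrow> bool" where
  "sedge (Cup j) r w l a b =
     ((\<exists>p<w. a = (l, p) \<and> b = (Suc l, if p < j then p else p + 2))
      \<or> (a = (Suc l, j) \<and> b = (Suc l, Suc j)))"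
| "sedge (Cap j) r w l a b =
     ((\<exists>p<w. p \<noteq> j \<and> p \<noteq> Suc j \<and> a = (l, p) \<and> b = (Suc l, if p < j then p else p - 2))
      \<or> (a = (l, j) \<and> b = (l, Suc j)))"
| "sedge (Cross j ov) r w l a b =
     ((\<exists>p<w. p \<noteq> j \<and> p \<noteq> Suc j \<and> a = (l, p) \<and> b = (Suc l, p))
      \<or> (if ov = (\<not> r)
         then (a = (l, j) \<and> b = (Suc l, j)) \<or> (a = (l, Suc j) \<and> b = (Suc l, Suc j))
         else (a = (l, j) \<and> b = (l, Suc j)) \<or> (a = (Suc l, j) \<and> b = (Suc l, Suc j))))"

definition is_cross :: "slice \<Rightarrow> bool" where
  "is_cross s = (case s of Cross j ov \<Rightarrow> True | _ \<Rightarrow> False)"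

definition cpos :: "slice \<Rightarrow> nat" where
  "cpos s = (case s of Cross j ov \<Rightarrow> j | Cup j \<Rightarrow> j | Cap j \<Rightarrow> j)"

definition cover :: "slice \<Rightarrow> bool" where
  "cover s = (case s of Cross j ov \<Rightarrow> ov | _ \<Rightarrow> False)"

text \<open>The set of crossings (indexed by their levels).  A vertex of the cube
 I is a subset R of the crossings (those given the 1-resolution).\<close>

definition crossings :: "slice list \<Rightarrow> nat set" where
  "crossings D = {l. l < length D \<and> is_cross (D ! l)}"

definition tedge :: "slice list \<Rightarrow> nat set \<Rightarrow> node \<Rightarrow> node \<Rightarrow> bool" where
  "tedge D R a b = (\<exists>l < length D. sedge (D ! l) (l \<in> R) (wid D l) l a b)"

text \<open>The closure [T,k]: the reflection of T_k attached outside the disk.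
 T_0 joins 1 to -i and i to -1; T_1 joins 1 to i and -1 to -i.\<close>

definition cedge :: "slice list \<Rightarrow> nat \<Rightarrow> nat set \<Rightarrow> node \<Rightarrow> node \<Rightarrow> bool" where
  "cedge D k R a b = (tedge D R a b \<or>
     (let t = length D in
      if k = 0 then (a = (t, 3) \<and> b = (t, 0)) \<or> (a = (t, 2) \<and> b = (t, 1))
      else (a = (t, 3) \<and> b = (t, 2)) \<or> (a = (t, 1) \<and> b = (t, 0))))"

definition conn :: "(node \<Rightarrow> node \<Rightarrow> bool) \<Rightarrow> node \<Rightarrow> node \<Rightarrow> bool" where
  "conn E = (\<lambda>a b. E a b \<or> E b a)\<^sup>*\<^sup>*"

definition comp_of :: "(node \<Rightarrow> node \<Rightarrow> bool) \<Rightarrow> node \<Rightarrow> comp" where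
  "comp_of E a = {b. conn E a b}"

definition comps :: "slice list \<Rightarrow> (node \<Rightarrow> node \<Rightarrow> bool) \<Rightarrow> comp set" where
  "comps D E = comp_of E ` nodes D"

definition tops :: "slice list \<Rightarrow> node set" where
  "tops D = {(length D, p) | p. p < 4}"

text \<open>Components of the complete resolution P_R, its circles, its type
 ell (0 for T_0, 1 for T_1), and the earringed arc (the one through 1).\<close>

definition tcomps :: "slice list \<Rightarrow> nat set \<Rightarrow> comp set" where
  "tcomps D R = comps D (tedge D R)"

definition tcircles :: "slice list \<Rightarrow> nat set \<Rightarrow> comp set" where
  "tcircles D R = {C \<in> tcomps D R. C \<inter> tops D = {}}"

definition ltype :: "slice list \<Rightarrow> nat set \<Rightarrow> nat" where
  "ltype D R = (if conn (tedge D R) (length D, 3) (length D, 0) then 0 else 1)"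

definition ccomps :: "slice list \<Rightarrow> nat \<Rightarrow> nat set \<Rightarrow> comp set" where
  "ccomps D k R = comps D (cedge D k R)"

definition marked :: "slice list \<Rightarrow> nat \<Rightarrow> nat set \<Rightarrow> comp" where
  "marked D k R = comp_of (cedge D k R) (length D, 3)"

definition loc :: "slice list \<Rightarrow> nat \<Rightarrow> node set" where
  "loc D c = (let j = cpos (D ! c) in {(c, j), (c, Suc j), (Suc c, j), (Suc c, Suc j)})"

definition involved :: "comp set \<Rightarrow> node set \<Rightarrow> comp set" where
  "involved Cs L = {C \<in> Cs. C \<inter> L \<noteq> {}}"

text \<open>An orientation assigns to every node whether the strand through it
 points up (True) or down.\<close>

definition oriented :: "slice list \<Rightarrow> (node \<Rightarrow> bool) \<Rightarrow> bool" where
  "oriented D ori = (\<forall>l < length D. let w = wid D l in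
     (case D ! l of
        Cup j \<Rightarrow> (\<forall>p<w. ori (l, p) = ori (Suc l, if p < j then p else p + 2))
                 \<and> ori (Suc l, j) \<noteq> ori (Suc l, Suc j)
      | Cap j \<Rightarrow> (\<forall>p<w. p \<noteq> j \<and> p \<noteq> Suc j \<longrightarrow> ori (l, p) = ori (Suc l, if p < j then p else p - 2))
                 \<and> ori (l, j) \<noteq> ori (l, Suc j)
      | Cross j ov \<Rightarrow> (\<forall>p<w. p \<noteq> j \<and> p \<noteq> Suc j \<longrightarrow> ori (l, p) = ori (Suc l, p))
                 \<and> ori (l, j) = ori (Suc l, Suc j) \<and> ori (l, Suc j) = ori (Suc l, j)))"

definition extends_closure :: "slice list \<Rightarrow> (node \<Rightarrow> bool) \<Rightarrow> nat \<Rightarrow> bool" where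
  "extends_closure D ori k = (let t = length D in
     if k = 0 then ori (t, 3) \<noteq> ori (t, 0) \<and> ori (t, 2) \<noteq> ori (t, 1)
     else ori (t, 3) \<noteq> ori (t, 2) \<and> ori (t, 1) \<noteq> ori (t, 0))"

definition positive :: "slice list \<Rightarrow> (node \<Rightarrow> bool) \<Rightarrow> nat \<Rightarrow> bool" where
  "positive D ori c = (let j = cpos (D ! c) in cover (D ! c) = (ori (c, j) = ori (c, Suc j)))"

definition npos :: "slice list \<Rightarrow> (node \<Rightarrow> bool) \<Rightarrow> nat" where
  "npos D ori = card {c \<in> crossings D. positive D ori c}"

definition nneg :: "slice list \<Rightarrow> (node \<Rightarrow> bool) \<Rightarrow> nat" where
  "nneg D ori = card {c \<in> crossings D. \<not> positive D ori c}"

datatype hp = A0 | B0 | C0 | A1 | B1 | C1 | P01 | P10 | Q01 | Q10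
datatype pt = Alpha | Beta | Gamma | Tau | Rho | Sigma

fun modgens :: "nat \<Rightarrow> nat \<Rightarrow> pt set" where
  "modgens k l = (if k = 0 then (if l = 0 then {Alpha, Beta} else {Gamma})
                  else (if l = 0 then {Tau} else {Rho, Sigma}))"

fun pgr :: "pt \<Rightarrow> int" where
  "pgr Alpha = 0" | "pgr Beta = -2" | "pgr Gamma = -1"
| "pgr Tau = -1" | "pgr Rho = 0" | "pgr Sigma = -2"

definition mu2 :: "hp \<Rightarrow> pt \<Rightarrow> pt option" where
  "mu2 u y = (
     if (u, y) = (A0, Alpha) then Some Alpha
     else if (u, y) = (A0, Beta) then Some Beta
     else if (u, y) = (C0, Alpha) then Some Beta
     else if (u, y) = (A1, Gamma) then Some Gamma
     else if (u, y) = (Q10, Alpha) then Some Gamma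
     else if (u, y) = (P01, Gamma) then Some Beta
     else if (u, y) = (A1, Rho) then Some Rho
     else if (u, y) = (A1, Sigma) then Some Sigma
     else if (u, y) = (C1, Rho) then Some Sigma
     else if (u, y) = (A0, Tau) then Some Tau
     else if (u, y) = (Q10, Tau) then Some Sigma
     else if (u, y) = (P01, Rho) then Some Tau
     else None)"

text \<open>mu3 u' u y, with u' the later (second) morphism.\<close>

definition mu3 :: "hp \<Rightarrow> hp \<Rightarrow> pt \<Rightarrow> pt option" where
  "mu3 u' u y = (
     if (u', u, y) = (B0, P01, Gamma) then Some Alpha
     else if (u', u, y) = (Q01, Q10, Alpha) then Some Alpha
     else if (u', u, y) = (C0, B0, Beta) then Some Beta
     else if (u', u, y) = (P01, P10, Alpha) then Some Alpha
     else if (u', u, y) = (B1, Q10, Tau) then Some Rho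
     else if (u', u, y) = (Q10, Q01, Sigma) then Some Sigma
     else if (u', u, y) = (C1, B1, Sigma) then Some Sigma
     else if (u', u, y) = (P10, P01, Rho) then Some Rho
     else if (u', u, y) = (P01, P10, Tau) then Some Tau
     else None)"

text \<open>A basis vector of A^{\<otimes> m} is encoded by the set X of circles labelled x
 (the other circles are labelled 1).  A linear map between such tensor
 powers is encoded by its F_2 matrix phi X X'.\<close>

definition mergeR :: "nat \<Rightarrow> bool \<Rightarrow> bool" where
  "mergeR n b = (n \<le> 1 \<and> b = (n = 1))"

definition splitR :: "bool \<Rightarrow> nat \<Rightarrow> bool" where
  "splitR a n = (if a then n = 2 else n = 1)"

definition delta :: "slice list \<Rightarrow> nat set \<Rightarrow> nat \<Rightarrow> ((comp set \<Rightarrow> comp set \<Rightarrow> bool) \<times> hp) list" where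
  "delta D R c = (let R' = insert c R;
      S = involved (tcomps D R) (loc D c); S' = involved (tcomps D R') (loc D c);
      circ = tcircles D R; circ' = tcircles D R';
      aL = (if ltype D R = 0 then A0 else A1); cL = (if ltype D R = 0 then C0 else C1);
      earr = (\<exists>C \<in> S. (length D, 3) \<in> C);
      base = (\<lambda>X X'. X - S = X' - S') in
   if card S = 2 \<and> card S' = 1 \<and> S \<subseteq> circ \<and> S' \<subseteq> circ' then
      [(\<lambda>X X'. base X X' \<and> mergeR (card (S \<inter> X)) (S' \<inter> X' \<noteq> {}), aL)]
   else if card S = 1 \<and> card S' = 2 \<and> S \<subseteq> circ \<and> S' \<subseteq> circ' then
      [(\<lambda>X X'. base X X' \<and> splitR (S \<inter> X \<noteq> {}) (card (S' \<inter> X')), aL)]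
   else if card S = 2 \<and> card S' = 1 \<and> card (S \<inter> circ) = 1 then
      (if earr then [(\<lambda>X X'. base X X' \<and> S \<inter> X = {}, aL)]
       else [(\<lambda>X X'. base X X' \<and> S \<inter> X = {}, aL), (\<lambda>X X'. base X X' \<and> S \<inter> X \<noteq> {}, cL)])
   else if card S = 1 \<and> card S' = 2 \<and> S \<inter> circ = {} \<and> card (S' \<inter> circ') = 1 then
      (if earr then [(\<lambda>X X'. base X X' \<and> S' \<inter> X' \<noteq> {}, aL)]
       else [(\<lambda>X X'. base X X' \<and> S' \<inter> X' \<noteq> {}, aL), (\<lambda>X X'. base X X' \<and> S' \<inter> X' = {}, cL)])
   else if card S = 2 \<and> S \<inter> circ = {} then
      [(base, if ltype D R = 0 then Q10 else P01)]
   else [])"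

type_synonym kgen = "nat set \<times> comp set \<times> pt"

definition GK :: "slice list \<Rightarrow> nat \<Rightarrow> kgen set" where
  "GK D k = {(R, X, y). R \<subseteq> crossings D \<and> X \<subseteq> tcircles D R \<and> y \<in> modgens k (ltype D R)}"

fun bidegK :: "slice list \<Rightarrow> (node \<Rightarrow> bool) \<Rightarrow> kgen \<Rightarrow> int \<times> int" where
  "bidegK D ori (R, X, y) = (let h = int (card R) - int (nneg D ori) in
     (int (card (tcircles D R)) - 2 * int (card X) + pgr y + int (npos D ori) - int (nneg D ori) + 2 * h, h))"

fun terms2 :: "slice list \<Rightarrow> kgen \<Rightarrow> kgen \<Rightarrow> (nat \<times> nat) set" where
  "terms2 D (R, X, y) (R', X', y') =
     {(c, n). c \<in> crossings D - R \<and> R' = insert c R \<and> n < length (delta D R c)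
        \<and> fst (delta D R c ! n) X X' \<and> mu2 (snd (delta D R c ! n)) y = Some y'}"

fun terms3 :: "slice list \<Rightarrow> kgen \<Rightarrow> kgen \<Rightarrow> (nat \<times> nat \<times> nat \<times> nat \<times> comp set) set" where
  "terms3 D (R, X, y) (R', X', y') =
     {(c, c', n, n', Z). c \<in> crossings D - R \<and> c' \<in> crossings D - insert c R
        \<and> R' = insert c' (insert c R)
        \<and> n < length (delta D R c) \<and> n' < length (delta D (insert c R) c')
        \<and> Z \<subseteq> tcircles D (insert c R)
        \<and> fst (delta D R c ! n) X Z \<and> fst (delta D (insert c R) c' ! n') Z X'
        \<and> mu3 (snd (delta D (insert c R) c' ! n')) (snd (delta D R c ! n)) y = Some y'}"

text \<open>Matrix of partial_T: dK D g g' is the coefficient (in F_2) of g' in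
 partial_T g; dK3 is the coefficient coming from the mu^3 terms only.\<close>

definition dK :: "slice list \<Rightarrow> kgen \<Rightarrow> kgen \<Rightarrow> bool" where
  "dK D g g' = odd (card (terms2 D g g') + card (terms3 D g g'))"

definition dK3 :: "slice list \<Rightarrow> kgen \<Rightarrow> kgen \<Rightarrow> bool" where
  "dK3 D g g' = odd (card (terms3 D g g'))"

type_synonym khgen = "nat set \<times> comp set"

definition GKh :: "slice list \<Rightarrow> nat \<Rightarrow> khgen set" where
  "GKh D k = {(R, X). R \<subseteq> crossings D \<and> X \<subseteq> ccomps D k R \<and> marked D k R \<in> X}"

fun bidegKh :: "slice list \<Rightarrow> (node \<Rightarrow> bool) \<Rightarrow> nat \<Rightarrow> khgen \<Rightarrow> int \<times> int" where
  "bidegKh D ori k (R, X) =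
     (int (card (ccomps D k R)) - 2 * int (card X) + int (card R) + int (npos D ori) - 2 * int (nneg D ori),
      int (card R) - int (nneg D ori))"

fun dKh :: "slice list \<Rightarrow> nat \<Rightarrow> khgen \<Rightarrow> khgen \<Rightarrow> bool" where
  "dKh D k (R, X) (R', X') = (\<exists>c \<in> crossings D - R. R' = insert c R \<and>
     (let S = involved (ccomps D k R) (loc D c); S' = involved (ccomps D k R') (loc D c) in
      X - S = X' - S' \<and>
      ((card S = 2 \<and> card S' = 1 \<and> mergeR (card (S \<inter> X)) (S' \<inter> X' \<noteq> {}))
       \<or> (card S = 1 \<and> card S' = 2 \<and> splitR (S \<inter> X \<noteq> {}) (card (S' \<inter> X'))))))"

text \<open>Vectors are finite sets of generators; a matrix M g g' gives the
 coefficient of g' in M(g).\<close>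

definition vapply :: "'b set \<Rightarrow> ('a \<Rightarrow> 'b \<Rightarrow> bool) \<Rightarrow> 'a set \<Rightarrow> 'b set" where
  "vapply G2 M S = {h \<in> G2. odd (card {g \<in> S. M g h})}"

definition chain_iso ::
  "'a set \<Rightarrow> ('a \<Rightarrow> 'a \<Rightarrow> bool) \<Rightarrow> 'b set \<Rightarrow> ('b \<Rightarrow> 'b \<Rightarrow> bool) \<Rightarrow> ('a \<Rightarrow> 'b \<Rightarrow> bool) \<Rightarrow> bool" where
  "chain_iso G1 d1 G2 d2 F =
    ((\<forall>g\<in>G1. \<forall>h\<in>G2. odd (card {g'\<in>G1. d1 g g' \<and> F g' h}) = odd (card {h'\<in>G2. F g h' \<and> d2 h' h}))
     \<and> (\<exists>F'. (\<forall>g\<in>G1. \<forall>g2\<in>G1. odd (card {h\<in>G2. F g h \<and> F' h g2}) = (g = g2))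
           \<and> (\<forall>h\<in>G2. \<forall>h2\<in>G2. odd (card {g\<in>G1. F' h g \<and> F g h2}) = (h = h2))))"

definition cycles :: "'a set \<Rightarrow> ('a \<Rightarrow> 'a \<Rightarrow> bool) \<Rightarrow> ('a \<Rightarrow> int \<times> int) \<Rightarrow> int \<times> int \<Rightarrow> 'a set set" where
  "cycles G d deg e = {S. S \<subseteq> {g\<in>G. deg g = e} \<and> vapply G d S = {}}"

definition boundaries ::
  "'a set \<Rightarrow> ('a \<Rightarrow> 'a \<Rightarrow> bool) \<Rightarrow> ('a \<Rightarrow> int \<times> int) \<Rightarrow> int \<times> int \<Rightarrow> int \<times> int \<Rightarrow> 'a set set" where
  "boundaries G d deg sh e = {vapply G d S | S. S \<subseteq> {g\<in>G. deg g = (fst e - fst sh, snd e - snd sh)}}"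

text \<open>Homology in degree e1 of the first complex (differential of degree
 sh1) is isomorphic to homology in degree e2 of the second one: there is a
 linear map between the chain groups inducing a bijection on homology.\<close>

definition homology_iso ::
  "'a set \<Rightarrow> ('a \<Rightarrow> 'a \<Rightarrow> bool) \<Rightarrow> ('a \<Rightarrow> int \<times> int) \<Rightarrow> int \<times> int \<Rightarrow> int \<times> int \<Rightarrow>
   'b set \<Rightarrow> ('b \<Rightarrow> 'b \<Rightarrow> bool) \<Rightarrow> ('b \<Rightarrow> int \<times> int) \<Rightarrow> int \<times> int \<Rightarrow> int \<times> int \<Rightarrow> bool" where
  "homology_iso G1 d1 deg1 sh1 e1 G2 d2 deg2 sh2 e2 =
    (let Z1 = cycles G1 d1 deg1 e1; B1 = boundaries G1 d1 deg1 sh1 e1;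
         Z2 = cycles G2 d2 deg2 e2; B2 = boundaries G2 d2 deg2 sh2 e2 in
     \<exists>f :: 'a \<Rightarrow> 'b \<Rightarrow> bool.
        (\<forall>S\<in>Z1. vapply G2 f S \<in> Z2) \<and> (\<forall>S\<in>B1. vapply G2 f S \<in> B2)
      \<and> (\<forall>T\<in>Z2. \<exists>S\<in>Z1. vapply G2 f S - T \<union> (T - vapply G2 f S) \<in> B2)
      \<and> (\<forall>S\<in>Z1. vapply G2 f S \<in> B2 \<longrightarrow> S \<in> B1))"

end

theory Submission
  imports Defs "HOL-Library.Z2"
begin

text \<open>All morphisms occurring in the cube are of the kinds \<open>a\<close>, \<open>c\<close>, \<open>q\<^sub>1\<^sub>0\<close>, \<open>p\<^sub>0\<^sub>1\<close>, while every
  nonzero \<open>\<mu>\<^sup>3\<close> involves one of the others, so only \<open>\<mu>\<^sup>2\<close> contributes. The generators of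
  \<open>(W\<^sub>k, L\<^sub>l)\<close> are the labellings of the arc components of the closure with the marked component
  labelled \<open>x\<close>: for \<open>k = l\<close> the unearringed arc closes up to a further circle, labelled \<open>1\<close> for
  \<open>\<alpha>, \<rho>\<close> and \<open>x\<close> for \<open>\<beta>, \<sigma>\<close>, and for \<open>k \<noteq> l\<close> both arcs form the marked circle. This bijection
  of bases matches the two differentials.

  The planarity needed is the checkerboard colouring: it orients all resolutions compatibly, so a
  change of smoothing composes a permutation with a transposition and always merges two
  components or splits one. For the same reason the closure complex is a cube of oriented
  cobordisms, whence the differential squares to zero.\<close>

section \<open>Components of partial injections\<close>

text \<open>Checking d^2 = 0 directly would mean running through every configuration of components
  on a square of surgeries. Dualising avoids this: a functional on labellings is pulled back to
  squarefree monomials in variables attached to the nodes, and the set of nodes is the same at all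
  four corners. A merge then acts as the identity and a split as multiplication by x_a + x_b, so
  most squares commute because multiplications do. Only the squares where one crossing is a merge on
  one route and a split on the other need an argument, namely that nodes of one component share a
  variable. For this reason components are handled as functions sending a node to its class, and no
  circles are matched across resolutions. On the tangle side nothing is squared: its coefficients
  are compared with those of the closure one crossing at a time, and d^2 = 0 and the bidegree are
  transported back. The morphism \<open>C0\<close> or \<open>C1\<close> is multiplication by x on
  the extra circle present for k = l; for k \<noteq> l it acts as zero, because the unearringed arc
  then belongs to the marked circle, whose label x is killed by x.\<close>

lemma conn_refl [simp]: "conn E x x"
  by (simp add: conn_def)

lemma conn_sym: "conn E x y \<Longrightarrow> conn E y x"
proof -
  have "symp (\<lambda>a b. E a b \<or> E b a)\<^sup>*\<^sup>*" by (intro symp_rtranclp sympI) auto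
  then show "conn E x y \<Longrightarrow> conn E y x" unfolding conn_def by (rule sympD)
qed

lemma conn_trans: "conn E x y \<Longrightarrow> conn E y z \<Longrightarrow> conn E x z"
  unfolding conn_def by (rule rtranclp_trans)

lemma conn_edge: "E x y \<Longrightarrow> conn E x y" "E x y \<Longrightarrow> conn E y x"
  unfolding conn_def by (auto intro: r_into_rtranclp)

lemma conn_induct [consumes 1, case_names refl step]:
  assumes "conn E x y" and "P x"
    and "\<And>y z. conn E x y \<Longrightarrow> E y z \<or> E z y \<Longrightarrow> P y \<Longrightarrow> P z"
  shows "P y"
  using assms(1) unfolding conn_def
  by (induction rule: rtranclp_induct) (use assms in \<open>auto simp: conn_def\<close>)

lemma comp_of_eq_iff: "comp_of E x = comp_of E y \<longleftrightarrow> conn E x y"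
proof
  assume "comp_of E x = comp_of E y"
  then have "y \<in> comp_of E x" by (simp add: comp_of_def)
  then show "conn E x y" by (simp add: comp_of_def)
next
  assume "conn E x y"
  then have "conn E x z \<longleftrightarrow> conn E y z" for z
    using conn_trans[of E x y z] conn_trans[of E y x z] conn_sym[of E x y] by blast
  then show "comp_of E x = comp_of E y" by (simp add: comp_of_def)
qed

lemma in_comp_of: "y \<in> comp_of E x \<longleftrightarrow> conn E x y"
  by (simp add: comp_of_def)

lemma conn_mono:
  assumes "\<And>x y. E x y \<Longrightarrow> conn H x y" and "conn E x y"
  shows "conn H x y"
  using assms(2)
proof (induction rule: conn_induct)
  case (step y z)
  then have "conn H y z" using assms(1)[of y z] conn_sym[OF assms(1)[of z y]] by blast
  with step(3) show ?case by (rule conn_trans)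
qed simp

lemma conn_cong:
  assumes "\<And>x y. E x y \<Longrightarrow> conn H x y" "\<And>x y. H x y \<Longrightarrow> conn E x y"
  shows "conn E = conn H"
  using conn_mono[OF assms(1)] conn_mono[OF assms(2)] by (intro ext iffI)

lemma conn_converse: "conn (\<lambda>x y. E y x) = conn E"
  by (rule conn_cong) (auto intro: conn_edge)

section \<open>Partitions presented as class functions\<close>

definition part_fun :: "('a \<Rightarrow> 'a set) \<Rightarrow> bool" where
  "part_fun f \<longleftrightarrow> (\<forall>x. x \<in> f x) \<and> (\<forall>x y. y \<in> f x \<longrightarrow> f y = f x)"

text \<open>A merge of two distinct classes, with the finer partition as first argument. A split is
  the same relation read backwards.\<close>

definition joined :: "('a \<Rightarrow> 'a set) \<Rightarrow> ('a \<Rightarrow> 'a set) \<Rightarrow> 'a \<Rightarrow> 'a \<Rightarrow> bool" where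
  "joined f f' a b \<longleftrightarrow> f a \<noteq> f b \<and> f' = (\<lambda>x. if x \<in> f a \<union> f b then f a \<union> f b else f x)"

lemma part_fun_comp_of: "part_fun (comp_of E)"
proof -
  have "conn E y x" if "conn E x y" for x y using that by (rule conn_sym)
  then show ?thesis by (simp add: part_fun_def in_comp_of comp_of_eq_iff)
qed

text \<open>The union of the two old components is closed under \<open>G\<close>-connection. A path
  in \<open>H\<close> is therefore either a path of \<open>G\<close> throughout or stays inside this
  union, which the connection of \<open>p\<close> and \<open>q\<close> makes into one class.\<close>

lemma comp_of_join:
  assumes "\<And>x y. G x y \<Longrightarrow> conn H x y"
    and "\<And>x y. H x y \<Longrightarrow> conn G x y \<or> (x \<in> comp_of G p \<union> comp_of G q \<and> y \<in> comp_of G p \<union> comp_of G q)"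
    and "conn H p q"
  shows "comp_of H x = (if x \<in> comp_of G p \<union> comp_of G q then comp_of G p \<union> comp_of G q else comp_of G x)"
proof -
  let ?U = "comp_of G p \<union> comp_of G q"
  have U: "y \<in> ?U" if "conn G x y" "x \<in> ?U" for x y
    using that conn_trans[of G p x y] conn_trans[of G q x y] unfolding Un_iff in_comp_of by blast
  have 1: "conn G x y \<or> (x \<in> ?U \<and> y \<in> ?U)" if "conn H x y" for x y
    using that
  proof (induction rule: conn_induct)
    case (step y z)
    then consider "conn G y z" | "y \<in> ?U" "z \<in> ?U"
      using assms(2)[of y z] assms(2)[of z y] conn_sym[of G z y] by blast
    then show ?case
    proof cases
      case 1 then show ?thesis using step(3) U[of y z] conn_trans[of G x y z] by blast
    next
      case 2 then show ?thesis using step(3) U[of y x] conn_sym[of G x y] by blast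
    qed
  qed simp
  have G: "conn H x y" if "conn G x y" for x y using conn_mono[OF assms(1) that] .
  have 2: "conn H x y" if "x \<in> ?U" "y \<in> ?U" for x y
  proof -
    have "conn H p z" if "z \<in> ?U" for z
      using that G[of p z] G[of q z] conn_trans[OF assms(3), of z] unfolding Un_iff in_comp_of by blast
    then show ?thesis using that conn_sym[of H p x] conn_trans[of H x p y] by blast
  qed
  show ?thesis
  proof (cases "x \<in> ?U")
    case True
    have "comp_of H x = ?U"
    proof (rule set_eqI)
      fix y show "y \<in> comp_of H x \<longleftrightarrow> y \<in> ?U"
        unfolding in_comp_of[of y H] using 1[of x y] 2[of x y] U[of x y] True by blast
    qed
    with True show ?thesis by simp
  next
    case False
    have "comp_of H x = comp_of G x"
      unfolding set_eq_iff in_comp_of using 1 G False by blast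
    with False show ?thesis by simp
  qed
qed

section \<open>Directed paths and cycles of a partial injection\<close>

definition pinj :: "(node \<Rightarrow> node \<Rightarrow> bool) \<Rightarrow> bool" where
  "pinj E \<longleftrightarrow> (\<forall>x y z. E x y \<longrightarrow> E x z \<longrightarrow> y = z) \<and> (\<forall>x y z. E x z \<longrightarrow> E y z \<longrightarrow> x = y)"

lemma pinj_converse: "pinj (\<lambda>x y. E y x) = pinj E"
  unfolding pinj_def by auto

text \<open>An undirected walk from a source gains nothing by stepping backwards: by injectivity
  such a step undoes the last edge of the directed path, and at the source itself it is
  impossible.\<close>

lemma source_reaches:
  assumes "pinj E" "\<And>x. \<not> E x s" "conn E s y"
  shows "E\<^sup>*\<^sup>* s y"
  using assms(3)
proof (induction rule: conn_induct)
  case (step y z)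
  then show ?case
  proof (elim disjE)
    assume "E z y" "E\<^sup>*\<^sup>* s y"
    then show ?thesis
      using assms by (metis pinj_def rtranclp.cases)
  qed auto
qed auto

lemma source_unique:
  assumes "pinj E" "\<And>x. \<not> E x s" "\<And>x. \<not> E x s'" "conn E s s'"
  shows "s = s'"
  using source_reaches[of E s s'] assms by (metis rtranclp.cases)

lemma sink_unique:
  assumes "pinj E" "\<And>x. \<not> E s x" "\<And>x. \<not> E s' x" "conn E s s'"
  shows "s = s'"
proof (rule source_unique[of "\<lambda>x y. E y x"])
  show "pinj (\<lambda>x y. E y x)" using assms(1) by (rule pinj_converse[THEN iffD2])
  show "conn (\<lambda>x y. E y x) s s'" using assms(4) by (subst conn_converse)
qed (fact assms(2,3))+

lemma conn_stays:
  assumes "\<And>x y. E x y \<Longrightarrow> x \<in> N \<and> y \<in> N" "s \<in> N" "conn E s y"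
  shows "y \<in> N"
  using assms(3)
proof (induction rule: conn_induct)
  case (step y z)
  then show ?case using assms(1)[of y z] assms(1)[of z y] by blast
qed (fact assms(2))

text \<open>Without a sink in the component, the successor map would be an injection of a finite set
  into itself, hence onto, and the source would have a predecessor.\<close>

lemma source_has_sink:
  assumes "pinj E" "\<And>x. \<not> E x s" "finite N" "\<And>x y. E x y \<Longrightarrow> x \<in> N \<and> y \<in> N" "s \<in> N"
  obtains y where "conn E s y" "y \<in> N" "\<And>x. \<not> E y x"
proof (rule ccontr)
  assume *: "\<not> thesis"
  let ?C = "{y. conn E s y}"
  have CN: "?C \<subseteq> N" using conn_stays[of E N s, OF assms(4,5)] by blast
  then have fin: "finite ?C" using assms(3) finite_subset by blast
  have "\<forall>y\<in>?C. \<exists>x. E y x" using CN * that by (metis mem_Collect_eq subsetD)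
  then obtain f where f: "\<And>y. y \<in> ?C \<Longrightarrow> E y (f y)" by metis
  have "f ` ?C \<subseteq> ?C"
  proof
    fix z assume "z \<in> f ` ?C"
    then obtain y where "conn E s y" "z = f y" by blast
    then show "z \<in> ?C" using f[of y] conn_edge(1)[of E y "f y"] conn_trans[of E s y "f y"] by simp
  qed
  moreover have "inj_on f ?C" using f assms(1) unfolding pinj_def inj_on_def by metis
  ultimately have "f ` ?C = ?C" using fin by (simp add: endo_inj_surj)
  then have "s \<in> f ` ?C" by simp
  then obtain y where "conn E s y" "s = f y" by blast
  then show False using f[of y] assms(2)[of y] by simp
qed

text \<open>Removing the edges leaving \<open>a\<close> and \<open>b\<close> cuts the permutation \<open>E\<close> into two paths, whose
  ends can be reconnected in exactly two ways compatible with the orientation.\<close>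

lemma reconnect_joined:
  assumes "pinj E" "finite N" "\<And>x y. E x y \<Longrightarrow> x \<in> N \<and> y \<in> N" "\<And>x. x \<in> N \<Longrightarrow> \<exists>y. E x y"
    and "a \<noteq> b" "E a a'" "E b b'"
    and E': "\<And>x y. E' x y \<longleftrightarrow> (if x = a then y = b' else if x = b then y = a' else E x y)"
  shows "(joined (comp_of E) (comp_of E') a b \<or> joined (comp_of E') (comp_of E) a b) \<and>
    {a', b'} \<subseteq> comp_of E a \<union> comp_of E b \<and> {a', b'} \<subseteq> comp_of E' a \<union> comp_of E' b"
proof -
  define G where "G = (\<lambda>x y. E x y \<and> x \<noteq> a \<and> x \<noteq> b)"
  have G: "pinj G" using assms(1) unfolding pinj_def G_def by blast
  have N: "a \<in> N" "b \<in> N" "a' \<in> N" "b' \<in> N" using assms by auto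
  have GN: "x \<in> N \<and> y \<in> N" if "G x y" for x y using that assms(3)[of x y] by (simp add: G_def)
  have ab': "a' \<noteq> b'" using assms(1,5-7) unfolding pinj_def by blast
  have src: "\<not> G x a'" "\<not> G x b'" for x using assms(1,6,7) unfolding pinj_def G_def by blast+
  have snk: "\<not> G a x" "\<not> G b x" for x by (auto simp: G_def)
  have snk': "x = a \<or> x = b" if "x \<in> N" "\<And>y. \<not> G x y" for x
    using that assms(4)[of x] unfolding G_def by blast
  obtain u where u: "conn G a' u" "u = a \<or> u = b"
    using source_has_sink[OF G src(1) assms(2) GN N(3)] snk' by metis
  obtain v where v: "conn G b' v" "v = a \<or> v = b"
    using source_has_sink[OF G src(2) assms(2) GN N(4)] snk' by metis
  have nab: "\<not> conn G a b" using sink_unique[OF G snk] assms(5) by blast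
  have nab': "\<not> conn G a' b'" using source_unique[OF G src] ab' by blast
  have uv: "u \<noteq> v" using nab' conn_trans[OF u(1)] conn_sym[OF v(1)] by blast
  \<comment> \<open>\<open>H1\<close> closes each of the two paths of \<open>G\<close> on itself, so
    it has the components of \<open>G\<close>; \<open>H2\<close> splices the paths into one cycle.
    Which of \<open>E\<close> and \<open>E'\<close> plays \<open>H1\<close> depends on whether the
    path starting at \<open>a'\<close> ends at \<open>a\<close> or at \<open>b\<close>, so the claim
    is stated for both.\<close>
  have *: "conn H1 = conn G \<and> joined (comp_of H1) (comp_of H2) a b \<and> conn H1 a p \<and> conn H1 b q
       \<and> conn H2 a p \<and> conn H2 a q"
    if H: "\<And>x y. H1 x y \<longleftrightarrow> (if x = a then y = p else if x = b then y = q else E x y)"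
      "\<And>x y. H2 x y \<longleftrightarrow> (if x = a then y = q else if x = b then y = p else E x y)"
      "conn G p a" "conn G q b" for H1 H2 p q
  proof -
    have c: "conn H1 = conn G"
    proof (rule conn_cong)
      fix x y assume "H1 x y"
      then show "conn G x y" using H(1)[of x y] conn_edge(1)[of G x y] conn_sym[OF H(3)] conn_sym[OF H(4)]
        by (auto simp: G_def split: if_splits)
    next
      fix x y assume "G x y"
      then show "conn H1 x y" using H by (intro conn_edge) (auto simp: G_def)
    qed
    have gh: "conn H2 x y" if "G x y" for x y
      using that H by (intro conn_edge) (auto simp: G_def)
    have gh': "conn H2 x y" if "conn G x y" for x y
      using conn_mono[OF gh that] .
    have e: "conn H2 a q" "conn H2 b p" using H(2) assms(5) by (simp_all add: conn_edge(1))
    have j1: "comp_of H2 x = (if x \<in> comp_of G a \<union> comp_of G b then comp_of G a \<union> comp_of G b else comp_of G x)" for x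
    proof (rule comp_of_join)
      show "conn H2 x y" if "G x y" for x y using gh[OF that] .
      show "conn H2 a b" using conn_trans[OF e(1) gh'[OF H(4)]] .
      fix x y assume "H2 x y"
      then show "conn G x y \<or> x \<in> comp_of G a \<union> comp_of G b \<and> y \<in> comp_of G a \<union> comp_of G b"
        using H(2)[of x y] conn_edge(1)[of G x y] conn_sym[OF H(3)] conn_sym[OF H(4)]
        by (auto simp: G_def in_comp_of split: if_splits)
    qed
    have j2: "comp_of H1 = comp_of G" unfolding comp_of_def c ..
    have "comp_of G a \<noteq> comp_of G b" using nab comp_of_eq_iff by blast
    with j1 j2 have "joined (comp_of H1) (comp_of H2) a b"
      unfolding joined_def by (intro conjI ext) simp_all
    moreover have "conn H1 a p" "conn H1 b q" "conn H2 a p" 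
      using c conn_sym[OF H(3)] conn_sym[OF H(4)] gh' by simp_all
    ultimately show ?thesis using c e(1) by blast
  qed
  have E: "E x y \<longleftrightarrow> (if x = a then y = a' else if x = b then y = b' else E x y)" for x y
    using assms(1,6,7) unfolding pinj_def by metis
  have E2: "E' x y \<longleftrightarrow> (if x = a then y = b' else if x = b then y = a' else E x y)" for x y
    by (rule E')
  show ?thesis
  proof (cases "u = a")
    case True
    with u v uv have "conn G a' a" "conn G b' b" by auto
    from *[OF E E2 this] show ?thesis by (auto simp: in_comp_of)
  next
    case False
    with u v uv have "conn G b' a" "conn G a' b" by auto
    from *[OF E2 E this] show ?thesis by (auto simp: in_comp_of)
  qed
qed

section \<open>Orientation of the resolved diagrams\<close>

definition uedge :: "slice \<Rightarrow> bool \<Rightarrow> nat \<Rightarrow> nat \<Rightarrow> node \<Rightarrow> node \<Rightarrow> bool" where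
  "uedge s r w l a b \<longleftrightarrow> sedge s r w l a b \<or> sedge s r w l b a"

text \<open>Resolved strands are oriented upwards at even and downwards at odd positions (the
  boundary orientation of the checkerboard colouring), so both smoothings of a crossing
  respect the orientation.\<close>

definition isout :: "nat \<Rightarrow> node \<Rightarrow> bool" where
  "isout l a \<longleftrightarrow> (fst a = l \<and> even (snd a)) \<or> (fst a = Suc l \<and> odd (snd a))"

definition slots :: "slice \<Rightarrow> nat \<Rightarrow> nat \<Rightarrow> node set" where
  "slots s w l = {l} \<times> {..<w} \<union> {Suc l} \<times> {..<swidth s w}"

lemma sedge_slots:
  assumes "slice_ok s w" "sedge s r w l a b"
  shows "a \<in> slots s w l \<and> b \<in> slots s w l"
  using assms by (cases s) (auto simp: slots_def split: if_splits)

lemma uedge_slots: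
  assumes "slice_ok s w" "uedge s r w l a b"
  shows "a \<in> slots s w l" "b \<in> slots s w l"
  using sedge_slots assms unfolding uedge_def by blast+

text \<open>An edge of a slice either changes level and keeps the parity of the position (shifts are
  by 0 or 2), or stays on its level and joins neighbouring positions.\<close>

lemma sedge_parity:
  assumes "slice_ok s w" "sedge s r w l a b"
  shows "isout l a \<noteq> isout l b"
  using assms by (cases s) (auto simp: isout_def split: if_splits)

lemma uedge_parity:
  assumes "slice_ok s w" "uedge s r w l a b"
  shows "isout l b \<longleftrightarrow> \<not> isout l a"
  using sedge_parity assms unfolding uedge_def by blast

text \<open>Together with \<open>uedge_total\<close> this says that a resolved slice is a perfect
  matching of the points on its two boundary lines.\<close>

lemma uedge_unique:
  assumes "slice_ok s w" "uedge s r w l a b" "uedge s r w l a c"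
  shows "b = c"
proof (cases s)
  case (Cup j)
  with assms show ?thesis by (auto simp: uedge_def split: if_splits)
next
  case (Cap j)
  with assms show ?thesis by (auto simp: uedge_def split: if_splits)
next
  case (Cross j ov)
  with assms show ?thesis by (auto simp: uedge_def split: if_splits)
qed

lemma uedge_total:
  assumes "slice_ok s w" "a \<in> slots s w l"
  shows "\<exists>b. uedge s r w l a b"
proof -
  obtain m p where a: "a = (m, p)" by fastforce
  show ?thesis
  proof (cases s)
    case (Cup j)
    have "uedge s r w l a (Suc l, if p < j then p else p + 2)" if "m = l"
      using that assms Cup a by (auto simp: uedge_def slots_def)
    moreover have "uedge s r w l a (if p = j then (Suc l, Suc j) else if p = Suc j then (Suc l, j)
        else (l, if p < j then p else p - 2))" if "m = Suc l"
      using that assms Cup a by (auto simp: uedge_def slots_def)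
    moreover have "m = l \<or> m = Suc l" using assms(2) a by (auto simp: slots_def)
    ultimately show ?thesis by blast
  next
    case (Cap j)
    have "uedge s r w l a (if p = j then (l, Suc j) else if p = Suc j then (l, j)
        else (Suc l, if p < j then p else p - 2))" if "m = l"
      using that assms Cap a by (auto simp: uedge_def slots_def)
    moreover have "uedge s r w l a (l, if p < j then p else p + 2)" if "m = Suc l"
      using that assms Cap a by (auto simp: uedge_def slots_def)
    moreover have "m = l \<or> m = Suc l" using assms(2) a by (auto simp: slots_def)
    ultimately show ?thesis by blast
  next
    case (Cross j ov)
    let ?m = "if m = l then Suc l else l"
    have "uedge s r w l a (if p = j then (if ov = (\<not> r) then (?m, j) else (m, Suc j))
      else if p = Suc j then (if ov = (\<not> r) then (?m, Suc j) else (m, j)) else (?m, p))"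
      using assms Cross a by (auto simp: uedge_def slots_def)
    then show ?thesis by blast
  qed
qed

section \<open>Directed edges of resolutions and closures\<close>

definition dedge :: "slice list \<Rightarrow> nat set \<Rightarrow> node \<Rightarrow> node \<Rightarrow> bool" where
  "dedge D R a b \<longleftrightarrow> (\<exists>l < length D. uedge (D ! l) (l \<in> R) (wid D l) l a b \<and> isout l a)"

text \<open>Both closing tangles join top positions of opposite parity, so both can be directed from
  the even ends, where strands leave the disk, to the odd ends, where they enter it.\<close>

definition dcap :: "slice list \<Rightarrow> nat \<Rightarrow> node \<Rightarrow> node \<Rightarrow> bool" where
  "dcap D k a b \<longleftrightarrow> (let t = length D in
     if k = 0 then (a = (t, 0) \<and> b = (t, 3)) \<or> (a = (t, 2) \<and> b = (t, 1))
     else (a = (t, 2) \<and> b = (t, 3)) \<or> (a = (t, 0) \<and> b = (t, 1)))"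

definition dcedge :: "slice list \<Rightarrow> nat \<Rightarrow> nat set \<Rightarrow> node \<Rightarrow> node \<Rightarrow> bool" where
  "dcedge D k R a b \<longleftrightarrow> dedge D R a b \<or> dcap D k a b"

lemma valid_slice: "valid_diagram D \<Longrightarrow> l < length D \<Longrightarrow> slice_ok (D ! l) (wid D l)"
  by (simp add: valid_diagram_def)

lemma slots_nodes:
  "l < length D \<Longrightarrow> a \<in> slots (D ! l) (wid D l) l \<longleftrightarrow> a \<in> nodes D \<and> (fst a = l \<or> fst a = Suc l)"
  by (cases a) (auto simp: slots_def nodes_def)

lemma finite_nodes: "finite (nodes D)"
proof -
  have "nodes D = (\<Union>l\<le>length D. {l} \<times> {..<wid D l})" by (auto simp: nodes_def)
  then show ?thesis by simp
qed

lemma top_nodes: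
  "valid_diagram D \<Longrightarrow> (length D, p) \<in> nodes D \<longleftrightarrow> p < 4"
  by (auto simp: nodes_def valid_diagram_def)

lemma conn_dedge:
  assumes "valid_diagram D"
  shows "conn (dedge D R) = conn (tedge D R)"
proof (rule conn_cong)
  fix x y assume "dedge D R x y"
  then have "tedge D R x y \<or> tedge D R y x" unfolding dedge_def tedge_def uedge_def by blast
  then show "conn (tedge D R) x y" using conn_edge by blast
next
  fix x y assume "tedge D R x y"
  then obtain l where l: "l < length D" "sedge (D ! l) (l \<in> R) (wid D l) l x y"
    unfolding tedge_def by blast
  then have "dedge D R x y \<or> dedge D R y x"
    using sedge_parity[OF valid_slice[OF assms l(1)] l(2)] unfolding dedge_def uedge_def by blast
  then show "conn (dedge D R) x y" using conn_edge by blast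
qed

lemma conn_dcedge:
  assumes "valid_diagram D"
  shows "conn (dcedge D k R) = conn (cedge D k R)"
proof (rule conn_cong)
  fix x y assume "dcedge D k R x y"
  then consider "dedge D R x y" | "dcap D k x y" unfolding dcedge_def by blast
  then show "conn (cedge D k R) x y"
  proof cases
    case 1
    then have "cedge D k R x y \<or> cedge D k R y x" unfolding dedge_def cedge_def tedge_def uedge_def by blast
    then show ?thesis using conn_edge by blast
  next
    case 2
    then have "cedge D k R x y \<or> cedge D k R y x" by (auto simp: dcap_def cedge_def Let_def split: if_splits)
    then show ?thesis using conn_edge by blast
  qed
next
  fix x y assume "cedge D k R x y"
  then consider "tedge D R x y" | "dcap D k x y \<or> dcap D k y x"
    by (auto simp: dcap_def cedge_def Let_def split: if_splits)
  then show "conn (dcedge D k R) x y"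
  proof cases
    case 1
    then have c: "conn (dedge D R) x y" using conn_edge(1) by (metis conn_dedge[OF assms])
    show ?thesis by (rule conn_mono[OF conn_edge(1) c]) (simp add: dcedge_def)
  next
    case 2
    then have "dcedge D k R x y \<or> dcedge D k R y x" unfolding dcedge_def by blast
    then show ?thesis using conn_edge by blast
  qed
qed

lemma dedge_nodes:
  assumes "valid_diagram D" "dedge D R a b"
  shows "a \<in> nodes D \<and> b \<in> nodes D"
  using assms(2) uedge_slots[OF valid_slice[OF assms(1)]] slots_nodes unfolding dedge_def by blast

lemma dcap_nodes: "valid_diagram D \<Longrightarrow> dcap D k a b \<Longrightarrow> a \<in> nodes D \<and> b \<in> nodes D"
  by (auto simp: dcap_def Let_def top_nodes split: if_splits)

lemma dcedge_nodes: "valid_diagram D \<Longrightarrow> dcedge D k R a b \<Longrightarrow> a \<in> nodes D \<and> b \<in> nodes D"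
  unfolding dcedge_def using dedge_nodes dcap_nodes by blast

lemma dedge_no_out: "even p \<Longrightarrow> \<not> dedge D R (length D, p) y"
  by (auto simp: dedge_def isout_def)

lemma dedge_in:
  assumes "valid_diagram D" "l < length D" "uedge (D ! l) (l \<in> R) (wid D l) l a b" "isout l a"
  shows "(fst b = l \<and> odd (snd b)) \<or> (fst b = Suc l \<and> even (snd b))"
proof -
  have "\<not> isout l b" using uedge_parity[OF valid_slice[OF assms(1,2)] assms(3)] assms(4) by simp
  moreover have "fst b = l \<or> fst b = Suc l"
    using uedge_slots(2)[OF valid_slice[OF assms(1,2)] assms(3)] slots_nodes[OF assms(2)] by blast
  ultimately show ?thesis unfolding isout_def by auto
qed

lemma dedge_no_in:
  assumes "valid_diagram D" "odd p"
  shows "\<not> dedge D R x (length D, p)"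
proof
  assume "dedge D R x (length D, p)"
  then obtain l where l: "l < length D" "uedge (D ! l) (l \<in> R) (wid D l) l x (length D, p)" "isout l x"
    unfolding dedge_def by blast
  then show False using dedge_in[OF assms(1) l] assms(2) by simp
qed

text \<open>The parity of a node decides which adjacent slice contains its outgoing edge and which
  its incoming one. Uniqueness thus reduces to the matching inside one slice.\<close>

lemma pinj_dedge:
  assumes "valid_diagram D"
  shows "pinj (dedge D R)"
  unfolding pinj_def
proof (intro conjI allI impI)
  fix x y z assume "dedge D R x y" "dedge D R x z"
  then obtain l l' where l: "l < length D" "uedge (D ! l) (l \<in> R) (wid D l) l x y" "isout l x"
    and l': "l' < length D" "uedge (D ! l') (l' \<in> R) (wid D l') l' x z" "isout l' x"
    unfolding dedge_def by blast
  have "l' = l" using l(3) l'(3) by (auto simp: isout_def)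
  then show "y = z" using uedge_unique[OF valid_slice[OF assms]] l l' by blast
next
  fix x y z assume "dedge D R x z" "dedge D R y z"
  then obtain l l' where l: "l < length D" "uedge (D ! l) (l \<in> R) (wid D l) l x z" "isout l x"
    and l': "l' < length D" "uedge (D ! l') (l' \<in> R) (wid D l') l' y z" "isout l' y"
    unfolding dedge_def by blast
  have "l' = l" using dedge_in[OF assms l] dedge_in[OF assms l'] by auto
  moreover have "uedge (D ! l) (l \<in> R) (wid D l) l z x" "uedge (D ! l') (l' \<in> R) (wid D l') l' z y"
    using l l' unfolding uedge_def by blast+
  ultimately show "x = y" using uedge_unique[OF valid_slice[OF assms]] l by blast
qed

text \<open>A closing arc starts only where the tangle has no outgoing edge and ends only where it
  has no incoming one, so the two partial injections do not collide.\<close>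

lemma pinj_dcedge:
  assumes "valid_diagram D"
  shows "pinj (dcedge D k R)"
proof -
  have P: "(dedge D R x y \<longrightarrow> dedge D R x z \<longrightarrow> y = z) \<and> (dedge D R x z \<longrightarrow> dedge D R y z \<longrightarrow> x = y)"
    for x y z using pinj_dedge[OF assms] unfolding pinj_def by blast
  have o: "\<not> dedge D R x z" if "dcap D k x y" for x y z
    using that dedge_no_out[of 0] dedge_no_out[of 2] by (simp add: dcap_def Let_def split: if_splits) blast+
  have i: "\<not> dedge D R z y" if "dcap D k x y" for x y z
    using that dedge_no_in[OF assms, of 1] dedge_no_in[OF assms, of 3]
    by (simp add: dcap_def Let_def split: if_splits) blast+
  have c: "(dcap D k x y \<longrightarrow> dcap D k x z \<longrightarrow> y = z) \<and> (dcap D k x z \<longrightarrow> dcap D k y z \<longrightarrow> x = y)" for x y z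
    by (auto simp: dcap_def Let_def)
  show ?thesis unfolding pinj_def dcedge_def using P o i c by metis
qed

lemma dedge_ex_out:
  assumes "valid_diagram D" "(m, p) \<in> nodes D" "m = length D \<Longrightarrow> odd p"
  shows "\<exists>y. dedge D R (m, p) y"
proof -
  \<comment> \<open>Level 0 has no points, so there is a slice below every odd node; it contains the
    outgoing edge, as the slice above does for even nodes.\<close>
  have m: "m \<noteq> 0" if "odd p" using assms(2) that by (cases m) (auto simp: nodes_def)
  have ml: "m < length D \<or> m = length D" using assms(2) by (auto simp: nodes_def)
  define l where "l = (if even p then m else m - 1)"
  have l: "l < length D" "isout l (m, p)" "m = l \<or> m = Suc l"
    using ml assms(3) m by (auto simp: l_def isout_def)
  have "(m, p) \<in> slots (D ! l) (wid D l) l" using slots_nodes[OF l(1)] l(3) assms(2) by simp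
  then show ?thesis
    using uedge_total[OF valid_slice[OF assms(1) l(1)]] l(1,2) unfolding dedge_def by blast
qed

lemma less4_cases: "(p::nat) < 4 \<Longrightarrow> p = 0 \<or> p = 1 \<or> p = 2 \<or> p = 3"
  by auto

text \<open>The closing arcs supply the edges missing at the even top positions. The directed
  closure is then a permutation of the finite node set, as \<open>reconnect_joined\<close>
  requires.\<close>

lemma dcedge_ex_out:
  assumes "valid_diagram D" "a \<in> nodes D"
  shows "\<exists>y. dcedge D k R a y"
proof -
  obtain m p where a: "a = (m, p)" by fastforce
  show ?thesis
  proof (cases "m = length D \<and> even p")
    case True
    then have "p = 0 \<or> p = 2" using assms a less4_cases[of p] top_nodes by auto
    then show ?thesis using True a by (auto simp: dcedge_def dcap_def Let_def)
  next
    case False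
    then show ?thesis using dedge_ex_out[OF assms(1), of m p R] assms(2) a unfolding dcedge_def by blast
  qed
qed

text \<open>The starting points of the two edges at the crossing \<open>c\<close>; they are the same in both resolutions.\<close>

definition outA :: "slice list \<Rightarrow> nat \<Rightarrow> node" where
  "outA D c = (let j = cpos (D ! c) in if even j then (c, j) else (c, Suc j))"

definition outB :: "slice list \<Rightarrow> nat \<Rightarrow> node" where
  "outB D c = (let j = cpos (D ! c) in if even j then (Suc c, Suc j) else (Suc c, j))"

text \<open>The outgoing corners lie on one diagonal of the crossing and the incoming corners on the
  other. The two smoothings are the two bijections between these pairs, so changing the resolution
  exchanges the targets.\<close>

lemma crossing_edges:
  assumes "c \<in> crossings D"
  shows "\<exists>a' b'. loc D c = {outA D c, outB D c, a', b'} \<and>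
    dedge D (R - {c}) (outA D c) a' \<and> dedge D (R - {c}) (outB D c) b' \<and>
    dedge D (insert c R) (outA D c) b' \<and> dedge D (insert c R) (outB D c) a'"
proof -
  obtain j ov where c: "c < length D" "D ! c = Cross j ov"
    using assms by (auto simp: crossings_def is_cross_def split: slice.splits)
  let ?x = "if even j then (Suc c, j) else (Suc c, Suc j)"
  let ?y = "if even j then (c, Suc j) else (c, j)"
  have "loc D c = {outA D c, outB D c, ?x, ?y}"
    using c by (auto simp: loc_def outA_def outB_def cpos_def Let_def)
  moreover have A: "dedge D R' (outA D c) (if ov = (c \<notin> R') then ?x else ?y)" for R'
    unfolding dedge_def using c(1)
    by (intro exI[of _ c] conjI)
      (cases "even j"; simp add: c(2) outA_def cpos_def Let_def uedge_def isout_def)+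
  moreover have B: "dedge D R' (outB D c) (if ov = (c \<notin> R') then ?y else ?x)" for R'
    unfolding dedge_def using c(1)
    by (intro exI[of _ c] conjI)
      (cases "even j"; simp add: c(2) outB_def cpos_def Let_def uedge_def isout_def)+
  ultimately show ?thesis
    using A[of "R - {c}"] A[of "insert c R"] B[of "R - {c}"] B[of "insert c R"]
    by (cases ov) (auto simp only: insert_commute insertI1 Diff_iff singletonI if_True if_False
        simp_thms)
qed

lemma crossing_other_edges:
  assumes "valid_diagram D" "c \<in> crossings D" "x \<noteq> outA D c" "x \<noteq> outB D c"
  shows "dedge D (R - {c}) x y \<longleftrightarrow> dedge D (insert c R) x y"
proof -
  obtain j ov where c: "c < length D" "D ! c = Cross j ov"
    using assms by (auto simp: crossings_def is_cross_def split: slice.splits)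
  have "uedge (D ! l) (l \<in> R - {c}) (wid D l) l x y \<and> isout l x \<longleftrightarrow>
        uedge (D ! l) (l \<in> insert c R) (wid D l) l x y \<and> isout l x" for l
  proof (cases "l = c \<and> isout l x")
    case True
    obtain m p where x: "x = (m, p)" by fastforce
    have "x \<notin> {(c, j), (c, Suc j), (Suc c, j), (Suc c, Suc j)}"
      using True assms(3,4) c x by (cases "even j") (auto simp: outA_def outB_def cpos_def Let_def isout_def)
    then show ?thesis using True c by (auto simp: uedge_def)
  next
    case False
    then show ?thesis by (cases "l = c") auto
  qed
  then show ?thesis unfolding dedge_def by blast
qed

definition cof :: "slice list \<Rightarrow> nat \<Rightarrow> nat set \<Rightarrow> node \<Rightarrow> comp" where
  "cof D k R = comp_of (cedge D k R)"

text \<open>\<open>reconnect_joined\<close> applied to the exchange of targets at \<open>c\<close>.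
  The orientation rules out a surgery of one circle into one circle; the inclusions of
  \<open>loc D c\<close> ensure that no further component is involved.\<close>

lemma cof_joined:
  assumes "valid_diagram D" "c \<in> crossings D" "c \<notin> R"
  shows "(joined (cof D k R) (cof D k (insert c R)) (outA D c) (outB D c) \<or>
      joined (cof D k (insert c R)) (cof D k R) (outA D c) (outB D c)) \<and>
    loc D c \<subseteq> cof D k R (outA D c) \<union> cof D k R (outB D c) \<and>
    loc D c \<subseteq> cof D k (insert c R) (outA D c) \<union> cof D k (insert c R) (outB D c)"
proof -
  have R: "R - {c} = R" using assms(3) by simp
  let ?a = "outA D c" and ?b = "outB D c"
  obtain a' b' where loc: "loc D c = {?a, ?b, a', b'}"
    and e: "dcedge D k R ?a a'" "dcedge D k R ?b b'"
      "dcedge D k (insert c R) ?a b'" "dcedge D k (insert c R) ?b a'"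
    using crossing_edges[OF assms(2), of R] unfolding R dcedge_def by blast
  have ab: "?a \<noteq> ?b" by (simp add: outA_def outB_def Let_def)
  have E: "dcedge D k (insert c R) x y \<longleftrightarrow>
      (if x = ?a then y = b' else if x = ?b then y = a' else dcedge D k R x y)" for x y
  proof (cases "x = ?a \<or> x = ?b")
    case True
    then show ?thesis using e(3,4) ab pinj_dcedge[OF assms(1), of k "insert c R"]
      unfolding pinj_def by metis
  next
    case False
    then show ?thesis using crossing_other_edges[OF assms(1,2), of x R y] R unfolding dcedge_def by simp
  qed
  have *: "comp_of (dcedge D k R) = cof D k R" for R
    unfolding cof_def comp_of_def conn_dcedge[OF assms(1)] ..
  have "x \<in> cof D k R x" for x R unfolding cof_def in_comp_of by simp
  moreover have "(joined (comp_of (dcedge D k R)) (comp_of (dcedge D k (insert c R))) ?a ?b \<or>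
      joined (comp_of (dcedge D k (insert c R))) (comp_of (dcedge D k R)) ?a ?b) \<and>
    {a', b'} \<subseteq> comp_of (dcedge D k R) ?a \<union> comp_of (dcedge D k R) ?b \<and>
    {a', b'} \<subseteq> comp_of (dcedge D k (insert c R)) ?a \<union> comp_of (dcedge D k (insert c R)) ?b"
    by (rule reconnect_joined[OF pinj_dcedge[OF assms(1)] finite_nodes _ _ ab e(1,2) E])
      (use dcedge_nodes[OF assms(1)] dcedge_ex_out[OF assms(1)] in blast)+
  ultimately show ?thesis unfolding * loc by blast
qed

section \<open>The transposed merge and split maps\<close>

lemma part_fun_cof: "part_fun (cof D k R)"
  unfolding cof_def by (rule part_fun_comp_of)

lemma part_funD:
  assumes "part_fun f"
  shows "x \<in> f x" "y \<in> f x \<Longrightarrow> f y = f x"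
  using assms unfolding part_fun_def by blast+

lemma joinedD:
  assumes "part_fun f" "joined f f' a b"
  shows "f a \<noteq> f b" "f a \<inter> f b = {}" "f' x = (if x \<in> f a \<union> f b then f a \<union> f b else f x)"
    "x \<in> f a \<union> f b \<longleftrightarrow> f x = f a \<or> f x = f b" "f x \<noteq> f a \<union> f b" "f' x \<noteq> f a" "f' x \<noteq> f b"
    "f' x = f a \<union> f b \<longleftrightarrow> x \<in> f a \<union> f b"
proof -
  note p = part_funD[OF assms(1)]
  show 1: "f a \<noteq> f b" using assms(2) unfolding joined_def by blast
  show 2: "f a \<inter> f b = {}" using 1 p(2) by blast
  have 3: "f' y = (if y \<in> f a \<union> f b then f a \<union> f b else f y)" for y
    using assms(2) unfolding joined_def by simp
  show "f' x = (if x \<in> f a \<union> f b then f a \<union> f b else f x)" by (rule 3)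
  show 4: "x \<in> f a \<union> f b \<longleftrightarrow> f x = f a \<or> f x = f b" using p by blast
  \<comment> \<open>A class containing both \<open>a\<close> and \<open>b\<close> would equal each
    of their classes.\<close>
  have ab: "f y \<noteq> f a \<union> f b" for y
  proof
    assume "f y = f a \<union> f b"
    then have "a \<in> f y" "b \<in> f y" using p(1) by blast+
    then show False using 1 p(2) by metis
  qed
  show "f x \<noteq> f a \<union> f b" by (rule ab)
  show "f' x \<noteq> f a" using 3[of x] ab[of a] p by (metis Un_iff)
  show "f' x \<noteq> f b" using 3[of x] ab[of b] p by (metis Un_iff)
  show "f' x = f a \<union> f b \<longleftrightarrow> x \<in> f a \<union> f b" using 3[of x] ab[of x] by simp
qed

lemma joined_eq:
  assumes "part_fun f" "joined f f' a b" "f x = f y"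
  shows "f' x = f' y"
  using joinedD(3,4)[OF assms(1,2), of x] joinedD(3,4)[OF assms(1,2), of y] assms(3) by simp

lemma joined_image:
  assumes "part_fun f" "joined f f' a b" "a \<in> Y \<or> b \<in> Y"
  shows "f' ` Y = f ` Y - {f a, f b} \<union> {f a \<union> f b}"
proof (rule set_eqI)
  note j = joinedD[OF assms(1,2)]
  fix C
  have "f' a = f a \<union> f b" "f' b = f a \<union> f b" using j(8) part_funD(1)[OF assms(1)] by blast+
  then have U: "f a \<union> f b \<in> f' ` Y" using assms(3) image_eqI[of "f a \<union> f b" f' a Y] image_eqI[of "f a \<union> f b" f' b Y] by blast
  show "C \<in> f' ` Y \<longleftrightarrow> C \<in> f ` Y - {f a, f b} \<union> {f a \<union> f b}"
  proof
    assume "C \<in> f' ` Y"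
    then obtain y where "y \<in> Y" "C = f' y" by blast
    then show "C \<in> f ` Y - {f a, f b} \<union> {f a \<union> f b}" using j(3,4)[of y] by auto
  next
    assume "C \<in> f ` Y - {f a, f b} \<union> {f a \<union> f b}"
    then consider y where "y \<in> Y" "C = f y" "C \<noteq> f a" "C \<noteq> f b" | "C = f a \<union> f b" by blast
    then show "C \<in> f' ` Y"
    proof cases
      case (1 y)
      then have "C = f' y" using j(3,4)[of y] by simp
      with 1 show ?thesis by blast
    qed (use U in simp)
  qed
qed

lemma joined_card:
  assumes "part_fun f" "joined f f' a b" "a \<in> N" "b \<in> N" "finite N"
  shows "card (f ` N) = Suc (card (f' ` N))"
proof -
  note j = joinedD[OF assms(1,2)]
  have "card (f ` N) = card (f ` N - {f a, f b}) + card {f a, f b}"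
    using assms(3-5) by (subst card_Un_disjoint[symmetric]) (auto intro: arg_cong[where f = card])
  moreover have "card (f ` N - {f a, f b} \<union> {f a \<union> f b}) = Suc (card (f ` N - {f a, f b}))"
    using j(5) assms(5) by (subst card_Un_disjoint) auto
  ultimately show ?thesis using joined_image[OF assms(1,2)] assms(3) j(1) by simp
qed

text \<open>All nodes of \<open>L\<close> lie in the two surgered classes, so a class meeting
  \<open>L\<close> is one of them, or their union after the merge.\<close>

lemma joined_involved:
  assumes "part_fun f" "joined f f' a b" "L \<subseteq> f a \<union> f b" "{a, b} \<subseteq> L" "L \<subseteq> N"
  shows "involved (f ` N) L = {f a, f b}" "involved (f' ` N) L = {f a \<union> f b}"
proof -
  note j = joinedD[OF assms(1,2)] and p = part_funD[OF assms(1)]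
  show "involved (f ` N) L = {f a, f b}"
  proof (intro subset_antisym subsetI)
    fix C assume "C \<in> involved (f ` N) L"
    then obtain x y where "C = f x" "y \<in> f x" "y \<in> L" unfolding involved_def by blast
    then show "C \<in> {f a, f b}" using p(2) assms(3) by (metis Un_iff insert_iff subsetD)
  next
    fix C assume "C \<in> {f a, f b}"
    then show "C \<in> involved (f ` N) L" using assms(4,5) p(1) unfolding involved_def by blast
  qed
  have U: "f' a = f a \<union> f b" using j(8)[of a] p(1) by blast
  show "involved (f' ` N) L = {f a \<union> f b}"
  proof (intro subset_antisym subsetI)
    fix C assume "C \<in> involved (f' ` N) L"
    then obtain x y where x: "C = f' x" "y \<in> f' x" "y \<in> L" unfolding involved_def by blast
    then have "x \<in> f a \<union> f b" using j(3)[of x] p(2)[of y x] j(4)[of x] j(4)[of y] assms(3) by (metis subsetD)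
    then show "C \<in> {f a \<union> f b}" using x(1) j(8) by simp
  next
    fix C assume "C \<in> {f a \<union> f b}"
    then show "C \<in> involved (f' ` N) L" using assms(4,5) p(1) U unfolding involved_def by blast
  qed
qed

text \<open>The matrix entry of M or S between two labellings, with \<open>S\<close> and
  \<open>S'\<close> the circles involved before and after. It does not depend on where the circles
  come from, so it serves the tangle and its closure alike.\<close>

definition khm :: "'b set \<Rightarrow> 'b set \<Rightarrow> 'b set \<Rightarrow> 'b set \<Rightarrow> bool" where
  "khm S S' X X' \<longleftrightarrow> X - S = X' - S' \<and>
     (card S = 2 \<and> card S' = 1 \<and> mergeR (card (S \<inter> X)) (S' \<inter> X' \<noteq> {}) \<or>
      card S = 1 \<and> card S' = 2 \<and> splitR (S \<inter> X \<noteq> {}) (card (S' \<inter> X')))"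

lemma card_pair_inter:
  "A \<noteq> B \<Longrightarrow> card ({A, B} \<inter> X) = (if A \<in> X then 1 else 0) + (if B \<in> X then 1 else 0)"
  by (cases "A \<in> X"; cases "B \<in> X") auto

lemma khm_merge:
  assumes "A \<noteq> B" "C \<noteq> A" "C \<noteq> B"
  shows "khm {A, B} {C} X X' \<longleftrightarrow> X - {A, B} = X' - {C} \<and> \<not> (A \<in> X \<and> B \<in> X) \<and> (C \<in> X' \<longleftrightarrow> A \<in> X \<or> B \<in> X)"
  using assms by (auto simp: khm_def mergeR_def card_pair_inter)

lemma khm_split:
  assumes "A \<noteq> B" "C \<noteq> A" "C \<noteq> B"
  shows "khm {C} {A, B} X X' \<longleftrightarrow> X - {C} = X' - {A, B} \<and>
    (if C \<in> X then A \<in> X' \<and> B \<in> X' else (A \<in> X' \<longleftrightarrow> B \<notin> X'))"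
  using assms by (auto simp: khm_def splitR_def card_pair_inter)

text \<open>A functional \<open>h\<close> on \<open>A\<^sup>\<otimes>\<^sup>m\<close> (given by its values on the basis) is viewed as a functional on the
  polynomial ring \<open>F[x_v]\<close> with one variable for each node \<open>v\<close>, via the quotient map which
  identifies the variables of a component and kills all squares. In this picture the transpose of
  a merge is the identity and the transpose of a split is the transpose of the multiplication by
  \<open>x_a + x_b\<close>.\<close>

definition ext_fun :: "('a \<Rightarrow> 'b) \<Rightarrow> ('b set \<Rightarrow> bit) \<Rightarrow> 'a set \<Rightarrow> bit" where
  "ext_fun f h Y = (if inj_on f Y then h (f ` Y) else 0)"

text \<open>Evaluation of \<open>F\<close> on x_a times the monomial of \<open>Y\<close>; the value
  0 encodes that x_a squares to zero.\<close>

definition der :: "'a \<Rightarrow> ('a set \<Rightarrow> bit) \<Rightarrow> 'a set \<Rightarrow> bit" where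
  "der a F Y = (if a \<in> Y then 0 else F (insert a Y))"

definition transp :: "'b set set \<Rightarrow> ('b set \<Rightarrow> 'b set \<Rightarrow> bool) \<Rightarrow> ('b set \<Rightarrow> bit) \<Rightarrow> 'b set \<Rightarrow> bit" where
  "transp P M h X = (\<Sum>X' | X' \<in> P \<and> M X X'. h X')"

lemma insert_if_eq_iff:
  "u \<notin> W \<Longrightarrow> X = W \<union> (if c then {u} else {}) \<longleftrightarrow> W = X - {u} \<and> (u \<in> X \<longleftrightarrow> c)"
  by auto

lemma eq_iff_off_pair:
  "X = Z \<longleftrightarrow> Z - {u, v} = X - {u, v} \<and> (u \<in> X \<longleftrightarrow> u \<in> Z) \<and> (v \<in> X \<longleftrightarrow> v \<in> Z)"
proof
  assume *: "Z - {u, v} = X - {u, v} \<and> (u \<in> X \<longleftrightarrow> u \<in> Z) \<and> (v \<in> X \<longleftrightarrow> v \<in> Z)"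
  show "X = Z"
  proof (rule set_eqI)
    fix x
    have "x \<in> Z - {u, v} \<longleftrightarrow> x \<in> X - {u, v}"
      by (rule arg_cong[where f = "\<lambda>S. x \<in> S"]) (rule conjunct1[OF *])
    then show "x \<in> X \<longleftrightarrow> x \<in> Z" using conjunct2[OF *] by (cases "x = u \<or> x = v") auto
  qed
qed simp

lemma Collect_conj_singleton: "Q a \<Longrightarrow> (\<And>x. P x \<longleftrightarrow> x = a) \<Longrightarrow> {x. Q x \<and> P x} = {a}"
  by auto

lemma Collect_conj_pair: "Q a \<Longrightarrow> Q b \<Longrightarrow> (\<And>x. P x \<longleftrightarrow> x = a \<or> x = b) \<Longrightarrow> {x. Q x \<and> P x} = {a, b}"
  by auto

text \<open>A merge sends the basis labelling \<open>f\<close> Y\<open>to\<close>f'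
  \<open>Y\<close>, unless both merged circles carry x. In that case M gives 0, and
  \<open>f'\<close> fails to be injective on \<open>Y\<close>, so both sides vanish.\<close>

lemma ext_merge:
  assumes "part_fun f" "joined f f' a b" "Y \<subseteq> N"
  shows "ext_fun f (transp (Pow (f' ` N)) (khm {f a, f b} {f a \<union> f b}) h) Y = ext_fun f' h Y"
proof -
  note j = joinedD[OF assms(1,2)] and p = part_funD[OF assms(1)]
  let ?U = "f a \<union> f b"
  have U: "?U \<noteq> f a" "?U \<noteq> f b" using j(5)[of a] j(5)[of b] by auto
  show ?thesis
  proof (cases "inj_on f Y")
    case False
    then obtain x y where xy: "x \<in> Y" "y \<in> Y" "x \<noteq> y" "f x = f y" unfolding inj_on_def by blast
    then have "f' x = f' y" using j(3)[of x] j(3)[of y] j(4)[of x] j(4)[of y] by simp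
    with xy have "\<not> inj_on f' Y" unfolding inj_on_def by blast
    with False show ?thesis by (simp add: ext_fun_def)
  next
    case True
    show ?thesis
    proof (cases "f a \<in> f ` Y \<and> f b \<in> f ` Y")
      case ab: True
      then obtain x y where xy: "x \<in> Y" "y \<in> Y" "f x = f a" "f y = f b" by (metis imageE)
      then have "f' x = f' y" "x \<noteq> y" using j(1) j(3)[of x] j(3)[of y] j(4)[of x] j(4)[of y] by auto
      with xy have "\<not> inj_on f' Y" unfolding inj_on_def by blast
      moreover have "{X'. X' \<in> Pow (f' ` N) \<and> khm {f a, f b} {?U} (f ` Y) X'} = {}"
        using ab by (simp add: khm_merge[OF j(1) U])
      ultimately show ?thesis by (simp add: ext_fun_def transp_def del: Collect_empty_eq)
    next
      case ab: False
      have inj: "inj_on f' Y"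
      proof (rule inj_onI)
        fix x y assume xy: "x \<in> Y" "y \<in> Y" "f' x = f' y"
        then have "f x = f y"
          using ab j(3)[of x] j(3)[of y] j(4)[of x] j(4)[of y] j(5)[of x] j(5)[of y]
          by (metis image_eqI)
        then show "x = y" using True xy unfolding inj_on_def by blast
      qed
      have im: "f' ` Y = f ` Y - {f a, f b} \<union> (if f a \<in> f ` Y \<or> f b \<in> f ` Y then {?U} else {})"
      proof (cases "f a \<in> f ` Y \<or> f b \<in> f ` Y")
        case False
        then have "f' y = f y" if "y \<in> Y" for y using that j(3,4)[of y] by (metis image_eqI)
        then show ?thesis using False by auto
      next
        case T: True
        then obtain u where u: "u \<in> Y" "f u = f a \<or> f u = f b" by (metis imageE)
        have "f' ` Y \<subseteq> f ` Y - {f a, f b} \<union> {?U}" using j(3,4) by auto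
        moreover have "f ` Y - {f a, f b} \<subseteq> f' ` Y"
        proof
          fix C assume "C \<in> f ` Y - {f a, f b}"
          then obtain y where y: "y \<in> Y" "C = f y" "f y \<noteq> f a" "f y \<noteq> f b" by blast
          then have "C = f' y" using j(3,4)[of y] by simp
          with y(1) show "C \<in> f' ` Y" by blast
        qed
        moreover have "?U \<in> f' ` Y" using u j(8)[of u] j(4)[of u] by force
        ultimately show ?thesis using T by auto
      qed
      have "?U \<notin> f ` Y" using j(5) by (metis imageE)
      then have "X' = f' ` Y \<longleftrightarrow> f ` Y - {f a, f b} = X' - {?U} \<and> (?U \<in> X' \<longleftrightarrow> f a \<in> f ` Y \<or> f b \<in> f ` Y)" for X'
        unfolding im by (intro insert_if_eq_iff) blast
      then have "khm {f a, f b} {?U} (f ` Y) X' \<longleftrightarrow> X' = f' ` Y" for X'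
        unfolding khm_merge[OF j(1) U] using ab by simp
      moreover have "f' ` Y \<in> Pow (f' ` N)" using assms(3) by blast
      ultimately have "{X'. X' \<in> Pow (f' ` N) \<and> khm {f a, f b} {?U} (f ` Y) X'} = {f' ` Y}"
        by (intro Collect_conj_singleton)
      then show ?thesis using True inj by (simp add: ext_fun_def transp_def)
    qed
  qed
qed

text \<open>Here \<open>g\<close> is the partition after the split. The map S is multiplication by
  x_a + x_b: it sends 1 to x_a + x_b and x to x_a x_b, one of the two terms vanishing when the
  corresponding half already carries x.\<close>

lemma ext_split:
  assumes "part_fun g" "joined g f a b" "Y \<subseteq> N" "a \<in> N" "b \<in> N"
  shows "ext_fun f (transp (Pow (g ` N)) (khm {g a \<union> g b} {g a, g b}) h) Y =
    der a (ext_fun g h) Y + der b (ext_fun g h) Y"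
proof -
  note j = joinedD[OF assms(1,2)] and p = part_funD[OF assms(1)]
  let ?U = "g a \<union> g b"
  have U: "?U \<noteq> g a" "?U \<noteq> g b" using j(5)[of a] j(5)[of b] by auto
  have fg: "f x = f y" if "g x = g y" for x y using that j(3,4) by simp
  show ?thesis
  proof (cases "inj_on f Y")
    case False
    then obtain x y where xy: "x \<in> Y" "y \<in> Y" "x \<noteq> y" "f x = f y" unfolding inj_on_def by blast
    \<comment> \<open>If two nodes of \<open>Y\<close> share an \<open>f\<close>-class, they either
      share a \<open>g\<close>-class or occupy both halves of the split circle. Then adding
      \<open>a\<close> or \<open>b\<close> repeats a half: (x_a + x_b) x_a x_b = 0.\<close>
    have 0: "der c (ext_fun g h) Y = 0" if "c = a \<or> c = b" for c
    proof -
      have "\<not> inj_on g (insert c Y)" if "c \<notin> Y"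
      proof
        assume i: "inj_on g (insert c Y)"
        then have gxy: "g x \<noteq> g y" using xy unfolding inj_on_def by blast
        then have "x \<in> ?U \<and> y \<in> ?U" using xy(4) j(3)[of x] j(3)[of y] j(5)[of x] j(5)[of y] by metis
        then have "g c = g x \<or> g c = g y" using \<open>c = a \<or> c = b\<close> gxy j(4)[of x] j(4)[of y] by metis
        then show False using i xy that unfolding inj_on_def by (metis insert_iff)
      qed
      then show ?thesis by (simp add: der_def ext_fun_def del: inj_on_insert)
    qed
    then show ?thesis using False by (simp add: ext_fun_def)
  next
    case True
    then have injg: "inj_on g Y" using fg unfolding inj_on_def by blast
    have inj: "inj_on g (insert c Y) \<longleftrightarrow> g c \<notin> g ` Y" if "c \<notin> Y" for c
      using injg that by auto
    have gU: "g ` Y - {g a, g b} = f ` Y - {?U}"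
    proof (intro subset_antisym subsetI)
      fix C assume "C \<in> g ` Y - {g a, g b}"
      then obtain y where "y \<in> Y" "C = g y" "g y \<noteq> g a" "g y \<noteq> g b" by blast
      then show "C \<in> f ` Y - {?U}" using j(3-5)[of y] by (metis Diff_iff image_eqI singletonD)
    next
      fix C assume "C \<in> f ` Y - {?U}"
      then obtain y where "y \<in> Y" "C = f y" "f y \<noteq> ?U" by blast
      then show "C \<in> g ` Y - {g a, g b}" using j(3,4)[of y] by (metis Diff_iff image_eqI insertE singletonD)
    qed
    have fU: "?U \<in> f ` Y \<longleftrightarrow> g a \<in> g ` Y \<or> g b \<in> g ` Y"
    proof -
      have "f y = ?U \<longleftrightarrow> g y = g a \<or> g y = g b" for y using j(4,8)[of y] by simp
      then show ?thesis unfolding image_iff by metis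
    qed
    have not2: "\<not> (g a \<in> g ` Y \<and> g b \<in> g ` Y)"
    proof
      assume "g a \<in> g ` Y \<and> g b \<in> g ` Y"
      then obtain x y where xy: "x \<in> Y" "y \<in> Y" "g x = g a" "g y = g b" by (metis imageE)
      then have "f x = f y" "x \<noteq> y" using j(1) j(3)[of x] j(3)[of y] j(4)[of x] j(4)[of y] by auto
      then show False using True xy unfolding inj_on_def by blast
    qed
    have sub: "g ` insert c Y \<subseteq> g ` N" if "c = a \<or> c = b" for c using assms(3-5) that by blast
    have notY: "c \<notin> Y" if "g c \<notin> g ` Y" for c using that by blast
    have mem: "khm {?U} {g a, g b} (f ` Y) X' \<longleftrightarrow> g ` Y - {g a, g b} = X' - {g a, g b} \<and>
        (if g a \<in> g ` Y \<or> g b \<in> g ` Y then g a \<in> X' \<and> g b \<in> X' else (g a \<in> X' \<longleftrightarrow> g b \<notin> X'))" for X'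
      unfolding khm_split[OF j(1) U] gU fU ..
    have Z: "X' = g ` insert a Y \<longleftrightarrow> g ` Y - {g a, g b} = X' - {g a, g b} \<and> g a \<in> X' \<and> (g b \<in> X' \<longleftrightarrow> g b \<in> g ` Y)"
      "X' = g ` insert b Y \<longleftrightarrow> g ` Y - {g a, g b} = X' - {g a, g b} \<and> g b \<in> X' \<and> (g a \<in> X' \<longleftrightarrow> g a \<in> g ` Y)" for X'
      using eq_iff_off_pair[of X' "g ` insert a Y" "g a" "g b"] eq_iff_off_pair[of X' "g ` insert b Y" "g a" "g b"] j(1)
      by (simp_all add: insert_Diff_if conj_commute)
    let ?S = "{X'. X' \<in> Pow (g ` N) \<and> khm {?U} {g a, g b} (f ` Y) X'}"
    have P: "g ` insert a Y \<in> Pow (g ` N)" "g ` insert b Y \<in> Pow (g ` N)" using sub[of a] sub[of b] by simp_all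
    consider "g a \<in> g ` Y" "g b \<notin> g ` Y" | "g b \<in> g ` Y" "g a \<notin> g ` Y"
      | "g a \<notin> g ` Y" "g b \<notin> g ` Y" using not2 by blast
    then show ?thesis
    proof cases
      case 1
      then have "khm {?U} {g a, g b} (f ` Y) X' \<longleftrightarrow> X' = g ` insert b Y" for X'
        unfolding mem Z by auto
      then have S: "?S = {g ` insert b Y}" by (intro Collect_conj_singleton P)
      have "der a (ext_fun g h) Y = 0" using 1 inj[of a] by (simp add: der_def ext_fun_def)
      moreover have "der b (ext_fun g h) Y = h (g ` insert b Y)"
        using 1 inj[OF notY[of b]] notY[of b] by (simp add: der_def ext_fun_def)
      ultimately show ?thesis unfolding ext_fun_def transp_def S using True by simp
    next
      case 2
      then have "khm {?U} {g a, g b} (f ` Y) X' \<longleftrightarrow> X' = g ` insert a Y" for X'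
        unfolding mem Z by auto
      then have S: "?S = {g ` insert a Y}" by (intro Collect_conj_singleton P)
      have "der b (ext_fun g h) Y = 0" using 2 inj[of b] by (simp add: der_def ext_fun_def)
      moreover have "der a (ext_fun g h) Y = h (g ` insert a Y)"
        using 2 inj[OF notY[of a]] notY[of a] by (simp add: der_def ext_fun_def)
      ultimately show ?thesis unfolding ext_fun_def transp_def S using True by simp
    next
      case 3
      let ?Za = "g ` insert a Y" and ?Zb = "g ` insert b Y"
      from 3 have "khm {?U} {g a, g b} (f ` Y) X' \<longleftrightarrow> X' = ?Za \<or> X' = ?Zb" for X'
        unfolding mem Z by auto
      then have S: "?S = {?Za, ?Zb}" by (intro Collect_conj_pair P)
      have ne: "?Za \<noteq> ?Zb" using 3 j(1) by auto
      have "der a (ext_fun g h) Y = h ?Za" "der b (ext_fun g h) Y = h ?Zb"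
        using 3 inj[OF notY[of a]] notY[of a] inj[OF notY[of b]] notY[of b]
        by (simp_all add: der_def ext_fun_def)
      then show ?thesis unfolding ext_fun_def transp_def S using True ne by simp
    qed
  qed
qed

text \<open>Nodes of one component represent the same variable in the quotient.\<close>

lemma der_ext_eq:
  assumes "f a = f b"
  shows "der a (ext_fun f h) Y = der b (ext_fun f h) Y"
proof (cases "a = b")
  case False
  have "\<not> inj_on f (insert a (insert b Z))" for Z using False assms unfolding inj_on_def by blast
  then have 1: "ext_fun f h (insert a Y) = 0" if "b \<in> Y" for Y using that by (metis ext_fun_def insert_absorb)
  have "\<not> inj_on f (insert b (insert a Z))" for Z using False assms unfolding inj_on_def by blast
  then have 2: "ext_fun f h (insert b Y) = 0" if "a \<in> Y" for Y using that by (metis ext_fun_def insert_absorb)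
  show ?thesis
  proof (cases "a \<in> Y \<or> b \<in> Y")
    case True
    then show ?thesis using 1[of Y] 2[of Y] by (auto simp: der_def)
  next
    case F: False
    then have "inj_on f (insert a Y) = inj_on f (insert b Y)" using assms by simp
    then show ?thesis using F assms by (simp add: der_def ext_fun_def)
  qed
qed simp

lemma der_commute: "der a (der b F) Y = der b (der a F) Y"
  by (auto simp: der_def insert_commute)

lemma der_add: "der a (\<lambda>Y. F Y + G Y) Y = der a F Y + der a G Y"
  by (simp add: der_def)

section \<open>Commuting squares of surgeries\<close>

definition surgery :: "('a \<Rightarrow> 'a set) \<Rightarrow> ('a \<Rightarrow> 'a set) \<Rightarrow> 'a \<Rightarrow> 'a \<Rightarrow> bool" where
  "surgery f f' a b \<longleftrightarrow> joined f f' a b \<or> joined f' f a b"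

definition surgery_mat :: "('a \<Rightarrow> 'a set) \<Rightarrow> ('a \<Rightarrow> 'a set) \<Rightarrow> 'a \<Rightarrow> 'a \<Rightarrow> 'a set set \<Rightarrow> 'a set set \<Rightarrow> bool" where
  "surgery_mat f f' a b = (if joined f f' a b then khm {f a, f b} {f a \<union> f b}
     else khm {f' a \<union> f' b} {f' a, f' b})"

definition surgery_op :: "('a \<Rightarrow> 'a set) \<Rightarrow> ('a \<Rightarrow> 'a set) \<Rightarrow> 'a \<Rightarrow> 'a \<Rightarrow> ('a set \<Rightarrow> bit) \<Rightarrow> 'a set \<Rightarrow> bit" where
  "surgery_op f f' a b F Y = (if joined f f' a b then F Y else der a F Y + der b F Y)"

lemma ext_surgery:
  assumes "part_fun f" "part_fun f'" "surgery f f' a b" "Y \<subseteq> N" "a \<in> N" "b \<in> N"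
  shows "ext_fun f (transp (Pow (f' ` N)) (surgery_mat f f' a b) h) Y = surgery_op f f' a b (ext_fun f' h) Y"
proof (cases "joined f f' a b")
  case True
  then show ?thesis using ext_merge[OF assms(1) True assms(4)] by (simp add: surgery_mat_def surgery_op_def)
next
  case False
  then have "joined f' f a b" using assms(3) by (simp add: surgery_def)
  from ext_split[OF assms(2) this assms(4-6)] show ?thesis
    using False by (simp add: surgery_mat_def surgery_op_def)
qed

lemma der_cong:
  assumes "\<And>Z. Z \<subseteq> N \<Longrightarrow> F Z = G Z" "Y \<subseteq> N" "a \<in> N"
  shows "der a F Y = der a G Y"
  using assms by (simp add: der_def)

lemma surgery_op_cong:
  assumes "\<And>Z. Z \<subseteq> N \<Longrightarrow> F Z = G Z" "Y \<subseteq> N" "a \<in> N" "b \<in> N"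
  shows "surgery_op f f' a b F Y = surgery_op f f' a b G Y"
  using assms der_cong[of N F G Y a] der_cong[of N F G Y b] by (simp add: surgery_op_def)

lemma of_nat_bit_eq_0_iff: "(of_nat n :: bit) = 0 \<longleftrightarrow> even n"
  by (induction n) auto

text \<open>The surgery at \<open>a\<close>, \<open>b\<close> and the one at \<open>p\<close>,
  \<open>q\<close> are done in either order. If each keeps its type in both orders, both routes
  multiply by the same factors; otherwise the factors agree only after passing to the components of
  \<open>f3\<close>.\<close>

lemma surgery_square:
  assumes pf: "part_fun f0" "part_fun f1" "part_fun f2" "part_fun f3"
    and s01: "surgery f0 f1 a b" and s13: "surgery f1 f3 p q"
    and s02: "surgery f0 f2 p q" and s23: "surgery f2 f3 a b"
    and N: "finite N" "a \<in> N" "b \<in> N" "p \<in> N" "q \<in> N"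
  shows "surgery_op f0 f1 a b (surgery_op f1 f3 p q (ext_fun f3 h)) Y =
    surgery_op f0 f2 p q (surgery_op f2 f3 a b (ext_fun f3 h)) Y"
proof -
  let ?F = "ext_fun f3 h"
  let ?j01 = "joined f0 f1 a b" and ?j13 = "joined f1 f3 p q" and ?j02 = "joined f0 f2 p q" and ?j23 = "joined f2 f3 a b"
  have card: "card (f ` N) = (if joined f f' u v then card (f' ` N) + 1 else card (f' ` N) - 1)" "card (f' ` N) > 0"
    if "surgery f f' u v" "part_fun f" "part_fun f'" "u \<in> N" "v \<in> N" for f f' u v
  proof -
    show pos: "card (f' ` N) > 0" using that(4) N(1) by (auto simp: card_gt_0_iff)
    show "card (f ` N) = (if joined f f' u v then card (f' ` N) + 1 else card (f' ` N) - 1)"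
    proof (cases "joined f f' u v")
      case True
      then show ?thesis using joined_card[OF that(2) True that(4,5) N(1)] by simp
    next
      case False
      then have "joined f' f u v" using that(1) by (simp add: surgery_def)
      from joined_card[OF that(3) this that(4,5) N(1)] show ?thesis using False by simp
    qed
  qed
  \<comment> \<open>Both routes go from the components of \<open>f0\<close> to those of
    \<open>f3\<close>, so they contain equally many merges. This leaves the four patterns listed
    below.\<close>
  have cnt: "(if ?j01 then 1 else - 1) + (if ?j13 then 1 else - 1 :: int) = (if ?j02 then 1 else - 1) + (if ?j23 then 1 else - 1)"
  proof -
    have i: "int (card (f ` N)) = int (card (f' ` N)) + (if joined f f' u v then 1 else - 1)"
      if "surgery f f' u v" "part_fun f" "part_fun f'" "u \<in> N" "v \<in> N" for f f' u v
      using card[OF that] by (simp split: if_splits)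
    show ?thesis using i[OF s01 pf(1,2) N(2,3)] i[OF s13 pf(2,4) N(4,5)] i[OF s02 pf(1,3) N(4,5)] i[OF s23 pf(3,4) N(2,3)]
      by linarith
  qed
  have eq0: "der u ?F Y + der v ?F Y = 0" if "f3 u = f3 v" for u v
    using der_ext_eq[of f3 u v h Y] that by simp
  consider "?j01 = ?j02" "?j13 = ?j23" "?j01 = ?j13" | "?j01 = ?j23" "?j13 = ?j02" "?j01 \<noteq> ?j13"
    | "?j01" "?j02" "\<not> ?j13" "\<not> ?j23" | "\<not> ?j01" "\<not> ?j02" "?j13" "?j23"
    using cnt by (cases ?j01; cases ?j13; cases ?j02; cases ?j23) simp_all
  then show ?thesis
  proof cases
    case 1
    show ?thesis
    proof (cases ?j01)
      case True then show ?thesis using 1 by (simp add: surgery_op_def)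
    next
      case False
      then have "surgery_op f1 f3 p q ?F = (\<lambda>Y. der p ?F Y + der q ?F Y)"
        "surgery_op f2 f3 a b ?F = (\<lambda>Y. der a ?F Y + der b ?F Y)"
        using 1 by (simp_all add: surgery_op_def fun_eq_iff)
      then show ?thesis using 1 False
        by (simp only: surgery_op_def if_False der_add der_commute[of p a] der_commute[of p b]
            der_commute[of q a] der_commute[of q b] ac_simps)
    qed
  next
    case 2
    have e: "surgery_op f1 f3 p q ?F = (\<lambda>Y. if ?j13 then ?F Y else der p ?F Y + der q ?F Y)"
      "surgery_op f2 f3 a b ?F = (\<lambda>Y. if ?j23 then ?F Y else der a ?F Y + der b ?F Y)"
      by (simp_all add: surgery_op_def fun_eq_iff)
    show ?thesis unfolding e using 2 by (cases ?j01) (simp_all add: surgery_op_def)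
  next
    \<comment> \<open>Merge then split on both routes, with factors x_a + x_b and x_p + x_q. The
      circle formed first and the circle split afterwards are the same, so \<open>a\<close>,
      \<open>b\<close> and \<open>p\<close>, \<open>q\<close> represent the same two final
      components.\<close>
    case 3
    have j: "joined f3 f1 p q" "joined f3 f2 a b" using 3 s13 s23 by (simp_all add: surgery_def)
    note p1 = part_funD(1)[OF pf(1)] and p4 = part_funD[OF pf(4)]
    have "f1 p = f3 p \<union> f3 q" "f1 q = f3 p \<union> f3 q" using joinedD(8)[OF pf(4) j(1)] p4(1) by (metis Un_iff)+
    moreover have "f0 p \<noteq> f0 q" using 3(2) by (simp add: joined_def)
    ultimately have "p \<in> f0 a \<union> f0 b \<or> q \<in> f0 a \<union> f0 b"
      using joinedD(3)[OF pf(1) 3(1), of p] joinedD(3)[OF pf(1) 3(1), of q] by metis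
    then have "f1 p = f0 a \<union> f0 b \<or> f1 q = f0 a \<union> f0 b" using joinedD(8)[OF pf(1) 3(1)] by blast
    then have "f3 p \<union> f3 q = f0 a \<union> f0 b" using \<open>f1 p = _\<close> \<open>f1 q = _\<close> by simp
    then have "a \<in> f3 p \<union> f3 q" "b \<in> f3 p \<union> f3 q" using p1[of a] p1[of b] by blast+
    then have "f3 a = f3 p \<or> f3 a = f3 q" "f3 b = f3 p \<or> f3 b = f3 q" using p4(2) by blast+
    moreover have "f3 a \<noteq> f3 b" using j(2) by (simp add: joined_def)
    ultimately have "(f3 a = f3 p \<and> f3 b = f3 q) \<or> (f3 a = f3 q \<and> f3 b = f3 p)" by metis
    then have "der a ?F Y + der b ?F Y = der p ?F Y + der q ?F Y"
      using der_ext_eq[of f3 a p h Y] der_ext_eq[of f3 a q h Y] der_ext_eq[of f3 b p h Y] der_ext_eq[of f3 b q h Y]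
      by (auto simp: add.commute)
    then show ?thesis using 3 by (simp add: surgery_op_def)
  next
    \<comment> \<open>Split then merge on both routes: the halves are rejoined in \<open>f3\<close>,
      so x_a = x_b and x_p = x_q there and both factors are 2x = 0.\<close>
    case 4
    have e: "surgery_op f1 f3 p q ?F = ?F" "surgery_op f2 f3 a b ?F = ?F"
      using 4 by (simp_all add: surgery_op_def fun_eq_iff)
    have "f3 p = f3 q" "f3 a = f3 b"
      using joinedD(8)[OF pf(2) 4(3)] joinedD(8)[OF pf(3) 4(4)] part_funD(1)[OF pf(2)] part_funD(1)[OF pf(3)]
      by (metis Un_iff)+
    then show ?thesis unfolding e by (simp only: surgery_op_def 4(1,2) if_False eq0)
  qed
qed

text \<open>Choosing one node in each component of \<open>X\<close> gives a monomial on which the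
  extension returns \<open>h X\<close>, so passing to polynomials loses nothing.\<close>

lemma ext_fun_inject:
  assumes "\<And>Y. Y \<subseteq> N \<Longrightarrow> ext_fun f h Y = ext_fun f h' Y" "X \<subseteq> f ` N"
  shows "h X = h' X"
proof -
  obtain Y where "Y \<subseteq> N" "inj_on f Y" "f ` Y = X" using assms(2) subset_image_inj by metis
  then show ?thesis using assms(1)[of Y] by (simp add: ext_fun_def)
qed

lemma even_square_count:
  assumes pf: "part_fun f0" "part_fun f1" "part_fun f2" "part_fun f3"
    and s: "surgery f0 f1 a b" "surgery f1 f3 p q" "surgery f0 f2 p q" "surgery f2 f3 a b"
    and N: "finite N" "a \<in> N" "b \<in> N" "p \<in> N" "q \<in> N"
    and X: "X \<subseteq> f0 ` N" "X'' \<subseteq> f3 ` N"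
  shows "even (card {X'. X' \<subseteq> f1 ` N \<and> surgery_mat f0 f1 a b X X' \<and> surgery_mat f1 f3 p q X' X''} +
    card {X'. X' \<subseteq> f2 ` N \<and> surgery_mat f0 f2 p q X X' \<and> surgery_mat f2 f3 a b X' X''})"
proof -
  \<comment> \<open>The dual basis vector of \<open>X''\<close>. Its double transpose evaluated at
    \<open>X\<close> is the coefficient of \<open>X''\<close> in the composite, that is, a count of
    intermediate labellings modulo 2.\<close>
  define h where "h = (\<lambda>Z. if Z = X'' then 1 else (0 :: bit))"
  have two: "transp (Pow (f' ` N)) M (transp (Pow (f3 ` N)) M' h) X = of_nat (card {X'. X' \<subseteq> f' ` N \<and> M X X' \<and> M' X' X''})"
    for f' :: "'a \<Rightarrow> 'a set" and M M'
  proof -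
    have fin: "finite (Pow (f ` N))" for f :: "'a \<Rightarrow> 'a set" using N(1) by simp
    have "transp (Pow (f3 ` N)) M' h Z = (if M' Z X'' then 1 else 0)" for Z
    proof -
      have "transp (Pow (f3 ` N)) M' h Z = (\<Sum>X'\<in>{X' \<in> Pow (f3 ` N). M' Z X'}. if X' = X'' then 1 else 0)"
        unfolding transp_def h_def ..
      also have "\<dots> = (if X'' \<in> {X' \<in> Pow (f3 ` N). M' Z X'} then 1 else 0)"
        by (rule sum.delta) (use fin in simp)
      finally show ?thesis using X(2) by simp
    qed
    then have "transp (Pow (f' ` N)) M (transp (Pow (f3 ` N)) M' h) X =
        (\<Sum>X'\<in>{X' \<in> Pow (f' ` N). M X X'}. if M' X' X'' then 1 else 0)"
      unfolding transp_def by simp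
    also have "\<dots> = of_nat (card ({X' \<in> Pow (f' ` N). M X X'} \<inter> {X'. M' X' X''}))"
      by (subst sum.If_cases) (use fin in simp_all)
    also have "{X' \<in> Pow (f' ` N). M X X'} \<inter> {X'. M' X' X''} = {X'. X' \<subseteq> f' ` N \<and> M X X' \<and> M' X' X''}" by blast
    finally show ?thesis .
  qed
  have "transp (Pow (f1 ` N)) (surgery_mat f0 f1 a b) (transp (Pow (f3 ` N)) (surgery_mat f1 f3 p q) h) X =
    transp (Pow (f2 ` N)) (surgery_mat f0 f2 p q) (transp (Pow (f3 ` N)) (surgery_mat f2 f3 a b) h) X"
  proof (rule ext_fun_inject[OF _ X(1)])
    fix Y assume Y: "Y \<subseteq> N"
    have "ext_fun f0 (transp (Pow (f1 ` N)) (surgery_mat f0 f1 a b) (transp (Pow (f3 ` N)) (surgery_mat f1 f3 p q) h)) Y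
      = surgery_op f0 f1 a b (surgery_op f1 f3 p q (ext_fun f3 h)) Y"
      unfolding ext_surgery[OF pf(1,2) s(1) Y N(2,3)]
      by (rule surgery_op_cong[OF ext_surgery[OF pf(2,4) s(2) _ N(4,5)] Y N(2,3)])
    also have "\<dots> = surgery_op f0 f2 p q (surgery_op f2 f3 a b (ext_fun f3 h)) Y"
      by (rule surgery_square[OF pf s N])
    also have "\<dots> = ext_fun f0 (transp (Pow (f2 ` N)) (surgery_mat f0 f2 p q) (transp (Pow (f3 ` N)) (surgery_mat f2 f3 a b) h)) Y"
      unfolding ext_surgery[OF pf(1,3) s(3) Y N(4,5)]
      by (rule surgery_op_cong[OF ext_surgery[OF pf(3,4) s(4) _ N(2,3), symmetric] Y N(4,5)])
    finally show "ext_fun f0 (transp (Pow (f1 ` N)) (surgery_mat f0 f1 a b) (transp (Pow (f3 ` N)) (surgery_mat f1 f3 p q) h)) Y =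
      ext_fun f0 (transp (Pow (f2 ` N)) (surgery_mat f0 f2 p q) (transp (Pow (f3 ` N)) (surgery_mat f2 f3 a b) h)) Y" .
  qed
  then have "(of_nat (card {X'. X' \<subseteq> f1 ` N \<and> surgery_mat f0 f1 a b X X' \<and> surgery_mat f1 f3 p q X' X''} +
    card {X'. X' \<subseteq> f2 ` N \<and> surgery_mat f0 f2 p q X X' \<and> surgery_mat f2 f3 a b X' X''}) :: bit) = 0"
    unfolding two by simp
  then show ?thesis by (simp only: of_nat_bit_eq_0_iff)
qed

section \<open>The reduced Khovanov complex\<close>

lemma ccomps_eq: "ccomps D k R = cof D k R ` nodes D"
  by (simp add: ccomps_def comps_def cof_def)

lemma marked_eq: "marked D k R = cof D k R (length D, 3)"
  by (simp add: marked_def cof_def)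

lemma loc_nodes:
  assumes "valid_diagram D" "c \<in> crossings D"
  shows "loc D c \<subseteq> nodes D" "{outA D c, outB D c} \<subseteq> loc D c"
proof -
  obtain j ov where c: "c < length D" "D ! c = Cross j ov"
    using assms by (auto simp: crossings_def is_cross_def split: slice.splits)
  moreover have "j + 2 \<le> wid D c" using valid_slice[OF assms(1) c(1)] c(2) by simp
  ultimately show "loc D c \<subseteq> nodes D" by (auto simp: loc_def cpos_def nodes_def Let_def)
  show "{outA D c, outB D c} \<subseteq> loc D c" by (auto simp: loc_def outA_def outB_def Let_def)
qed

lemma cof_surgery:
  assumes "valid_diagram D" "c \<in> crossings D" "c \<notin> R"
  shows "surgery (cof D k R) (cof D k (insert c R)) (outA D c) (outB D c)"
  using cof_joined[OF assms, of k] by (simp add: surgery_def)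

lemma involved_joined:
  assumes "valid_diagram D" "c \<in> crossings D" "c \<notin> R"
    and "joined (cof D k R) (cof D k (insert c R)) (outA D c) (outB D c)"
  shows "involved (ccomps D k R) (loc D c) = {cof D k R (outA D c), cof D k R (outB D c)}"
    "involved (ccomps D k (insert c R)) (loc D c) = {cof D k R (outA D c) \<union> cof D k R (outB D c)}"
  unfolding ccomps_eq
  using joined_involved[OF part_fun_cof assms(4) _ loc_nodes(2,1)[OF assms(1,2)]] cof_joined[OF assms(1-3), of k]
  by blast+

lemma involved_joined':
  assumes "valid_diagram D" "c \<in> crossings D" "c \<notin> R"
    and "joined (cof D k (insert c R)) (cof D k R) (outA D c) (outB D c)"
  shows "involved (ccomps D k (insert c R)) (loc D c) =
      {cof D k (insert c R) (outA D c), cof D k (insert c R) (outB D c)}"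
    "involved (ccomps D k R) (loc D c) = {cof D k (insert c R) (outA D c) \<union> cof D k (insert c R) (outB D c)}"
  unfolding ccomps_eq
  using joined_involved[OF part_fun_cof assms(4) _ loc_nodes(2,1)[OF assms(1,2)]] cof_joined[OF assms(1-3), of k]
  by blast+

lemma khm_involved:
  assumes "valid_diagram D" "c \<in> crossings D" "c \<notin> R"
  shows "khm (involved (ccomps D k R) (loc D c)) (involved (ccomps D k (insert c R)) (loc D c)) =
    surgery_mat (cof D k R) (cof D k (insert c R)) (outA D c) (outB D c)"
proof (cases "joined (cof D k R) (cof D k (insert c R)) (outA D c) (outB D c)")
  case True
  then show ?thesis unfolding surgery_mat_def involved_joined[OF assms True] by simp
next
  case False
  then have j: "joined (cof D k (insert c R)) (cof D k R) (outA D c) (outB D c)"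
    using cof_surgery[OF assms, of k] by (simp add: surgery_def)
  show ?thesis unfolding surgery_mat_def involved_joined'[OF assms j] using False by simp
qed

definition khstep :: "slice list \<Rightarrow> nat \<Rightarrow> nat set \<Rightarrow> nat \<Rightarrow> comp set \<Rightarrow> comp set \<Rightarrow> bool" where
  "khstep D k R c = khm (involved (ccomps D k R) (loc D c)) (involved (ccomps D k (insert c R)) (loc D c))"

lemma dKh_iff: "dKh D k (R, X) (R', X') \<longleftrightarrow> (\<exists>c\<in>crossings D - R. R' = insert c R \<and> khstep D k R c X X')"
  by (auto simp: khstep_def khm_def Let_def)

text \<open>A circle labelled x can only merge into a circle labelled x, and splits into two of
  them. Hence the marked label survives and the reduced generators span a subcomplex.\<close>

lemma surgery_mat_mem:
  assumes "part_fun f" "part_fun f'" "surgery f f' a b" "surgery_mat f f' a b X X'" "f z \<in> X"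
  shows "f' z \<in> X'"
proof (cases "joined f f' a b")
  case True
  note j = joinedD[OF assms(1) True]
  have U: "f a \<union> f b \<noteq> f a" "f a \<union> f b \<noteq> f b" using j(5)[of a] j(5)[of b] by auto
  have m: "X - {f a, f b} = X' - {f a \<union> f b}" "f a \<union> f b \<in> X' \<longleftrightarrow> f a \<in> X \<or> f b \<in> X"
    using assms(4) True khm_merge[OF j(1) U, of X X'] by (simp_all add: surgery_mat_def)
  show ?thesis
  proof (cases "z \<in> f a \<union> f b")
    case True
    then show ?thesis using m(2) j(3,4)[of z] assms(5) by auto
  next
    case False
    then have "f z \<in> X - {f a, f b}" using j(4)[of z] assms(5) by simp
    then show ?thesis using False j(3)[of z] m(1) by auto
  qed
next
  case False
  then have "joined f' f a b" using assms(3) by (simp add: surgery_def)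
  note j = joinedD[OF assms(2) this]
  have U: "f' a \<union> f' b \<noteq> f' a" "f' a \<union> f' b \<noteq> f' b" using j(5)[of a] j(5)[of b] by auto
  have m: "X - {f' a \<union> f' b} = X' - {f' a, f' b}" "f' a \<union> f' b \<in> X \<Longrightarrow> f' a \<in> X' \<and> f' b \<in> X'"
    using assms(4) False khm_split[OF j(1) U, of X X'] by (simp_all add: surgery_mat_def)
  show ?thesis
  proof (cases "z \<in> f' a \<union> f' b")
    case True
    then show ?thesis using m(2) j(3,4)[of z] assms(5) by auto
  next
    case F: False
    then have "f z \<in> X - {f' a \<union> f' b}" using j(3)[of z] j(5)[of z] assms(5) by simp
    then show ?thesis using F j(3)[of z] m(1) by auto
  qed
qed

lemma card_split_diff: "finite X \<Longrightarrow> card X = card (X - S) + card (S \<inter> X)"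
  by (metis Int_commute add.commute card_Int_Diff)

text \<open>A merge loses a circle and keeps the number of labels x; a split gains one circle and
  one label x. The degree drops by 1 in both cases.\<close>

lemma surgery_mat_degree:
  assumes "part_fun f" "part_fun f'" "surgery f f' a b" "surgery_mat f f' a b X X'"
    and "finite N" "a \<in> N" "b \<in> N" "X \<subseteq> f ` N" "X' \<subseteq> f' ` N"
  shows "int (card (f' ` N)) - 2 * int (card X') + 1 = int (card (f ` N)) - 2 * int (card X)"
proof -
  have fin: "finite X" "finite X'" 
    using finite_subset[OF assms(8)] finite_subset[OF assms(9)] assms(5) by simp_all
  show ?thesis
  proof (cases "joined f f' a b")
    case True
    note j = joinedD[OF assms(1) True]
    have U: "f a \<union> f b \<noteq> f a" "f a \<union> f b \<noteq> f b" using j(5)[of a] j(5)[of b] by auto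
    have m: "X - {f a, f b} = X' - {f a \<union> f b}" "\<not> (f a \<in> X \<and> f b \<in> X)" "f a \<union> f b \<in> X' \<longleftrightarrow> f a \<in> X \<or> f b \<in> X"
      using assms(4) True khm_merge[OF j(1) U, of X X'] by (simp_all add: surgery_mat_def)
    have "card ({f a, f b} \<inter> X) = card ({f a \<union> f b} \<inter> X')"
      unfolding card_pair_inter[OF j(1)] using m(2,3) by (cases "f a \<union> f b \<in> X'") auto
    then have "card X = card X'"
      unfolding card_split_diff[OF fin(1), of "{f a, f b}"] card_split_diff[OF fin(2), of "{f a \<union> f b}"] m(1)
      by simp
    then show ?thesis using joined_card[OF assms(1) True assms(6,7,5)] by simp
  next
    case False
    then have J: "joined f' f a b" using assms(3) by (simp add: surgery_def)
    note j = joinedD[OF assms(2) J]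
    have U: "f' a \<union> f' b \<noteq> f' a" "f' a \<union> f' b \<noteq> f' b" using j(5)[of a] j(5)[of b] by auto
    have m: "X - {f' a \<union> f' b} = X' - {f' a, f' b}"
      "if f' a \<union> f' b \<in> X then f' a \<in> X' \<and> f' b \<in> X' else (f' a \<in> X' \<longleftrightarrow> f' b \<notin> X')"
      using assms(4) False khm_split[OF j(1) U, of X X'] by (simp_all add: surgery_mat_def)
    have "card ({f' a, f' b} \<inter> X') = Suc (card ({f' a \<union> f' b} \<inter> X))"
      unfolding card_pair_inter[OF j(1)] using m(2) by (cases "f' a \<union> f' b \<in> X") auto
    then have "card X' = Suc (card X)"
      unfolding card_split_diff[OF fin(2), of "{f' a, f' b}"] card_split_diff[OF fin(1), of "{f' a \<union> f' b}"] m(1)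
      by simp
    then show ?thesis using joined_card[OF assms(2) J assms(6,7,5)] by simp
  qed
qed

lemma out_nodes:
  assumes "valid_diagram D" "c \<in> crossings D"
  shows "outA D c \<in> nodes D" "outB D c \<in> nodes D"
  using loc_nodes[OF assms] by blast+

lemma khstep_marked:
  assumes "valid_diagram D" "c \<in> crossings D" "c \<notin> R" "khstep D k R c X X'" "marked D k R \<in> X"
  shows "marked D k (insert c R) \<in> X'"
  using surgery_mat_mem[OF part_fun_cof part_fun_cof cof_surgery[OF assms(1-3)]] assms(4,5)
  unfolding marked_eq khstep_def khm_involved[OF assms(1-3)] by blast

lemma finite_crossings: "finite (crossings D)"
  unfolding crossings_def by simp

lemma dKh_degree:
  assumes "valid_diagram D" "h \<in> GKh D k" "h' \<in> GKh D k" "dKh D k h h'"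
  shows "bidegKh D ori k h' = (fst (bidegKh D ori k h), snd (bidegKh D ori k h) + 1)"
proof -
  obtain R X R' X' where h: "h = (R, X)" "h' = (R', X')" by fastforce
  then obtain c where c: "c \<in> crossings D" "c \<notin> R" "R' = insert c R" "khstep D k R c X X'"
    using assms(4) dKh_iff by blast
  have X: "X \<subseteq> cof D k R ` nodes D" "X' \<subseteq> cof D k R' ` nodes D" "R \<subseteq> crossings D"
    using assms(2,3) h by (auto simp: GKh_def ccomps_eq)
  have "finite R" using X(3) finite_crossings finite_subset by blast
  then have "card R' = Suc (card R)" using c by simp
  moreover have "int (card (cof D k R' ` nodes D)) - 2 * int (card X') + 1 = int (card (cof D k R ` nodes D)) - 2 * int (card X)"
    using surgery_mat_degree[OF part_fun_cof part_fun_cof cof_surgery[OF assms(1) c(1,2)] _ finite_nodes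
      out_nodes[OF assms(1) c(1)] X(1)] c(4) X(2)
    unfolding khstep_def khm_involved[OF assms(1) c(1,2)] c(3) by blast
  ultimately show ?thesis unfolding h by (simp add: ccomps_eq)
qed

text \<open>A nonzero composite adds two crossings \<open>c\<close> and \<open>d\<close>. The
  intermediate generators then lie over \<open>insert c R\<close> or \<open>insert d R\<close>, and
  the two counts add up to the even number of \<open>even_square_count\<close>.\<close>

lemma dKh_square:
  assumes D: "valid_diagram D" and h: "h \<in> GKh D k" "h'' \<in> GKh D k"
  shows "even (card {h' \<in> GKh D k. dKh D k h h' \<and> dKh D k h' h''})"
proof -
  obtain R X R'' X'' where g: "h = (R, X)" "h'' = (R'', X'')" by fastforce
  let ?N = "nodes D"
  let ?A = "{h' \<in> GKh D k. dKh D k h h' \<and> dKh D k h' h''}"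
  have X: "X \<subseteq> cof D k R ` ?N" "marked D k R \<in> X" "R \<subseteq> crossings D" "X'' \<subseteq> cof D k R'' ` ?N"
    using h g by (auto simp: GKh_def ccomps_eq)
  show ?thesis
  proof (cases "\<exists>c\<in>crossings D - R. \<exists>d\<in>crossings D - insert c R. R'' = insert d (insert c R)")
    case False
    have "?A = {}"
    proof (rule ccontr)
      assume "?A \<noteq> {}"
      then obtain R' X' where "dKh D k (R, X) (R', X')" "dKh D k (R', X') (R'', X'')" unfolding g by auto
      then show False using False unfolding dKh_iff by blast
    qed
    then show ?thesis by (simp del: Collect_empty_eq)
  next
    case True
    then obtain c d where cd: "c \<in> crossings D" "c \<notin> R" "d \<in> crossings D" "d \<notin> R" "c \<noteq> d"
      "R'' = insert d (insert c R)" by blast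
    then have R'': "R'' = insert c (insert d R)" and nin: "d \<notin> insert c R" "c \<notin> insert d R" by auto
    define P where "P = (\<lambda>c d. {X'. X' \<subseteq> cof D k (insert c R) ` ?N \<and> khstep D k R c X X' \<and> khstep D k (insert c R) d X' X''})"
    \<comment> \<open>The square count ranges over all labellings of the intermediate closure; those
      that contribute carry x on the marked circle automatically.\<close>
    have sub: "(insert u R, X') \<in> GKh D k" if "u = c \<or> u = d" "X' \<in> P u v" for u v X'
      using that cd X khstep_marked[OF D, of u R k X X'] by (auto simp: GKh_def P_def ccomps_eq)
    have A: "?A = Pair (insert c R) ` P c d \<union> Pair (insert d R) ` P d c"
    proof (intro subset_antisym subsetI)
      fix z assume z: "z \<in> ?A"
      obtain R' X' where zz: "z = (R', X')" by fastforce
      obtain u v where uv: "u \<notin> R" "R' = insert u R" "khstep D k R u X X'" "v \<notin> R'" "R'' = insert v R'" "khstep D k R' v X' X''"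
        using z unfolding zz g by (auto simp only: mem_Collect_eq dKh_iff)
      have X': "X' \<subseteq> cof D k R' ` ?N" using z zz by (auto simp: GKh_def ccomps_eq)
      have "insert v (insert u R) = insert d (insert c R)" using uv(2,5) cd(6) by simp
      then have "u \<in> insert d (insert c R)" "v \<in> insert d (insert c R)" by (metis insertI1 insertI2)+
      then consider "u = c" "v = d" | "u = d" "v = c" using uv(1,2,4) by blast
      then show "z \<in> Pair (insert c R) ` P c d \<union> Pair (insert d R) ` P d c"
      proof cases
        case 1
        then have "X' \<in> P c d" using uv X' unfolding P_def by simp
        then show ?thesis using zz uv(2) 1 by blast
      next
        case 2
        then have "X' \<in> P d c" using uv X' unfolding P_def by simp
        then show ?thesis using zz uv(2) 2 by blast
      qed
    next
      fix z assume "z \<in> Pair (insert c R) ` P c d \<union> Pair (insert d R) ` P d c"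
      then consider X' where "z = (insert c R, X')" "X' \<in> P c d" | X' where "z = (insert d R, X')" "X' \<in> P d c" by blast
      then show "z \<in> ?A"
      proof cases
        case 1
        then have "dKh D k (R, X) z" "dKh D k z (R'', X'')" unfolding 1(1) dKh_iff using cd nin by (auto simp: P_def)
        then show ?thesis using sub[of c X' d] 1 g by simp
      next
        case 2
        then have "dKh D k (R, X) z" "dKh D k z (R'', X'')" unfolding 2(1) dKh_iff using cd(1-5) R'' nin by (auto simp: P_def)
        then show ?thesis using sub[of d X' c] 2 g by simp
      qed
    qed
    have ne: "insert c R \<noteq> insert d R" using cd by blast
    have fin: "finite (P u v)" for u v
      by (rule finite_subset[of _ "Pow (cof D k (insert u R) ` ?N)"]) (auto simp: P_def finite_nodes)
    have im: "card (Pair r ` S) = card S" for r :: "nat set" and S :: "comp set set"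
      by (rule card_image) (simp add: inj_on_def)
    have "card ?A = card (Pair (insert c R) ` P c d) + card (Pair (insert d R) ` P d c)"
      unfolding A by (rule card_Un_disjoint) (use fin ne in auto)
    then have "card ?A = card (P c d) + card (P d c)" unfolding im .
    moreover have "even (card (P c d) + card (P d c))"
      unfolding P_def khstep_def khm_involved[OF D cd(1,2)] khm_involved[OF D cd(3,4)]
        khm_involved[OF D cd(3) nin(1)] khm_involved[OF D cd(1) nin(2), unfolded insert_commute[of c d R]]
        insert_commute[of c d R]
      using even_square_count[OF part_fun_cof part_fun_cof part_fun_cof part_fun_cof
          cof_surgery[OF D cd(1,2)] cof_surgery[OF D cd(3) nin(1)] cof_surgery[OF D cd(3,4)]
          cof_surgery[OF D cd(1) nin(2), unfolded insert_commute[of c d R]]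
          finite_nodes out_nodes[OF D cd(1)] out_nodes[OF D cd(3)] X(1) X(4)[unfolded cd(6)]] .
    ultimately show ?thesis by simp
  qed
qed

section \<open>Arcs of a resolved tangle\<close>

definition tof :: "slice list \<Rightarrow> nat set \<Rightarrow> node \<Rightarrow> comp" where
  "tof D R = comp_of (tedge D R)"

definition earc :: "slice list \<Rightarrow> nat set \<Rightarrow> comp" where
  "earc D R = tof D R (length D, 3)"

text \<open>Top positions 3 and 1 are the two sources of the directed tangle, so position 1 lies on
  the unearringed arc whatever the type of the resolution.\<close>

definition uarc :: "slice list \<Rightarrow> nat set \<Rightarrow> comp" where
  "uarc D R = tof D R (length D, 1)"

lemma part_fun_tof: "part_fun (tof D R)"
  unfolding tof_def by (rule part_fun_comp_of)

lemma tcomps_eq: "tcomps D R = tof D R ` nodes D"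
  by (simp add: tcomps_def comps_def tof_def)

text \<open>The odd top positions are sources and the even ones are the only sinks. Each arc is a
  directed path from a source to a sink, and distinct sources and distinct sinks lie on distinct
  paths.\<close>

lemma arcs:
  assumes D: "valid_diagram D"
  shows "earc D R \<noteq> uarc D R"
    "ltype D R = 0 \<Longrightarrow> (length D, 0) \<in> earc D R \<and> (length D, 2) \<in> uarc D R"
    "ltype D R \<noteq> 0 \<Longrightarrow> (length D, 2) \<in> earc D R \<and> (length D, 0) \<in> uarc D R"
proof -
  let ?t = "length D"
  let ?c = "conn (tedge D R)"
  have ni: "\<not> dedge D R x (?t, 1)" "\<not> dedge D R x (?t, 3)" for x
    using dedge_no_in[OF D] by simp_all
  have no: "\<not> dedge D R (?t, 0) x" "\<not> dedge D R (?t, 2) x" for x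
    using dedge_no_out by simp_all
  have sink: "\<exists>y. ?c s y \<and> (y = (?t, 0) \<or> y = (?t, 2))" if "s = (?t, 1) \<or> s = (?t, 3)" for s
  proof (rule source_has_sink[OF pinj_dedge[OF D, of R], of s "nodes D"])
    show "s \<in> nodes D" using that top_nodes[OF D] by (elim disjE) simp_all
    show "\<not> dedge D R x s" for x using that ni by blast
    show "x \<in> nodes D \<and> y \<in> nodes D" if "dedge D R x y" for x y using dedge_nodes[OF D that] .
    fix y assume y: "conn (dedge D R) s y" "y \<in> nodes D" "\<And>x. \<not> dedge D R y x"
    obtain m p where mp: "y = (m, p)" by fastforce
    have "m = ?t \<and> even p" using y(2,3) dedge_ex_out[OF D, of m p R] unfolding mp by blast
    moreover have "p < 4" using y(2) calculation top_nodes[OF D] unfolding mp by simp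
    ultimately have "y = (?t, 0) \<or> y = (?t, 2)" using mp less4_cases[of p] by auto
    then show ?thesis using y(1) unfolding conn_dedge[OF D] by blast
  qed (rule finite_nodes)
  have ne: "\<not> ?c (?t, 3) (?t, 1)"
    using source_unique[OF pinj_dedge[OF D, of R], of "(?t, 3)" "(?t, 1)", OF ni(2,1)]
    unfolding conn_dedge[OF D] by auto
  have one: "\<not> (?c (?t, 3) y \<and> ?c (?t, 1) y)" for y
    using ne conn_trans[of "tedge D R" "(?t, 3)" y "(?t, 1)"] conn_sym[of "tedge D R" "(?t, 1)" y] by blast
  show "earc D R \<noteq> uarc D R" using ne by (simp add: earc_def uarc_def tof_def comp_of_eq_iff)
  have so: "\<not> (?c y (?t, 0) \<and> ?c y (?t, 2))" for y
  proof
    assume a: "?c y (?t, 0) \<and> ?c y (?t, 2)"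
    have "?c (?t, 0) (?t, 2)" by (rule conn_trans[OF conn_sym]) (use a in blast)+
    then show False
      using sink_unique[OF pinj_dedge[OF D, of R], of "(?t, 0)" "(?t, 2)", OF no]
      unfolding conn_dedge[OF D] by auto
  qed
  have s3: "?c (?t, 3) (?t, 0) \<or> ?c (?t, 3) (?t, 2)" and s1: "?c (?t, 1) (?t, 0) \<or> ?c (?t, 1) (?t, 2)"
    using sink[of "(?t, 3)"] sink[of "(?t, 1)"] by auto
  show "ltype D R = 0 \<Longrightarrow> (?t, 0) \<in> earc D R \<and> (?t, 2) \<in> uarc D R"
    using s1 one[of "(?t, 0)"] by (auto simp: ltype_def earc_def uarc_def tof_def in_comp_of split: if_splits)
  show "ltype D R \<noteq> 0 \<Longrightarrow> (?t, 2) \<in> earc D R \<and> (?t, 0) \<in> uarc D R"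
    using s1 s3 one[of "(?t, 2)"] by (auto simp: ltype_def earc_def uarc_def tof_def in_comp_of split: if_splits)
qed

lemma ltype_le: "ltype D R = 0 \<or> ltype D R = 1"
  by (simp add: ltype_def)

text \<open>For \<open>k\<close> equal to the type, each closing arc joins the two ends of one arc,
  so no components are connected.\<close>

lemma cof_same_type:
  assumes D: "valid_diagram D" and k: "k = ltype D R"
  shows "cof D k R = tof D R"
proof -
  have "conn (cedge D k R) = conn (tedge D R)"
  proof (rule conn_cong)
    fix x y assume "cedge D k R x y"
    then show "conn (tedge D R) x y"
      using arcs(2,3)[OF D, of R] conn_edge(1)[of "tedge D R" x y] conn_sym
      unfolding cedge_def earc_def uarc_def tof_def in_comp_of Let_def k by (auto split: if_splits)
  next
    fix x y assume "tedge D R x y"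
    then show "conn (cedge D k R) x y" by (intro conn_edge) (simp add: cedge_def)
  qed
  then show ?thesis unfolding cof_def tof_def comp_of_def by (simp only:)
qed

text \<open>For the other type each closing arc joins ends of different arcs, which makes the two
  arcs a single component and changes nothing else.\<close>

lemma cof_other_type:
  assumes D: "valid_diagram D" and k: "k \<le> 1" "k \<noteq> ltype D R"
  shows "joined (tof D R) (cof D k R) (length D, 3) (length D, 1)"
proof -
  let ?t = "length D"
  let ?E = "comp_of (tedge D R) (?t, 3)" and ?U = "comp_of (tedge D R) (?t, 1)"
  have a: "ltype D R = 0 \<Longrightarrow> (?t, 0) \<in> ?E \<and> (?t, 2) \<in> ?U"
    "ltype D R \<noteq> 0 \<Longrightarrow> (?t, 2) \<in> ?E \<and> (?t, 0) \<in> ?U"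
    using arcs(2,3)[OF D, of R] unfolding earc_def uarc_def tof_def by blast+
  have s: "(?t, 3) \<in> ?E" "(?t, 1) \<in> ?U" by (simp_all add: in_comp_of)
  have "cof D k R x = (if x \<in> ?E \<union> ?U then ?E \<union> ?U else comp_of (tedge D R) x)" for x
    unfolding cof_def
  proof (rule comp_of_join)
    show m: "conn (cedge D k R) x y" if "tedge D R x y" for x y
      using that by (intro conn_edge) (simp add: cedge_def)
    fix x y
    show "conn (tedge D R) x y \<or> x \<in> ?E \<union> ?U \<and> y \<in> ?E \<union> ?U" if "cedge D k R x y"
    proof -
      from that consider "tedge D R x y" | "x \<in> {(?t, 0), (?t, 1), (?t, 2), (?t, 3)} \<and> y \<in> {(?t, 0), (?t, 1), (?t, 2), (?t, 3)}"
        unfolding cedge_def Let_def by (auto split: if_splits)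
      then show ?thesis
      proof cases
        case 1 then show ?thesis using conn_edge by blast
      next
        case 2 
        have "{(?t, 0), (?t, 1), (?t, 2), (?t, 3)} \<subseteq> ?E \<union> ?U" using a s by blast
        then show ?thesis using 2 by blast
      qed
    qed
    have m': "conn (cedge D k R) x y" if "conn (tedge D R) x y" for x y
      using conn_mono[OF m that] .
    show "conn (cedge D k R) (?t, 3) (?t, 1)"
    proof (cases "k = 0")
      case True
      then have "conn (tedge D R) (?t, 1) (?t, 0)" using k a by (simp add: in_comp_of)
      moreover have "cedge D k R (?t, 3) (?t, 0)" using True by (simp add: cedge_def)
      ultimately show ?thesis using conn_trans[OF conn_edge(1) conn_sym[OF m']] by blast
    next
      case False
      then have "conn (tedge D R) (?t, 1) (?t, 2)" using k ltype_le[of D R] a by (simp add: in_comp_of)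
      moreover have "cedge D k R (?t, 3) (?t, 2)" using False by (simp add: cedge_def)
      ultimately show ?thesis using conn_trans[OF conn_edge(1) conn_sym[OF m']] by blast
    qed
  qed
  then show ?thesis using arcs(1)[OF D, of R] unfolding joined_def tof_def earc_def uarc_def by (simp add: fun_eq_iff)
qed

lemma arcs_tcomps:
  assumes "valid_diagram D"
  shows "earc D R \<in> tcomps D R" "uarc D R \<in> tcomps D R"
  unfolding earc_def uarc_def tcomps_eq using top_nodes[OF assms] by auto

lemma tcircles_eq:
  assumes D: "valid_diagram D"
  shows "tcircles D R = tcomps D R - {earc D R, uarc D R}"
proof -
  let ?t = "length D"
  note p = part_funD[OF part_fun_tof, of _ D R]
  have tops: "tops D = {(?t, 0), (?t, 1), (?t, 2), (?t, 3)}"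
    unfolding tops_def using less4_cases by auto
  have s: "(?t, 3) \<in> earc D R" "(?t, 1) \<in> uarc D R" unfolding earc_def uarc_def by (rule p(1))+
  have 1: "tops D \<subseteq> earc D R \<union> uarc D R"
    using arcs(2,3)[OF D, of R] s unfolding tops by blast
  have "tof D R x \<inter> tops D = {} \<longleftrightarrow> tof D R x \<noteq> earc D R \<and> tof D R x \<noteq> uarc D R" for x
  proof
    assume "tof D R x \<inter> tops D = {}"
    moreover have "(?t, 3) \<in> tops D" "(?t, 1) \<in> tops D" unfolding tops by simp_all
    ultimately show "tof D R x \<noteq> earc D R \<and> tof D R x \<noteq> uarc D R" using s by blast
  next
    assume *: "tof D R x \<noteq> earc D R \<and> tof D R x \<noteq> uarc D R"
    show "tof D R x \<inter> tops D = {}"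
    proof (rule ccontr)
      assume "tof D R x \<inter> tops D \<noteq> {}"
      then obtain y where y: "y \<in> tof D R x" "y \<in> earc D R \<or> y \<in> uarc D R" using 1 by blast
      then have "tof D R y = tof D R x" using p(2) by blast
      moreover have "tof D R y = earc D R \<or> tof D R y = uarc D R"
        using y(2) p(2) unfolding earc_def uarc_def by blast
      ultimately show False using * by simp
    qed
  qed
  then show ?thesis unfolding tcircles_def tcomps_eq by blast
qed

lemma ccomps_cases:
  assumes D: "valid_diagram D" and k: "k \<le> 1"
  shows "k = ltype D R \<Longrightarrow> ccomps D k R = tcircles D R \<union> {earc D R, uarc D R}"
    "k = ltype D R \<Longrightarrow> marked D k R = earc D R"
    "k \<noteq> ltype D R \<Longrightarrow> ccomps D k R = tcircles D R \<union> {earc D R \<union> uarc D R}"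
    "k \<noteq> ltype D R \<Longrightarrow> marked D k R = earc D R \<union> uarc D R"
    "earc D R \<union> uarc D R \<notin> tcomps D R"
proof -
  show "k = ltype D R \<Longrightarrow> ccomps D k R = tcircles D R \<union> {earc D R, uarc D R}"
    using arcs_tcomps[OF D] unfolding tcircles_eq[OF D] ccomps_eq tcomps_eq by (auto simp: cof_same_type[OF D])
  show "k = ltype D R \<Longrightarrow> marked D k R = earc D R"
    unfolding marked_eq earc_def by (simp add: cof_same_type[OF D])
  show "ccomps D k R = tcircles D R \<union> {earc D R \<union> uarc D R}" if "k \<noteq> ltype D R"
    using joined_image[OF part_fun_tof cof_other_type[OF D k that], of "nodes D"] top_nodes[OF D]
    unfolding tcircles_eq[OF D] ccomps_eq tcomps_eq earc_def uarc_def by simp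
  show "marked D k R = earc D R \<union> uarc D R" if "k \<noteq> ltype D R"
    using joinedD(8)[OF part_fun_tof cof_other_type[OF D k that]] part_funD(1)[OF part_fun_tof]
    unfolding marked_eq earc_def uarc_def by blast
  show "earc D R \<union> uarc D R \<notin> tcomps D R"
  proof -
    have "tof D R x \<noteq> earc D R \<union> uarc D R" for x
    proof
      assume "tof D R x = earc D R \<union> uarc D R"
      then have "tof D R x = earc D R" "tof D R x = uarc D R"
        using part_funD[OF part_fun_tof] unfolding earc_def uarc_def by (metis Un_iff)+
      then show False using arcs(1)[OF D, of R] by simp
    qed
    then show ?thesis unfolding tcomps_eq by (metis imageE)
  qed
qed

section \<open>The maps of the tangle cube\<close>

text \<open>The generators for which the circle formed by the unearringed arc carries x.\<close>

definition low :: "pt \<Rightarrow> bool" where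
  "low y \<longleftrightarrow> y = Beta \<or> y = Sigma"

definition kstep :: "slice list \<Rightarrow> nat set \<Rightarrow> nat \<Rightarrow> comp set \<Rightarrow> pt \<Rightarrow> comp set \<Rightarrow> pt \<Rightarrow> bool" where
  "kstep D R c X y X' y' \<longleftrightarrow> (\<exists>p\<in>set (delta D R c). fst p X X' \<and> mu2 (snd p) y = Some y')"

lemma mu2_id:
  assumes "y \<in> modgens k l" "y' \<in> modgens k l" "l = 0 \<or> l = 1"
  shows "mu2 (if l = 0 then A0 else A1) y = Some y' \<longleftrightarrow> (low y \<longleftrightarrow> low y')"
  using assms by (auto simp: mu2_def low_def split: if_splits)

lemma mu2_x:
  assumes "y \<in> modgens k l" "y' \<in> modgens k l" "l = 0 \<or> l = 1" "k \<le> 1"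
  shows "mu2 (if l = 0 then C0 else C1) y = Some y' \<longleftrightarrow> k = l \<and> \<not> low y \<and> low y'"
  using assms by (auto simp: mu2_def low_def split: if_splits)

text \<open>For k = l the saddle merges the extra circle into the marked circle labelled x, which
  kills the label x. For k \<noteq> l it splits the marked circle, and S(x) = x \<otimes> x forces
  the label x.\<close>

lemma mu2_saddle:
  assumes "y \<in> modgens k l" "y' \<in> modgens k l'" "l = 0 \<or> l = 1" "l' = 0 \<or> l' = 1" "l \<noteq> l'" "k \<le> 1"
  shows "mu2 (if l = 0 then Q10 else P01) y = Some y' \<longleftrightarrow> (if k = l then \<not> low y else low y')"
  using assms by (auto simp: mu2_def low_def split: if_splits)

lemma low_type: "y \<in> modgens k l \<Longrightarrow> l = 0 \<or> l = 1 \<Longrightarrow> k \<le> 1 \<Longrightarrow> low y \<Longrightarrow> k = l"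
  by (auto simp: low_def split: if_splits)

lemma card_two: "A \<noteq> B \<Longrightarrow> card {A, B} = 2"
  by simp

section \<open>Matrix entries of the tangle cube and the closure cube for each kind of
  surgery\<close>

lemma kstep_merge_circles:
  assumes "involved (tcomps D R) (loc D c) = {A, B}" "involved (tcomps D (insert c R)) (loc D c) = {C}"
    "A \<noteq> B" "A \<in> tcircles D R" "B \<in> tcircles D R" "C \<in> tcircles D (insert c R)" "ltype D R = l"
  shows "kstep D R c X y X' y' \<longleftrightarrow> khm {A, B} {C} X X' \<and> mu2 (if l = 0 then A0 else A1) y = Some y'"
  using assms by (simp add: kstep_def delta_def khm_def Let_def card_two del: card_insert_disjoint) 

lemma kstep_split_circle:
  assumes "involved (tcomps D R) (loc D c) = {C}" "involved (tcomps D (insert c R)) (loc D c) = {A, B}"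
    "A \<noteq> B" "C \<in> tcircles D R" "A \<in> tcircles D (insert c R)" "B \<in> tcircles D (insert c R)" "ltype D R = l"
  shows "kstep D R c X y X' y' \<longleftrightarrow> khm {C} {A, B} X X' \<and> mu2 (if l = 0 then A0 else A1) y = Some y'"
  using assms by (simp add: kstep_def delta_def khm_def Let_def card_two)

lemma kstep_merge_arc:
  assumes "involved (tcomps D R) (loc D c) = {W, C}" "involved (tcomps D (insert c R)) (loc D c) = {W'}"
    "C \<in> tcircles D R" "W \<notin> tcircles D R" "(length D, 3) \<in> C \<or> (length D, 3) \<in> W \<longleftrightarrow> ear" "ltype D R = l"
    "W \<notin> X" "W' \<notin> X'"
  shows "kstep D R c X y X' y' \<longleftrightarrow> X - {C} = X' \<and>
    (C \<notin> X \<and> mu2 (if l = 0 then A0 else A1) y = Some y' \<or>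
     \<not> ear \<and> C \<in> X \<and> mu2 (if l = 0 then C0 else C1) y = Some y')"
proof -
  have WC: "W \<noteq> C" using assms(3,4) by blast
  have S: "{W, C} \<inter> tcircles D R = {C}" using assms(3,4) by blast
  have X: "X - {W, C} = X' - {W'} \<longleftrightarrow> X - {C} = X'" "{W, C} \<inter> X = {} \<longleftrightarrow> C \<notin> X" using assms(7,8) by auto
  show ?thesis
    unfolding kstep_def delta_def Let_def assms(1,2,6) S using assms(3-8) WC
    by (simp add: X card_two) blast
qed

lemma kstep_split_arc:
  assumes "involved (tcomps D R) (loc D c) = {W}" "involved (tcomps D (insert c R)) (loc D c) = {W', C}"
    "C \<in> tcircles D (insert c R)" "W \<notin> tcircles D R" "W' \<notin> tcircles D (insert c R)"
    "(length D, 3) \<in> W \<longleftrightarrow> ear" "ltype D R = l"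
    "W \<notin> X" "W' \<notin> X'"
  shows "kstep D R c X y X' y' \<longleftrightarrow> X = X' - {C} \<and>
    (C \<in> X' \<and> mu2 (if l = 0 then A0 else A1) y = Some y' \<or>
     \<not> ear \<and> C \<notin> X' \<and> mu2 (if l = 0 then C0 else C1) y = Some y')"
proof -
  have WC: "W' \<noteq> C" using assms(3,5) by blast
  have S: "{W', C} \<inter> tcircles D (insert c R) = {C}" "{W} \<inter> tcircles D R = {}" using assms(3-5) by blast+
  have X: "X - {W} = X' - {W', C} \<longleftrightarrow> X = X' - {C}" "{W', C} \<inter> X' = {} \<longleftrightarrow> C \<notin> X'" using assms(8,9) by auto
  show ?thesis
    unfolding kstep_def delta_def Let_def assms(1,2,7) S using assms(3-9) WC
    by (simp add: X card_two) blast
qed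

lemma kstep_saddle:
  assumes "involved (tcomps D R) (loc D c) = {E, U}" "involved (tcomps D (insert c R)) (loc D c) = {E', U'}"
    "E \<noteq> U" "E \<notin> tcircles D R" "U \<notin> tcircles D R" "ltype D R = l"
    "E \<notin> X" "U \<notin> X" "E' \<notin> X'" "U' \<notin> X'"
  shows "kstep D R c X y X' y' \<longleftrightarrow> X = X' \<and> mu2 (if l = 0 then Q10 else P01) y = Some y'"
proof -
  have S: "{E, U} \<inter> tcircles D R = {}" using assms(4,5) by blast
  have X: "X - {E, U} = X' - {E', U'} \<longleftrightarrow> X = X'" using assms(7-10) by auto
  show ?thesis
    unfolding kstep_def delta_def Let_def assms(1,2,6) S using assms(3-6)
    by (simp add: X card_two)
qed

lemma khm_union:
  assumes "(M \<union> M') \<inter> (X \<union> X') = {}" "(S \<union> S') \<inter> (M \<union> M') = {}"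
  shows "khm S S' (X \<union> M) (X' \<union> M') \<longleftrightarrow> khm S S' X X' \<and> M = M'"
proof -
  have "S \<inter> (X \<union> M) = S \<inter> X" "S' \<inter> (X' \<union> M') = S' \<inter> X'" using assms(2) by blast+
  moreover have "X \<union> M - S = X' \<union> M' - S' \<longleftrightarrow> X - S = X' - S' \<and> M = M'"
  proof -
    have "X \<union> M - S = (X - S) \<union> M" "X' \<union> M' - S' = (X' - S') \<union> M'" using assms(2) by blast+
    moreover have "(X - S) \<union> M = (X' - S') \<union> M' \<longleftrightarrow> X - S = X' - S' \<and> M = M'"
      using assms(1) by blast
    ultimately show ?thesis by simp
  qed
  ultimately show ?thesis unfolding khm_def by auto
qed

text \<open>\<open>W\<close> carries x, so x x = 0 and x 1 = x force the circle \<open>C\<close> to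
  carry 1: this is the map that \<open>delta\<close> assigns to merging a circle into the earringed
  arc. \<open>Q\<close> collects bystander labels.\<close>

lemma khm_merge_arc:
  assumes "W \<notin> Q" "W' \<notin> Q'" "W \<notin> X" "W' \<notin> X'" "C \<notin> Q" "C \<notin> Q'" "C \<noteq> W" "C \<noteq> W'" "W \<noteq> W'"
    "(Q \<union> Q') \<inter> (X \<union> X') = {}"
  shows "khm {W, C} {W'} (X \<union> ({W} \<union> Q)) (X' \<union> ({W'} \<union> Q')) \<longleftrightarrow> X - {C} = X' \<and> C \<notin> X \<and> Q = Q'"
proof -
  have "X \<union> ({W} \<union> Q) - {W, C} = (X - {C}) \<union> Q" "X' \<union> ({W'} \<union> Q') - {W'} = X' \<union> Q'"
    using assms by blast+
  moreover have "(X - {C}) \<union> Q = X' \<union> Q' \<longleftrightarrow> X - {C} = X' \<and> Q = Q'" using assms(10) by blast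
  ultimately have e: "X \<union> ({W} \<union> Q) - {W, C} = X' \<union> ({W'} \<union> Q') - {W'} \<longleftrightarrow> X - {C} = X' \<and> Q = Q'" by simp
  have n: "W \<noteq> C" "W' \<noteq> W" "W' \<noteq> C" using assms by blast+
  show ?thesis unfolding khm_merge[OF n] e using assms by auto
qed

lemma khm_split_arc:
  assumes "W \<notin> Q" "W' \<notin> Q'" "W \<notin> X" "W' \<notin> X'" "C \<notin> Q" "C \<notin> Q'" "C \<noteq> W" "C \<noteq> W'" "W \<noteq> W'"
    "(Q \<union> Q') \<inter> (X \<union> X') = {}"
  shows "khm {W} {W', C} (X \<union> ({W} \<union> Q)) (X' \<union> ({W'} \<union> Q')) \<longleftrightarrow> X = X' - {C} \<and> C \<in> X' \<and> Q = Q'"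
proof -
  have "X \<union> ({W} \<union> Q) - {W} = X \<union> Q" "X' \<union> ({W'} \<union> Q') - {W', C} = (X' - {C}) \<union> Q'"
    using assms by blast+
  moreover have "X \<union> Q = (X' - {C}) \<union> Q' \<longleftrightarrow> X = X' - {C} \<and> Q = Q'" using assms(10) by blast
  ultimately have e: "X \<union> ({W} \<union> Q) - {W} = X' \<union> ({W'} \<union> Q') - {W', C} \<longleftrightarrow> X = X' - {C} \<and> Q = Q'" by simp
  have n: "W' \<noteq> C" "W \<noteq> W'" "W \<noteq> C" using assms by blast+
  show ?thesis unfolding khm_split[OF n] e using assms by auto
qed

text \<open>Multiplying the arc label by the label of \<open>C\<close>: a label 1 is the identity
  (the \<open>a\<close> term), a label x turns 1 into x and kills x (the \<open>c\<close>
  term).\<close>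

lemma khm_merge_uarc:
  assumes "U \<notin> X" "U' \<notin> X'" "E \<notin> X" "E \<notin> X'" "E \<noteq> U" "E \<noteq> U'" "C \<noteq> U" "C \<noteq> U'" "C \<noteq> E" "U \<noteq> U'"
  shows "khm {U, C} {U'} (X \<union> ({E} \<union> (if l then {U} else {}))) (X' \<union> ({E} \<union> (if l' then {U'} else {}))) \<longleftrightarrow>
    X - {C} = X' \<and> (C \<notin> X \<and> (l \<longleftrightarrow> l') \<or> C \<in> X \<and> \<not> l \<and> l')"
proof -
  have "X \<union> ({E} \<union> (if l then {U} else {})) - {U, C} = insert E (X - {C})"
    "X' \<union> ({E} \<union> (if l' then {U'} else {})) - {U'} = insert E X'" using assms by auto
  moreover have "insert E (X - {C}) = insert E X' \<longleftrightarrow> X - {C} = X'" using assms by (intro insert_ident) auto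
  ultimately have e: "X \<union> ({E} \<union> (if l then {U} else {})) - {U, C} = X' \<union> ({E} \<union> (if l' then {U'} else {})) - {U'}
    \<longleftrightarrow> X - {C} = X'" by simp
  have n: "U \<noteq> C" "U' \<noteq> U" "U' \<noteq> C" using assms by blast+
  show ?thesis unfolding khm_merge[OF n] e using assms by auto
qed

text \<open>S(u) = u \<otimes> x + xu \<otimes> 1, with the split-off circle \<open>C\<close> in the
  second factor; the summands are the \<open>a\<close> and the \<open>c\<close> term.\<close>

lemma khm_split_uarc:
  assumes "U \<notin> X" "U' \<notin> X'" "E \<notin> X" "E \<notin> X'" "E \<noteq> U" "E \<noteq> U'" "C \<noteq> U" "C \<noteq> U'" "C \<noteq> E" "U \<noteq> U'"
  shows "khm {U} {U', C} (X \<union> ({E} \<union> (if l then {U} else {}))) (X' \<union> ({E} \<union> (if l' then {U'} else {}))) \<longleftrightarrow>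
    X = X' - {C} \<and> (C \<in> X' \<and> (l \<longleftrightarrow> l') \<or> C \<notin> X' \<and> \<not> l \<and> l')"
proof -
  have "X \<union> ({E} \<union> (if l then {U} else {})) - {U} = insert E X"
    "X' \<union> ({E} \<union> (if l' then {U'} else {})) - {U', C} = insert E (X' - {C})" using assms by auto
  moreover have "insert E X = insert E (X' - {C}) \<longleftrightarrow> X = X' - {C}" using assms by (intro insert_ident) auto
  ultimately have e: "X \<union> ({E} \<union> (if l then {U} else {})) - {U} = X' \<union> ({E} \<union> (if l' then {U'} else {})) - {U', C}
    \<longleftrightarrow> X = X' - {C}" by simp
  have n: "U' \<noteq> C" "U \<noteq> U'" "U \<noteq> C" using assms by blast+
  show ?thesis unfolding khm_split[OF n] e using assms by auto
qed

lemma khm_merge_arcs: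
  assumes "E \<noteq> U" "V \<noteq> E" "V \<noteq> U" "E \<notin> X" "U \<notin> X" "V \<notin> X'"
  shows "khm {E, U} {V} (X \<union> ({E} \<union> (if l then {U} else {}))) (X' \<union> {V}) \<longleftrightarrow> X = X' \<and> \<not> l"
proof -
  have e: "X \<union> ({E} \<union> (if l then {U} else {})) - {E, U} = X" "X' \<union> {V} - {V} = X'" using assms by auto
  show ?thesis unfolding khm_merge[OF assms(1-3)] e using assms by auto
qed

lemma khm_split_arcs:
  assumes "E \<noteq> U" "V \<noteq> E" "V \<noteq> U" "E \<notin> X'" "U \<notin> X'" "V \<notin> X"
  shows "khm {V} {E, U} (X \<union> {V}) (X' \<union> ({E} \<union> (if l then {U} else {}))) \<longleftrightarrow> X = X' \<and> l"
proof -
  have e: "X' \<union> ({E} \<union> (if l then {U} else {})) - {E, U} = X'" "X \<union> {V} - {V} = X" using assms by auto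
  show ?thesis unfolding khm_split[OF assms(1-3)] e using assms by auto
qed

text \<open>\<open>e\<close> and \<open>u\<close> stand for ends of the two arcs. As these remain
  distinct after the merge, at most one arc takes part.\<close>

lemma joined_arc_cases:
  assumes pf: "part_fun T" and J: "joined T T' a b" and ne: "T' e \<noteq> T' u"
  obtains (circles) "T a \<notin> {T e, T u}" "T b \<notin> {T e, T u}" "T a \<union> T b \<notin> {T' e, T' u}" "T' e = T e" "T' u = T u"
  | (earc) C where "C \<in> {T a, T b}" "{T a, T b} = {T e, C}" "T a \<union> T b = T' e" "T' u = T u"
      "C \<notin> {T e, T u}"
  | (uarc) C where "C \<in> {T a, T b}" "{T a, T b} = {T u, C}" "T a \<union> T b = T' u" "T' e = T e"
      "C \<notin> {T e, T u}"
proof -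
  note j = joinedD[OF pf J]
  have U: "T a \<union> T b \<noteq> T a" "T a \<union> T b \<noteq> T b" using j(5)[of a] j(5)[of b] by auto
  have eu: "T e \<noteq> T u" using ne j(3,4) by metis
  have not2: "\<not> (e \<in> T a \<union> T b \<and> u \<in> T a \<union> T b)" using ne j(3) by metis
  consider "e \<notin> T a \<union> T b" "u \<notin> T a \<union> T b" | "e \<in> T a \<union> T b" "u \<notin> T a \<union> T b" | "e \<notin> T a \<union> T b" "u \<in> T a \<union> T b"
    using not2 by blast
  then show thesis
  proof cases
    case 1
    then have E: "T' e = T e" "T' u = T u" using j(3) by metis+
    moreover have "T a \<notin> {T e, T u}" "T b \<notin> {T e, T u}" using 1 j(4) by auto
    moreover have "T a \<union> T b \<notin> {T' e, T' u}" using j(5)[of e] j(5)[of u] E by simp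
    ultimately show thesis by (intro circles)
  next
    case 2
    define C where "C = (if T e = T a then T b else T a)"
    have "T e = T a \<or> T e = T b" using 2 j(4) by blast
    moreover have "T' e = T a \<union> T b" using 2 j(3)[of e] by (simp only: if_True)
    moreover have "T' u = T u" using 2 j(3)[of u] by (simp only: if_False)
    moreover have "T u \<noteq> T a" "T u \<noteq> T b" using 2 j(4) by blast+
    ultimately show thesis using j(1) by (intro earc[of C]) (auto simp: C_def)
  next
    case 3
    define C where "C = (if T u = T a then T b else T a)"
    have "T u = T a \<or> T u = T b" using 3 j(4) by blast
    moreover have "T' u = T a \<union> T b" using 3 j(3)[of u] by (simp only: if_True)
    moreover have "T' e = T e" using 3 j(3)[of e] by (simp only: if_False)
    moreover have "T e \<noteq> T a" "T e \<noteq> T b" using 3 j(4) by blast+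
    ultimately show thesis using j(1) by (intro uarc[of C]) (auto simp: C_def)
  qed
qed


section \<open>Comparison of tangle components with closure components\<close>

definition glue :: "slice list \<Rightarrow> nat \<Rightarrow> nat set \<Rightarrow> comp \<Rightarrow> comp" where
  "glue D k R C = (if k \<noteq> ltype D R \<and> C \<in> {earc D R, uarc D R} then earc D R \<union> uarc D R else C)"

lemma cof_glue:
  assumes D: "valid_diagram D" and k: "k \<le> 1"
  shows "cof D k R x = glue D k R (tof D R x)"
proof (cases "k = ltype D R")
  case True
  then show ?thesis using cof_same_type[OF D True] by (simp add: glue_def)
next
  case False
  from joinedD(3,4)[OF part_fun_tof cof_other_type[OF D k False], of x]
  show ?thesis using False by (simp add: glue_def earc_def uarc_def)
qed

lemma involved_glue:
  assumes D: "valid_diagram D" and k: "k \<le> 1"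
  shows "involved (ccomps D k R) L = glue D k R ` involved (tcomps D R) L"
proof (intro subset_antisym subsetI)
  fix C assume "C \<in> involved (ccomps D k R) L"
  then obtain x where x: "x \<in> nodes D" "C = glue D k R (tof D R x)" "C \<inter> L \<noteq> {}"
    unfolding involved_def ccomps_eq cof_glue[OF D k] by blast
  have "\<exists>C'\<in>tcomps D R. C = glue D k R C' \<and> C' \<inter> L \<noteq> {}"
  proof (cases "k \<noteq> ltype D R \<and> tof D R x \<in> {earc D R, uarc D R}")
    case True
    then have g: "glue D k R (earc D R) = C" "glue D k R (uarc D R) = C" "C = earc D R \<union> uarc D R"
      using x(2) unfolding glue_def by auto
    then consider "earc D R \<inter> L \<noteq> {}" | "uarc D R \<inter> L \<noteq> {}" using x(3) by blast
    then show ?thesis using arcs_tcomps[OF D, of R] g(1,2) by metis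
  next
    case False
    then have "C = tof D R x" using x(2) unfolding glue_def by auto
    then show ?thesis using x unfolding tcomps_eq by (metis imageI)
  qed
  then show "C \<in> glue D k R ` involved (tcomps D R) L" unfolding involved_def by blast
next
  fix C assume "C \<in> glue D k R ` involved (tcomps D R) L"
  then obtain x where x: "x \<in> nodes D" "C = glue D k R (tof D R x)" "tof D R x \<inter> L \<noteq> {}"
    unfolding involved_def tcomps_eq by blast
  have "tof D R x \<subseteq> glue D k R (tof D R x)" unfolding glue_def by auto
  then show "C \<in> involved (ccomps D k R) L"
    using x unfolding involved_def ccomps_eq cof_glue[OF D k] by blast
qed

definition khset :: "slice list \<Rightarrow> nat \<Rightarrow> nat set \<Rightarrow> comp set \<Rightarrow> pt \<Rightarrow> comp set" where
  "khset D k R X y = X \<union> ({marked D k R} \<union> (if low y then {uarc D R} else {}))"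

lemma earc_mem: "(length D, 3) \<in> earc D R" and uarc_mem: "(length D, 1) \<in> uarc D R"
  unfolding earc_def uarc_def by (rule part_funD(1)[OF part_fun_tof])+

lemma tcircles_clean:
  assumes "valid_diagram D" "C \<in> tcircles D R"
  shows "(length D, 3) \<notin> C" "(length D, 1) \<notin> C"
  using assms(2) unfolding tcircles_def tops_def by auto

lemma cof_type: "valid_diagram D \<Longrightarrow> cof D (ltype D R) R = tof D R"
  by (rule cof_same_type) simp_all

text \<open>The comparison at one crossing. If the type is unchanged, the surgery involves circles
  only or exactly one arc; if the type changes, it is a saddle between the two arcs.\<close>

lemma kstep_khstep:
  assumes D: "valid_diagram D" and k: "k \<le> 1" and c: "c \<in> crossings D" "c \<notin> R"
    and X: "X \<subseteq> tcircles D R" "X' \<subseteq> tcircles D (insert c R)"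
    and y: "y \<in> modgens k (ltype D R)" "y' \<in> modgens k (ltype D (insert c R))"
  shows "kstep D R c X y X' y' \<longleftrightarrow> khstep D k R c (khset D k R X y) (khset D k (insert c R) X' y')"
proof -
  let ?R' = "insert c R" and ?e = "(length D, 3)" and ?u = "(length D, 1)"
  let ?a = "outA D c" and ?b = "outB D c"
  define T where "T = tof D R"
  define T' where "T' = tof D ?R'"
  define E where "E = earc D R"
  define U where "U = uarc D R"
  define E' where "E' = earc D ?R'"
  define U' where "U' = uarc D ?R'"
  let ?V = "E \<union> U" and ?V' = "E' \<union> U'"
  let ?l = "ltype D R" and ?l' = "ltype D ?R'"
  note defs = T_def T'_def E_def U_def E'_def U'_def
  have TE: "T ?e = E" "T ?u = U" "T' ?e = E'" "T' ?u = U'" unfolding defs earc_def uarc_def by simp_all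
  have pf: "part_fun T" "part_fun T'" unfolding defs by (rule part_fun_tof)+
  have ne: "E \<noteq> U" "E' \<noteq> U'" unfolding defs by (rule arcs(1)[OF D])+
  have eu: "?e \<in> E" "?u \<in> U" "?e \<in> E'" "?u \<in> U'" unfolding defs by (rule earc_mem uarc_mem)+
  have EU: "?u \<notin> E" "?e \<notin> U" "?u \<notin> E'" "?e \<notin> U'"
    using ne TE part_funD(2)[OF pf(1)] part_funD(2)[OF pf(2)] by metis+
  have cl: "?e \<notin> C" "?u \<notin> C" if "C \<in> tcircles D R \<or> C \<in> tcircles D ?R'" for C
    using that tcircles_clean[OF D] by blast+
  have clX: "?e \<notin> C" "?u \<notin> C" if "C \<in> X \<or> C \<in> X'" for C using that X cl by blast+
  have E: "E \<notin> X" "E' \<notin> X" "E \<notin> X'" "E' \<notin> X'" "U \<notin> X" "U' \<notin> X" "U \<notin> X'" "U' \<notin> X'"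
    "?V \<notin> X" "?V' \<notin> X" "?V \<notin> X'" "?V' \<notin> X'"
    using eu clX by blast+
  have V: "?V \<noteq> E" "?V \<noteq> U" "?V' \<noteq> E'" "?V' \<noteq> U'" using eu EU by blast+
  have circ: "tcircles D R = tcomps D R - {E, U}" "tcircles D ?R' = tcomps D ?R' - {E', U'}"
    unfolding defs by (rule tcircles_eq[OF D])+
  have tc: "tcomps D R = T ` nodes D" "tcomps D ?R' = T' ` nodes D" unfolding defs by (rule tcomps_eq)+
  have l: "?l = 0 \<or> ?l = 1" "?l' = 0 \<or> ?l' = 1" by (rule ltype_le)+
  have low: "k = ?l" if "low y" using low_type[OF y(1) l(1) k that] .
  have low': "k = ?l'" if "low y'" using low_type[OF y(2) l(2) k that] .
  \<comment> \<open>The labels x that the closure puts on components containing arcs. A low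
    generator exists only for k = l, so \<open>low\<close> need not be consulted in the other
    case.\<close>
  define M where "M = (if k = ?l then {E} \<union> (if low y then {U} else {}) else {?V})"
  define M' where "M' = (if k = ?l' then {E'} \<union> (if low y' then {U'} else {}) else {?V'})"
  have kh: "khset D k R X y = X \<union> M" "khset D k ?R' X' y' = X' \<union> M'"
    unfolding khset_def M_def M'_def E_def U_def E'_def U'_def
    using ccomps_cases(2,4)[OF D k] low low' by auto
  have disj: "(M \<union> M') \<inter> (X \<union> X') = {}" unfolding M_def M'_def using E by auto
  have gl: "glue D k R C = (if k \<noteq> ?l \<and> C \<in> {E, U} then ?V else C)"
    "glue D k ?R' C = (if k \<noteq> ?l' \<and> C \<in> {E', U'} then ?V' else C)" for C
    unfolding glue_def defs by (rule refl)+
  define S where "S = involved (tcomps D R) (loc D c)"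
  define S' where "S' = involved (tcomps D ?R') (loc D c)"
  have khs: "khstep D k R c Y Y' \<longleftrightarrow> khm (glue D k R ` S) (glue D k ?R' ` S') Y Y'" for Y Y'
    unfolding khstep_def involved_glue[OF D k] S_def S'_def ..
  \<comment> \<open>The closure of the same type as a resolution has the components of the tangle,
    so the statement about the closure descends.\<close>
  have loc: "loc D c \<subseteq> T ?a \<union> T ?b" "loc D c \<subseteq> T' ?a \<union> T' ?b"
    using cof_joined[OF D c, of ?l] cof_joined[OF D c, of ?l'] unfolding defs cof_type[OF D] by blast+
  have out: "?a \<in> nodes D" "?b \<in> nodes D" by (rule out_nodes[OF D c(1)])+
  note inv = joined_involved[OF _ _ _ loc_nodes(2,1)[OF D c(1)]]
  have clC: "C \<notin> {E, U, E', U', ?V, ?V'}" if "C \<in> tcircles D R \<or> C \<in> tcircles D ?R'" for C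
    using cl[OF that] eu by blast
  have lows: "(if low y then {U} else {}) = (if low y' then {U} else {}) \<longleftrightarrow> (low y \<longleftrightarrow> low y')" by auto
  have Vne: "?V \<noteq> ?V'" if "z \<in> ?V \<longleftrightarrow> z \<notin> ?V'" for z using that by blast
  show ?thesis
  proof (cases "?l' = ?l")
    case True
    \<comment> \<open>As the types agree, the closure of type \<open>?l\<close> leaves both
      resolutions unchanged, and a surgery of closures is one of tangle components.\<close>
    have "joined T T' ?a ?b \<or> joined T' T ?a ?b"
      using cof_surgery[OF D c, of ?l] cof_type[OF D, of R] cof_type[OF D, of ?R']
      unfolding surgery_def defs True by simp
    then show ?thesis
    proof
      assume J: "joined T T' ?a ?b"
      have S: "S = {T ?a, T ?b}" "S' = {T ?a \<union> T ?b}"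
        unfolding S_def S'_def tc by (rule inv[OF pf(1) J loc(1)])+
      have Sne: "T ?a \<noteq> T ?b" using J by (simp add: joined_def)
      have U: "T ?a \<union> T ?b \<in> tcomps D ?R'"
        using joinedD(8)[OF pf(1) J, of ?a] part_funD(1)[OF pf(1), of ?a] out unfolding tc by (metis UnI1 imageI)
      from ne(2) have "T' ?e \<noteq> T' ?u" unfolding TE .
      from pf(1) J this show ?thesis
      proof (cases rule: joined_arc_cases)
        case circles
        note h = this[unfolded TE]
        have C: "T ?a \<in> tcircles D R" "T ?b \<in> tcircles D R" "T ?a \<union> T ?b \<in> tcircles D ?R'"
          unfolding circ using h U out unfolding tc by auto
        have "kstep D R c X y X' y' \<longleftrightarrow> khm {T ?a, T ?b} {T ?a \<union> T ?b} X X' \<and> (low y \<longleftrightarrow> low y')"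
          using kstep_merge_circles[OF S(1)[unfolded S_def] S(2)[unfolded S'_def] Sne C refl]
            mu2_id[OF y(1) y(2)[unfolded True] l(1)] by simp
        also have "(low y \<longleftrightarrow> low y') \<longleftrightarrow> M = M'"
          unfolding M_def M'_def True h using low low' ne(1) True by auto
        also have "khm {T ?a, T ?b} {T ?a \<union> T ?b} X X' \<and> M = M' \<longleftrightarrow>
            khm {T ?a, T ?b} {T ?a \<union> T ?b} (X \<union> M) (X' \<union> M')"
        proof (rule khm_union[OF disj, symmetric])
          \<comment> \<open>Circles avoid both source nodes while every component in
            \<open>M\<close> or \<open>M'\<close> contains one, so the arc labels are
            bystanders.\<close>
          have "?e \<notin> C \<and> ?u \<notin> C" if "C \<in> {T ?a, T ?b} \<union> {T ?a \<union> T ?b}" for C using that C cl by blast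
          moreover have "?e \<in> C \<or> ?u \<in> C" if "C \<in> M \<union> M'" for C
            using that eu unfolding M_def M'_def by (auto split: if_splits)
          ultimately show "({T ?a, T ?b} \<union> {T ?a \<union> T ?b}) \<inter> (M \<union> M') = {}" by blast
        qed
        also have "{T ?a, T ?b} = glue D k R ` S" unfolding S gl using h by auto
        also have "{T ?a \<union> T ?b} = glue D k ?R' ` S'" unfolding S gl using h by auto
        finally show ?thesis unfolding khs kh .
      next
        case (earc C)
        note h = this[unfolded TE]
        have C: "C \<in> tcircles D R" unfolding circ using h(1,5) out unfolding tc by auto
        have EE: "E \<noteq> E'" using joinedD(5)[OF pf(1) J, of ?e] unfolding TE h(3) .
        have S: "S = {E, C}" "S' = {E'}" using S h(2,3) by simp_all
        have K: "kstep D R c X y X' y' \<longleftrightarrow> X - {C} = X' \<and> C \<notin> X \<and> (low y \<longleftrightarrow> low y')"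
          using kstep_merge_arc[OF S(1)[unfolded S_def] S(2)[unfolded S'_def] C _ _ refl E(1,4), of True y y']
            eu mu2_id[OF y(1) y(2)[unfolded True] l(1)] circ by simp
        have n: "C \<notin> {E, U, E', U', ?V, ?V'}" using clC C by blast
        show ?thesis
        proof (cases "k = ?l")
          case kl: True
          have g: "glue D k R ` S = {E, C}" "glue D k ?R' ` S' = {E'}" unfolding S gl using kl True by simp_all
          have M: "M = {E} \<union> (if low y then {U} else {})" "M' = {E'} \<union> (if low y' then {U} else {})"
            unfolding M_def M'_def using kl True h(4) by simp_all
          show ?thesis unfolding khs kh g K M lows[symmetric]
            by (rule khm_merge_arc[symmetric]) (use n E EE ne h(4) in \<open>auto split: if_splits\<close>)
        next
          case kl: False
          have g: "glue D k R ` S = {?V, C}" "glue D k ?R' ` S' = {?V'}" unfolding S gl using kl True n by auto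
          have M: "M = {?V} \<union> {}" "M' = {?V'} \<union> {}" unfolding M_def M'_def using kl True by simp_all
          \<comment> \<open>A node of the absorbed circle tells the marked component before the
            surgery from the one after it.\<close>
          obtain z where "C = T z" using h(1) by blast
          then have "z \<in> C" "z \<notin> E" "z \<notin> U"
            using part_funD[OF pf(1)] n unfolding TE[symmetric] by (metis insertI1, metis insert_iff, metis insert_iff)
          moreover have "C \<subseteq> E'" using h(1,3) by blast
          ultimately have VV: "?V \<noteq> ?V'" by (intro Vne[of z]) blast
          have lw: "\<not> low y" "\<not> low y'" using low low' kl True by auto
          show ?thesis unfolding khs kh g K M using lw
            by (subst khm_merge_arc) (use n E VV in auto)
        qed
      next
        case (uarc C)
        note h = this[unfolded TE]
        have C: "C \<in> tcircles D R" unfolding circ using h(1,5) out unfolding tc by auto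
        have UU: "U \<noteq> U'" using joinedD(5)[OF pf(1) J, of ?u] unfolding TE h(3) .
        have S: "S = {U, C}" "S' = {U'}" using S h(2,3) by simp_all
        have n: "C \<notin> {E, U, E', U', ?V, ?V'}" using clC C by blast
        \<comment> \<open>The last alternative is the \<open>c\<close> term. It disappears for k
          \<noteq> l, just as a circle labelled x merging into the marked circle gives 0.\<close>
        have K: "kstep D R c X y X' y' \<longleftrightarrow> X - {C} = X' \<and>
            (C \<notin> X \<and> (low y \<longleftrightarrow> low y') \<or> C \<in> X \<and> k = ?l \<and> \<not> low y \<and> low y')"
          using kstep_merge_arc[OF S(1)[unfolded S_def] S(2)[unfolded S'_def] C _ _ refl E(5,8), of False y y']
            EU cl C mu2_id[OF y(1) y(2)[unfolded True] l(1)] mu2_x[OF y(1) y(2)[unfolded True] l(1) k] circ by simp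
        show ?thesis
        proof (cases "k = ?l")
          case kl: True
          have g: "glue D k R ` S = {U, C}" "glue D k ?R' ` S' = {U'}" unfolding S gl using kl True by simp_all
          have M: "M = {E} \<union> (if low y then {U} else {})" "M' = {E} \<union> (if low y' then {U'} else {})"
            unfolding M_def M'_def using kl True h(4) by simp_all
          show ?thesis unfolding khs kh g K M
            by (subst khm_merge_uarc) (use n E UU ne h(4) kl in auto)
        next
          case kl: False
          have g: "glue D k R ` S = {?V, C}" "glue D k ?R' ` S' = {?V'}" unfolding S gl using kl True n by auto
          have M: "M = {?V} \<union> {}" "M' = {?V'} \<union> {}" unfolding M_def M'_def using kl True by simp_all
          obtain z where "C = T z" using h(1) by blast
          then have "z \<in> C" "z \<notin> E" "z \<notin> U"
            using part_funD[OF pf(1)] n unfolding TE[symmetric] by (metis insertI1, metis insert_iff, metis insert_iff)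
          moreover have "C \<subseteq> U'" using h(1,3) by blast
          ultimately have VV: "?V \<noteq> ?V'" by (intro Vne[of z]) blast
          have lw: "\<not> low y" "\<not> low y'" using low low' kl True by auto
          show ?thesis unfolding khs kh g K M using lw kl
            by (subst khm_merge_arc) (use n E VV in auto)
        qed
      qed
    next
      \<comment> \<open>For a split the resolution after the surgery is the finer one, so the case
        distinction is made with \<open>T'\<close> in place of \<open>T\<close>.\<close>
      assume J: "joined T' T ?a ?b"
      have S: "S' = {T' ?a, T' ?b}" "S = {T' ?a \<union> T' ?b}"
        unfolding S_def S'_def tc by (rule inv[OF pf(2) J loc(2)])+
      have Sne: "T' ?a \<noteq> T' ?b" using J by (simp add: joined_def)
      have U: "T' ?a \<union> T' ?b \<in> tcomps D R"
        using joinedD(8)[OF pf(2) J, of ?a] part_funD(1)[OF pf(2), of ?a] out unfolding tc by (metis UnI1 imageI)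
      from ne(1) have "T ?e \<noteq> T ?u" unfolding TE .
      from pf(2) J this show ?thesis
      proof (cases rule: joined_arc_cases)
        case circles
        note h = this[unfolded TE]
        have C: "T' ?a \<in> tcircles D ?R'" "T' ?b \<in> tcircles D ?R'" "T' ?a \<union> T' ?b \<in> tcircles D R"
          unfolding circ using h U out unfolding tc by auto
        have "kstep D R c X y X' y' \<longleftrightarrow> khm {T' ?a \<union> T' ?b} {T' ?a, T' ?b} X X' \<and> (low y \<longleftrightarrow> low y')"
          using kstep_split_circle[OF S(2)[unfolded S_def] S(1)[unfolded S'_def] Sne C(3,1,2) refl]
            mu2_id[OF y(1) y(2)[unfolded True] l(1)] by simp
        also have "(low y \<longleftrightarrow> low y') \<longleftrightarrow> M = M'"
          unfolding M_def M'_def True h using low low' ne(2) True by auto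
        also have "khm {T' ?a \<union> T' ?b} {T' ?a, T' ?b} X X' \<and> M = M' \<longleftrightarrow>
            khm {T' ?a \<union> T' ?b} {T' ?a, T' ?b} (X \<union> M) (X' \<union> M')"
        proof (rule khm_union[OF disj, symmetric])
          have "?e \<notin> C \<and> ?u \<notin> C" if "C \<in> {T' ?a \<union> T' ?b} \<union> {T' ?a, T' ?b}" for C using that C cl by blast
          moreover have "?e \<in> C \<or> ?u \<in> C" if "C \<in> M \<union> M'" for C
            using that eu unfolding M_def M'_def by (auto split: if_splits)
          ultimately show "({T' ?a \<union> T' ?b} \<union> {T' ?a, T' ?b}) \<inter> (M \<union> M') = {}" by blast
        qed
        also have "{T' ?a \<union> T' ?b} = glue D k R ` S" unfolding S gl using h by auto
        also have "{T' ?a, T' ?b} = glue D k ?R' ` S'" unfolding S gl using h by auto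
        finally show ?thesis unfolding khs kh .
      next
        case (earc C)
        note h = this[unfolded TE]
        have C: "C \<in> tcircles D ?R'" unfolding circ using h(1,5) out unfolding tc by auto
        have EE: "E' \<noteq> E" using joinedD(5)[OF pf(2) J, of ?e] unfolding TE h(3) .
        have S: "S' = {E', C}" "S = {E}" using S h(2,3) by simp_all
        have K: "kstep D R c X y X' y' \<longleftrightarrow> X = X' - {C} \<and> C \<in> X' \<and> (low y \<longleftrightarrow> low y')"
          using kstep_split_arc[OF S(2)[unfolded S_def] S(1)[unfolded S'_def] C _ _ _ refl E(1,4), of True y y']
            eu mu2_id[OF y(1) y(2)[unfolded True] l(1)] circ by simp
        have n: "C \<notin> {E, U, E', U', ?V, ?V'}" using clC C by blast
        show ?thesis
        proof (cases "k = ?l")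
          case kl: True
          have g: "glue D k R ` S = {E}" "glue D k ?R' ` S' = {E', C}" unfolding S gl using kl True by simp_all
          have M: "M = {E} \<union> (if low y then {U} else {})" "M' = {E'} \<union> (if low y' then {U} else {})"
            unfolding M_def M'_def using kl True h(4) by simp_all
          show ?thesis unfolding khs kh g K M lows[symmetric]
            by (rule khm_split_arc[symmetric]) (use n E EE ne h(4) in \<open>auto split: if_splits\<close>)
        next
          case kl: False
          have g: "glue D k R ` S = {?V}" "glue D k ?R' ` S' = {?V', C}" unfolding S gl using kl True n by auto
          have M: "M = {?V} \<union> {}" "M' = {?V'} \<union> {}" unfolding M_def M'_def using kl True by simp_all
          obtain z where "C = T' z" using h(1) by blast
          then have "z \<in> C" "z \<notin> E'" "z \<notin> U'"
            using part_funD[OF pf(2)] n unfolding TE[symmetric] by (metis insertI1, metis insert_iff, metis insert_iff)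
          moreover have "C \<subseteq> E" using h(1,3) by blast
          ultimately have VV: "?V \<noteq> ?V'" by (intro Vne[of z]) blast
          have lw: "\<not> low y" "\<not> low y'" using low low' kl True by auto
          show ?thesis unfolding khs kh g K M using lw
            by (subst khm_split_arc) (use n E VV in auto)
        qed
      next
        case (uarc C)
        note h = this[unfolded TE]
        have C: "C \<in> tcircles D ?R'" unfolding circ using h(1,5) out unfolding tc by auto
        have UU: "U' \<noteq> U" using joinedD(5)[OF pf(2) J, of ?u] unfolding TE h(3) .
        have S: "S' = {U', C}" "S = {U}" using S h(2,3) by simp_all
        have n: "C \<notin> {E, U, E', U', ?V, ?V'}" using clC C by blast
        have K: "kstep D R c X y X' y' \<longleftrightarrow> X = X' - {C} \<and>
            (C \<in> X' \<and> (low y \<longleftrightarrow> low y') \<or> C \<notin> X' \<and> k = ?l \<and> \<not> low y \<and> low y')"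
          using kstep_split_arc[OF S(2)[unfolded S_def] S(1)[unfolded S'_def] C _ _ _ refl E(5,8), of False y y']
            EU mu2_id[OF y(1) y(2)[unfolded True] l(1)] mu2_x[OF y(1) y(2)[unfolded True] l(1) k] circ by simp
        show ?thesis
        proof (cases "k = ?l")
          case kl: True
          have g: "glue D k R ` S = {U}" "glue D k ?R' ` S' = {U', C}" unfolding S gl using kl True by simp_all
          have M: "M = {E} \<union> (if low y then {U} else {})" "M' = {E} \<union> (if low y' then {U'} else {})"
            unfolding M_def M'_def using kl True h(4) by simp_all
          show ?thesis unfolding khs kh g K M
            by (subst khm_split_uarc) (use n E UU ne h(4) kl in auto)
        next
          case kl: False
          have g: "glue D k R ` S = {?V}" "glue D k ?R' ` S' = {?V', C}" unfolding S gl using kl True n by auto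
          have M: "M = {?V} \<union> {}" "M' = {?V'} \<union> {}" unfolding M_def M'_def using kl True by simp_all
          obtain z where "C = T' z" using h(1) by blast
          then have "z \<in> C" "z \<notin> E'" "z \<notin> U'"
            using part_funD[OF pf(2)] n unfolding TE[symmetric] by (metis insertI1, metis insert_iff, metis insert_iff)
          moreover have "C \<subseteq> U" using h(1,3) by blast
          ultimately have VV: "?V \<noteq> ?V'" by (intro Vne[of z]) blast
          have lw: "\<not> low y" "\<not> low y'" using low low' kl True by auto
          show ?thesis unfolding khs kh g K M using lw kl
            by (subst khm_split_arc) (use n E VV in auto)
        qed
      qed
    qed
  next
    case False
    text \<open>In the closure of type \<open>ltype D R\<close> the two arcs are separate before the saddle and joined
      after it, so this saddle is a merge, and the involved components are the arcs; dually
      for the other closure.\<close>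
    define f where "f = cof D ?l' R"
    define f' where "f' = cof D ?l ?R'"
    have pf': "part_fun f" "part_fun f'" unfolding f_def f'_def by (rule part_fun_cof)+
    have l1: "?l \<le> 1" "?l' \<le> 1" using l by auto
    have j: "joined T f ?e ?u" "joined T' f' ?e ?u"
      unfolding T_def T'_def f_def f'_def using cof_other_type[OF D] False l1 by simp_all
    have f: "f ?e = ?V" "f ?u = ?V" "f' ?e = ?V'" "f' ?u = ?V'"
      using joinedD(8)[OF pf(1) j(1)] joinedD(8)[OF pf(2) j(2)] eu unfolding TE by blast+
    have s: "surgery T f' ?a ?b" "surgery f T' ?a ?b"
      using cof_surgery[OF D c, of ?l] cof_surgery[OF D c, of ?l'] unfolding T_def T'_def f_def f'_def cof_type[OF D] .
    \<comment> \<open>The closure \<open>f'\<close> already has both arcs in one component. A merge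
      starting from it would keep them together, but they are distinct in \<open>T\<close>.\<close>
    have "\<not> joined f' T ?a ?b" 
      using joined_eq[OF pf'(2), of T ?a ?b ?e ?u] f(3,4) ne(1) unfolding TE by auto
    then have J: "joined T f' ?a ?b" using s(1) by (simp add: surgery_def)
    have "\<not> joined f T' ?a ?b" 
      using joined_eq[OF pf'(1), of T' ?a ?b ?e ?u] f(1,2) ne(2) unfolding TE by auto
    then have J': "joined T' f ?a ?b" using s(2) by (simp add: surgery_def)
    \<comment> \<open>A merge that identifies the distinct classes of \<open>?e\<close> and
      \<open>?u\<close> merges exactly these two classes.\<close>
    have arcs_ab: "{H ?a, H ?b} = {H ?e, H ?u} \<and> F ?e = H ?e \<union> H ?u"
      if H: "part_fun H" "joined H F ?a ?b" "F ?e = F ?u" "H ?e \<noteq> H ?u" for H F :: "node \<Rightarrow> comp"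
    proof -
      note jj = joinedD[OF H(1,2)]
      have "?e \<in> H ?a \<union> H ?b \<and> ?u \<in> H ?a \<union> H ?b"
        using jj(3)[of ?e] jj(3)[of ?u] jj(5)[of ?e] jj(5)[of ?u] H(3,4) by metis
      then have "H ?e = H ?a \<or> H ?e = H ?b" "H ?u = H ?a \<or> H ?u = H ?b" "F ?e = H ?a \<union> H ?b"
        using jj(4)[of ?e] jj(4)[of ?u] jj(8)[of ?e] by simp_all
      then show ?thesis using H(4) by auto
    qed
    have fe: "f' ?e = f' ?u" "f ?e = f ?u" using f by simp_all
    have "{T ?a, T ?b} = {E, U} \<and> ?V' = ?V"
      using arcs_ab[OF pf(1) J fe(1)] ne(1) unfolding TE f by blast
    moreover have "{T' ?a, T' ?b} = {E', U'} \<and> ?V = ?V'"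
      using arcs_ab[OF pf(2) J' fe(2)] ne(2) unfolding TE f by blast
    ultimately have ab: "{T ?a, T ?b} = {E, U}" "?V' = ?V" "{T' ?a, T' ?b} = {E', U'}" by simp_all
    have S: "S = {E, U}" "S' = {E', U'}"
      unfolding S_def S'_def tc ab[symmetric] by (rule inv(1)[OF pf(1) J loc(1)] inv(1)[OF pf(2) J' loc(2)])+
    have K: "kstep D R c X y X' y' \<longleftrightarrow> X = X' \<and> (if k = ?l then \<not> low y else low y')"
      using kstep_saddle[OF S(1)[unfolded S_def] S(2)[unfolded S'_def] ne(1) _ _ refl E(1,5,4,8), of y y']
        mu2_saddle[OF y l False[symmetric] k] circ by simp
    \<comment> \<open>There are only two types, so \<open>k\<close> agrees with exactly one of them:
      the saddle is a merge or a split in the closure accordingly.\<close>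
    have kl: "k = ?l \<longleftrightarrow> k \<noteq> ?l'" using k l False by auto
    show ?thesis
    proof (cases "k = ?l")
      case True
      have g: "glue D k R ` S = {E, U}" "glue D k ?R' ` S' = {?V}" unfolding S gl ab using kl True by simp_all
      have M: "M = {E} \<union> (if low y then {U} else {})" "M' = {?V}"
        unfolding M_def M'_def ab using kl True by simp_all
      show ?thesis unfolding khs kh g K M using True
        by (subst khm_merge_arcs) (use E ne V in auto)
    next
      case F: False
      have g: "glue D k R ` S = {?V'}" "glue D k ?R' ` S' = {E', U'}" unfolding S gl ab using kl F by simp_all
      have M: "M = {?V'}" "M' = {E'} \<union> (if low y' then {U'} else {})"
        unfolding M_def M'_def ab using kl F by simp_all
      show ?thesis unfolding khs kh g K M using F
        by (subst khm_split_arcs) (use E ne V in auto)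
    qed
  qed
qed

section \<open>The isomorphism of complexes\<close>

lemma delta_morphisms:
  assumes "p \<in> set (delta D R c)"
  shows "snd p \<in> {A0, A1, C0, C1, P01, Q10}"
proof -
  have "\<forall>p\<in>set (delta D R c). snd p \<in> {A0, A1, C0, C1, P01, Q10}"
    by (simp add: delta_def Let_def)
  with assms show ?thesis by blast
qed

lemma mu3_delta_zero: "u \<in> {A0, A1, C0, C1, P01, Q10} \<Longrightarrow> u' \<in> {A0, A1, C0, C1, P01, Q10} \<Longrightarrow> mu3 u' u y = None"
  by (elim insertE emptyE) (simp_all add: mu3_def)

lemma terms3_empty: "terms3 D g g' = {}"
proof (rule ccontr)
  assume "terms3 D g g' \<noteq> {}"
  moreover obtain R X y R' X' y' where "g = (R, X, y)" "g' = (R', X', y')" by (metis prod_cases3)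
  ultimately obtain c c' n n' where n: "n < length (delta D R c)" "n' < length (delta D (insert c R) c')"
    "mu3 (snd (delta D (insert c R) c' ! n')) (snd (delta D R c ! n)) y = Some y'"
    by auto
  then show False
    using mu3_delta_zero[OF delta_morphisms[OF nth_mem[OF n(1)]] delta_morphisms[OF nth_mem[OF n(2)]]] by simp
qed

text \<open>When \<open>delta\<close> has two summands, they require opposite labels on the circle,
  so a given pair of labellings meets at most one of them.\<close>

lemma delta_exclusive:
  assumes "n < length (delta D R c)" "m < length (delta D R c)"
    "fst (delta D R c ! n) X X'" "fst (delta D R c ! m) X X'"
  shows "n = m"
proof -
  have "length (delta D R c) \<le> 1 \<or> (\<exists>P Q u v. delta D R c = [(P, u), (Q, v)] \<and> \<not> (P X X' \<and> Q X X'))"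
    by (simp add: delta_def Let_def)
  then show ?thesis using assms by (auto simp: less_Suc_eq numeral_2_eq_2)
qed

text \<open>The crossing is determined by the two vertices of the cube and the summand by the
  labels. The number of terms is therefore 0 or 1, and its parity is mere existence.\<close>

lemma dK_iff:
  "dK D (R, X, y) (R', X', y') \<longleftrightarrow> (\<exists>c\<in>crossings D - R. R' = insert c R \<and> kstep D R c X y X' y')"
proof -
  let ?A = "terms2 D (R, X, y) (R', X', y')"
  have "z = w" if "z \<in> ?A" "w \<in> ?A" for z w
  proof -
    obtain c n d m where zw: "z = (c, n)" "w = (d, m)" by fastforce
    have h: "c \<notin> R" "d \<notin> R" "insert c R = insert d R" "n < length (delta D R c)" "m < length (delta D R d)"
      "fst (delta D R c ! n) X X'" "fst (delta D R d ! m) X X'"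
      using that unfolding zw by auto
    have "c = d" using h(1-3) by blast
    with h delta_exclusive zw show ?thesis by blast
  qed
  then have "odd (card ?A) \<longleftrightarrow> ?A \<noteq> {}"
  proof (cases "?A = {}")
    case False
    then obtain z where "z \<in> ?A" by blast
    then have "?A = {z}" using \<open>\<And>w z. z \<in> ?A \<Longrightarrow> w \<in> ?A \<Longrightarrow> z = w\<close> by blast
    then show ?thesis by simp
  qed (simp only: card.empty, simp)
  also have "?A \<noteq> {} \<longleftrightarrow> (\<exists>c\<in>crossings D - R. R' = insert c R \<and> kstep D R c X y X' y')"
  proof
    assume "?A \<noteq> {}"
    then obtain c n where "c \<in> crossings D - R" "R' = insert c R" "n < length (delta D R c)"
      "fst (delta D R c ! n) X X'" "mu2 (snd (delta D R c ! n)) y = Some y'"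
      by auto
    moreover from this have "kstep D R c X y X' y'" unfolding kstep_def using nth_mem by blast
    ultimately show "\<exists>c\<in>crossings D - R. R' = insert c R \<and> kstep D R c X y X' y'" by blast
  next
    assume "\<exists>c\<in>crossings D - R. R' = insert c R \<and> kstep D R c X y X' y'"
    then obtain c p where c: "c \<in> crossings D - R" "R' = insert c R" "p \<in> set (delta D R c)"
      "fst p X X'" "mu2 (snd p) y = Some y'"
      unfolding kstep_def by blast
    then obtain n where "n < length (delta D R c)" "delta D R c ! n = p" unfolding in_set_conv_nth by blast
    then have "(c, n) \<in> ?A" using c by simp
    then show "?A \<noteq> {}" by blast
  qed
  finally show ?thesis unfolding dK_def terms3_empty by simp
qed

definition khgen_of :: "slice list \<Rightarrow> nat \<Rightarrow> kgen \<Rightarrow> khgen" where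
  "khgen_of D k g = (case g of (R, X, y) \<Rightarrow> (R, khset D k R X y))"

text \<open>The degree formula explains the values of \<open>pgr\<close>: a label 1 counts 1 and a
  label x counts -1. For k = l the marked circle and the extra one give -1 + 1 = 0 or -1 - 1 = -2;
  for k \<noteq> l the marked circle alone gives -1.\<close>

lemma khset_decompose:
  assumes D: "valid_diagram D" and k: "k \<le> 1" and X: "X \<subseteq> tcircles D R" and y: "y \<in> modgens k (ltype D R)"
  shows "khset D k R X y \<inter> tcircles D R = X" "uarc D R \<in> khset D k R X y \<longleftrightarrow> low y"
    "khset D k R X y \<subseteq> ccomps D k R" "marked D k R \<in> khset D k R X y"
    "int (card (ccomps D k R)) - 2 * int (card (khset D k R X y)) = int (card (tcircles D R)) - 2 * int (card X) + pgr y"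
proof -
  let ?E = "earc D R" and ?U = "uarc D R"
  have l: "ltype D R = 0 \<or> ltype D R = 1" by (rule ltype_le)
  have low: "k = ltype D R" if "low y" using low_type[OF y l k that] .
  have n: "?E \<notin> tcircles D R" "?U \<notin> tcircles D R" "?E \<union> ?U \<notin> tcircles D R" "?E \<noteq> ?U" "?E \<union> ?U \<noteq> ?U"
    using arcs(1)[OF D, of R] ccomps_cases(5)[OF D k, of R] arcs_tcomps[OF D, of R] unfolding tcircles_eq[OF D] by auto
  have fin: "finite (tcircles D R)" unfolding tcircles_eq[OF D] tcomps_eq using finite_nodes by simp
  then have finX: "finite X" using X finite_subset by blast
  have "khset D k R X y \<inter> tcircles D R = X \<and> (uarc D R \<in> khset D k R X y \<longleftrightarrow> low y) \<and>
    khset D k R X y \<subseteq> ccomps D k R \<and> marked D k R \<in> khset D k R X y \<and>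
    int (card (ccomps D k R)) - 2 * int (card (khset D k R X y)) = int (card (tcircles D R)) - 2 * int (card X) + pgr y"
  proof (cases "k = ltype D R")
    case True
    note 1 = True ccomps_cases(2,1)[OF D k True]
    have kx: "khset D k R X y = (if low y then insert ?E (insert ?U X) else insert ?E X)"
      unfolding khset_def 1(2) by auto
    have "?E \<notin> X" "?U \<notin> X" using n X by blast+
    moreover have "pgr y = (if low y then -2 else 0)"
      using y l 1(1) by (auto simp: low_def split: if_splits)
    ultimately show ?thesis unfolding kx 1(2,3) using X n fin finX by (auto simp: card_insert_if)
  next
    case False
    note 2 = False ccomps_cases(4,3)[OF D k False]
    have kx: "khset D k R X y = insert (?E \<union> ?U) X" "\<not> low y"
      unfolding khset_def 2(2) using low 2(1) by auto
    have "?E \<union> ?U \<notin> X" "?U \<notin> X" using n X by blast+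
    moreover have "pgr y = -1" using y l 2(1) k by (auto split: if_splits)
    ultimately show ?thesis unfolding kx(1) 2(2,3) using X n fin finX kx(2) by (auto simp: card_insert_if)
  qed
  then show "khset D k R X y \<inter> tcircles D R = X" "uarc D R \<in> khset D k R X y \<longleftrightarrow> low y"
    "khset D k R X y \<subseteq> ccomps D k R" "marked D k R \<in> khset D k R X y"
    "int (card (ccomps D k R)) - 2 * int (card (khset D k R X y)) = int (card (tcircles D R)) - 2 * int (card X) + pgr y"
    by blast+
qed

lemma modgens_low_inj:
  assumes "y \<in> modgens k l" "y' \<in> modgens k l" "low y = low y'" "l = 0 \<or> l = 1"
  shows "y = y'"
  using assms by (auto simp: low_def split: if_splits)

lemma modgens_low_ex:
  assumes "l = 0 \<or> l = 1" "k \<le> 1" "b \<Longrightarrow> k = l"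
  obtains y where "y \<in> modgens k l" "low y = b"
proof -
  have "k = 0 \<or> k = 1" using assms(2) by auto
  then have "(if k = l then if b then if k = 0 then Beta else Sigma else if k = 0 then Alpha else Rho
    else if k = 0 then Gamma else Tau) \<in> modgens k l" "low (if k = l then if b then if k = 0 then Beta else Sigma else if k = 0 then Alpha else Rho
    else if k = 0 then Gamma else Tau) = b"
    using assms by (auto simp: low_def)
  then show ?thesis using that by blast
qed

lemma khgen_of_bij:
  assumes D: "valid_diagram D" and k: "k \<le> 1"
  shows "bij_betw (khgen_of D k) (GK D k) (GKh D k)"
  unfolding bij_betw_def
proof
  show "inj_on (khgen_of D k) (GK D k)"
  proof (rule inj_onI)
    fix g g' assume g: "g \<in> GK D k" "g' \<in> GK D k" "khgen_of D k g = khgen_of D k g'"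
    obtain R X y R' X' y' where e: "g = (R, X, y)" "g' = (R', X', y')" by (metis prod_cases3)
    have R: "R' = R" "khset D k R X y = khset D k R X' y'" using g(3) by (auto simp: e khgen_of_def)
    have h: "X \<subseteq> tcircles D R" "y \<in> modgens k (ltype D R)" "X' \<subseteq> tcircles D R" "y' \<in> modgens k (ltype D R)"
      using g(1,2) by (simp_all add: e GK_def R(1))
    note d = khset_decompose[OF D k h(1,2)] and d' = khset_decompose[OF D k h(3,4)]
    have "X = X'" using d(1) d'(1) R(2) by simp
    moreover have "y = y'" using modgens_low_inj[OF h(2,4) _ ltype_le] d(2) d'(2) R(2) by simp
    ultimately show "g = g'" using e R by simp
  qed
  show "khgen_of D k ` GK D k = GKh D k"
  proof (intro subset_antisym subsetI)
    fix h assume "h \<in> khgen_of D k ` GK D k"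
    then obtain R X y where "h = (R, khset D k R X y)" "R \<subseteq> crossings D" "X \<subseteq> tcircles D R" "y \<in> modgens k (ltype D R)"
      by (auto simp: khgen_of_def GK_def)
    then show "h \<in> GKh D k" using khset_decompose(3,4)[OF D k] by (auto simp: GKh_def)
  next
    fix h assume "h \<in> GKh D k"
    then obtain R Z where h: "h = (R, Z)" "R \<subseteq> crossings D" "Z \<subseteq> ccomps D k R" "marked D k R \<in> Z"
      by (auto simp: GKh_def)
    \<comment> \<open>The unearringed arc is a component of the closure only for k = l. Otherwise
      the module generator is unique and not low.\<close>
    define b where "b = (k = ltype D R \<and> uarc D R \<in> Z)"
    obtain y where y: "y \<in> modgens k (ltype D R)" "low y = b"
      using modgens_low_ex[OF ltype_le k, of b D R] unfolding b_def by blast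
    have "khset D k R (Z \<inter> tcircles D R) y = Z"
      unfolding khset_def y(2) b_def using h(3,4) ccomps_cases(1-4)[OF D k, of R] by (cases "k = ltype D R") auto
    then have "h = khgen_of D k (R, Z \<inter> tcircles D R, y)" using h(1) by (simp add: khgen_of_def)
    moreover have "(R, Z \<inter> tcircles D R, y) \<in> GK D k" using h(2) y(1) by (simp add: GK_def)
    ultimately show "h \<in> khgen_of D k ` GK D k" by blast
  qed
qed

lemma dK_dKh:
  assumes D: "valid_diagram D" and k: "k \<le> 1" and g: "g \<in> GK D k" "g' \<in> GK D k"
  shows "dK D g g' \<longleftrightarrow> dKh D k (khgen_of D k g) (khgen_of D k g')"
proof -
  obtain R X y R' X' y' where e: "g = (R, X, y)" "g' = (R', X', y')" by (metis prod_cases3)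
  have h: "X \<subseteq> tcircles D R" "X' \<subseteq> tcircles D R'" "y \<in> modgens k (ltype D R)" "y' \<in> modgens k (ltype D R')"
    using g by (simp_all add: e GK_def)
  have "kstep D R c X y X' y' \<longleftrightarrow> khstep D k R c (khset D k R X y) (khset D k R' X' y')"
    if "c \<in> crossings D - R" "R' = insert c R" for c
    using kstep_khstep[OF D k _ _ h(1) h(2)[unfolded that(2)] h(3) h(4)[unfolded that(2)]] that by simp
  then show ?thesis unfolding e khgen_of_def dK_iff prod.case dKh_iff by blast
qed

text \<open>Both sides equal the label degree plus n^+ - n^- + h, since r = deg + n^+ - n^- + 2h and
  h is the number of 1-resolutions minus n^-.\<close>

lemma khgen_of_degree:
  assumes D: "valid_diagram D" and k: "k \<le> 1" and g: "g \<in> GK D k"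
  shows "bidegKh D ori k (khgen_of D k g) = (fst (bidegK D ori g) - snd (bidegK D ori g), snd (bidegK D ori g))"
proof -
  obtain R X y where e: "g = (R, X, y)" by (metis prod_cases3)
  have "X \<subseteq> tcircles D R" "y \<in> modgens k (ltype D R)" using g by (simp_all add: e GK_def)
  from khset_decompose(5)[OF D k this] show ?thesis by (simp add: e khgen_of_def Let_def)
qed

section \<open>Isomorphisms induced by a bijection of bases\<close>

lemma card_Collect_conj_eq: "card {x \<in> G. P x \<and> x = a} = (if a \<in> G \<and> P a then 1 else 0)"
proof -
  have "{x \<in> G. P x \<and> x = a} = (if a \<in> G \<and> P a then {a} else {})" by auto
  then show ?thesis by simp
qed

lemma bij_chain_iso:
  assumes bij: "bij_betw \<phi> G1 G2" and d: "\<And>g g'. g \<in> G1 \<Longrightarrow> g' \<in> G1 \<Longrightarrow> d1 g g' \<longleftrightarrow> d2 (\<phi> g) (\<phi> g')"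
  shows "chain_iso G1 d1 G2 d2 (\<lambda>g h. h = \<phi> g)"
proof -
  let ?\<psi> = "the_inv_into G1 \<phi>"
  have inj: "inj_on \<phi> G1" and im: "\<phi> ` G1 = G2" using bij by (auto simp: bij_betw_def)
  have \<psi>: "?\<psi> h \<in> G1" "\<phi> (?\<psi> h) = h" if "h \<in> G2" for h
    using that inj im the_inv_into_into[OF inj, of h G1] f_the_inv_into_f[OF inj, of h] by auto
  have \<psi>': "?\<psi> (\<phi> g) = g" if "g \<in> G1" for g using the_inv_into_f_f[OF inj that] .
  have one: "card {x \<in> G. x = a \<and> P x} = (if a \<in> G \<and> P a then 1 else 0)" for a :: "'x" and G P
    using card_Collect_conj_eq[of G P a] by (simp add: conj_commute)
  show ?thesis unfolding chain_iso_def
  proof (intro conjI ballI exI[of _ "\<lambda>h g. g = ?\<psi> h"])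
    fix g h assume gh: "g \<in> G1" "h \<in> G2"
    have "{g' \<in> G1. d1 g g' \<and> h = \<phi> g'} = {g' \<in> G1. d1 g g' \<and> g' = ?\<psi> h}" using gh \<psi> \<psi>' by auto
    then have "odd (card {g' \<in> G1. d1 g g' \<and> h = \<phi> g'}) \<longleftrightarrow> d1 g (?\<psi> h)"
      using gh \<psi> card_Collect_conj_eq[of G1 "d1 g" "?\<psi> h"] by simp
    also have "\<dots> \<longleftrightarrow> d2 (\<phi> g) h" using d[OF gh(1) \<psi>(1)[OF gh(2)]] \<psi>(2)[OF gh(2)] by simp
    also have "\<dots> \<longleftrightarrow> odd (card {h' \<in> G2. h' = \<phi> g \<and> d2 h' h})"
      using one[of G2 "\<phi> g" "\<lambda>h'. d2 h' h"] gh im by auto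
    finally show "odd (card {g' \<in> G1. d1 g g' \<and> h = \<phi> g'}) = odd (card {h' \<in> G2. h' = \<phi> g \<and> d2 h' h})" .
  next
    fix g g2 assume gg: "g \<in> G1" "g2 \<in> G1"
    then show "odd (card {h \<in> G2. h = \<phi> g \<and> g2 = ?\<psi> h}) = (g = g2)"
      using one[of G2 "\<phi> g" "\<lambda>h. g2 = ?\<psi> h"] \<psi>'[OF gg(1)] im by auto
  next
    fix h h2 assume hh: "h \<in> G2" "h2 \<in> G2"
    then show "odd (card {g \<in> G1. g = ?\<psi> h \<and> h2 = \<phi> g}) = (h = h2)"
      using one[of G1 "?\<psi> h" "\<lambda>g. h2 = \<phi> g"] \<psi>[OF hh(1)] by auto
  qed
qed

text \<open>The bijection maps cycles onto cycles and boundaries onto boundaries. Degrees need to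
  match only at \<open>e1\<close> and at the degree from which the differential arrives
  there.\<close>

lemma bij_homology_iso:
  assumes bij: "bij_betw \<phi> G1 G2" and d: "\<And>g g'. g \<in> G1 \<Longrightarrow> g' \<in> G1 \<Longrightarrow> d1 g g' \<longleftrightarrow> d2 (\<phi> g) (\<phi> g')"
    and deg: "\<And>g. g \<in> G1 \<Longrightarrow> deg1 g = e1 \<longleftrightarrow> deg2 (\<phi> g) = e2"
    and deg': "\<And>g. g \<in> G1 \<Longrightarrow> deg1 g = (fst e1 - fst s1, snd e1 - snd s1) \<longleftrightarrow> deg2 (\<phi> g) = (fst e2 - fst s2, snd e2 - snd s2)"
  shows "homology_iso G1 d1 deg1 s1 e1 G2 d2 deg2 s2 e2"
proof -
  have inj: "inj_on \<phi> G1" and im: "\<phi> ` G1 = G2" using bij by (auto simp: bij_betw_def)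
  have F: "vapply G2 (\<lambda>g h. h = \<phi> g) S = \<phi> ` S" if "S \<subseteq> G1" for S
  proof -
    have "odd (card {g \<in> S. h = \<phi> g}) \<longleftrightarrow> h \<in> \<phi> ` S" for h
    proof (cases "h \<in> \<phi> ` S")
      case True
      then obtain g where g: "g \<in> S" "h = \<phi> g" by blast
      then have "{g \<in> S. h = \<phi> g} = {g}" using inj that unfolding inj_on_def by blast
      then show ?thesis using True by simp
    next
      case False
      then have "{g \<in> S. h = \<phi> g} = {}" by blast
      then show ?thesis using False by (simp only: card.empty) simp
    qed
    then show ?thesis unfolding vapply_def using that im by blast
  qed
  have V: "vapply G2 d2 (\<phi> ` S) = \<phi> ` vapply G1 d1 S" if S: "S \<subseteq> G1" for S
  proof -
    have c: "card {h' \<in> \<phi> ` S. d2 h' (\<phi> g)} = card {g' \<in> S. d1 g' g}" if "g \<in> G1" for g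
    proof -
      have "{h' \<in> \<phi> ` S. d2 h' (\<phi> g)} = \<phi> ` {g' \<in> S. d1 g' g}" using d S that by blast
      moreover have "inj_on \<phi> {g' \<in> S. d1 g' g}" by (rule inj_on_subset[OF inj]) (use S in blast)
      ultimately show ?thesis by (simp add: card_image)
    qed
    show ?thesis
    proof (intro subset_antisym subsetI)
      fix h assume "h \<in> vapply G2 d2 (\<phi> ` S)"
      then obtain g where "g \<in> G1" "h = \<phi> g" "odd (card {h' \<in> \<phi> ` S. d2 h' h})" unfolding vapply_def using im by blast
      then show "h \<in> \<phi> ` vapply G1 d1 S" using c[of g] unfolding vapply_def by auto
    next
      fix h assume "h \<in> \<phi> ` vapply G1 d1 S"
      then obtain g where "g \<in> G1" "h = \<phi> g" "odd (card {g' \<in> S. d1 g' g})" unfolding vapply_def by blast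
      then show "h \<in> vapply G2 d2 (\<phi> ` S)" using c[of g] im unfolding vapply_def by auto
    qed
  qed
  have sub: "S \<subseteq> G1" if "S \<in> cycles G1 d1 deg1 e1" for S using that unfolding cycles_def by auto
  have Z: "cycles G2 d2 deg2 e2 = image \<phi> ` cycles G1 d1 deg1 e1"
  proof (intro subset_antisym subsetI)
    fix T assume "T \<in> cycles G2 d2 deg2 e2"
    then have T: "T \<subseteq> {h \<in> G2. deg2 h = e2}" "vapply G2 d2 T = {}" unfolding cycles_def by auto
    define S where "S = {g \<in> G1. \<phi> g \<in> T}"
    have TS: "T = \<phi> ` S" using T(1) im unfolding S_def by blast
    have S1: "S \<subseteq> G1" unfolding S_def by blast
    have "S \<subseteq> {g \<in> G1. deg1 g = e1}" using T(1) deg unfolding S_def by blast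
    moreover have "vapply G1 d1 S = {}" using V[OF S1] T(2) TS by simp
    ultimately show "T \<in> image \<phi> ` cycles G1 d1 deg1 e1" unfolding cycles_def TS by blast
  next
    fix T assume "T \<in> image \<phi> ` cycles G1 d1 deg1 e1"
    then obtain S where S: "T = \<phi> ` S" "S \<subseteq> {g \<in> G1. deg1 g = e1}" "vapply G1 d1 S = {}" unfolding cycles_def by blast
    have "S \<subseteq> G1" using S(2) by blast
    then have "vapply G2 d2 T = {}" using V[of S] S by simp
    moreover have "T \<subseteq> {h \<in> G2. deg2 h = e2}" using S(1,2) deg im by auto
    ultimately show "T \<in> cycles G2 d2 deg2 e2" unfolding cycles_def by blast
  qed
  have B: "boundaries G2 d2 deg2 s2 e2 = image \<phi> ` boundaries G1 d1 deg1 s1 e1"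
  proof (intro subset_antisym subsetI)
    fix T assume "T \<in> boundaries G2 d2 deg2 s2 e2"
    then obtain Q where Q: "Q \<subseteq> {h \<in> G2. deg2 h = (fst e2 - fst s2, snd e2 - snd s2)}" "T = vapply G2 d2 Q"
      unfolding boundaries_def by blast
    define S where "S = {g \<in> G1. \<phi> g \<in> Q}"
    have QS: "Q = \<phi> ` S" using Q(1) im unfolding S_def by blast
    have S1: "S \<subseteq> G1" unfolding S_def by blast
    have "S \<subseteq> {g \<in> G1. deg1 g = (fst e1 - fst s1, snd e1 - snd s1)}" using Q(1) deg' unfolding S_def by blast
    then show "T \<in> image \<phi> ` boundaries G1 d1 deg1 s1 e1" unfolding boundaries_def Q(2) QS V[OF S1] by blast
  next
    fix T assume "T \<in> image \<phi> ` boundaries G1 d1 deg1 s1 e1"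
    then obtain S where S: "S \<subseteq> {g \<in> G1. deg1 g = (fst e1 - fst s1, snd e1 - snd s1)}" "T = \<phi> ` vapply G1 d1 S"
      unfolding boundaries_def by blast
    have S1: "S \<subseteq> G1" using S(1) by blast
    have "\<phi> ` S \<subseteq> {h \<in> G2. deg2 h = (fst e2 - fst s2, snd e2 - snd s2)}" using S(1) deg' im by auto
    then show "T \<in> boundaries G2 d2 deg2 s2 e2" unfolding boundaries_def S(2) V[OF S1, symmetric] by blast
  qed
  have Bsub: "S \<subseteq> G1" if "S \<in> boundaries G1 d1 deg1 s1 e1" for S
    using that unfolding boundaries_def vapply_def by auto
  \<comment> \<open>Every cycle of the target is the image of a cycle exactly, so the difference to
    be recognised as a boundary is the empty set.\<close>
  have zero: "{} \<in> boundaries G2 d2 deg2 s2 e2"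
    unfolding boundaries_def by (rule CollectI, rule exI[of _ "{}"]) (simp add: vapply_def)
  show ?thesis unfolding homology_iso_def Let_def
  proof (intro exI[of _ "\<lambda>g h. h = \<phi> g"] conjI ballI impI)
    fix S assume "S \<in> cycles G1 d1 deg1 e1"
    then show "vapply G2 (\<lambda>g h. h = \<phi> g) S \<in> cycles G2 d2 deg2 e2" using F[OF sub] Z by auto
  next
    fix S assume "S \<in> boundaries G1 d1 deg1 s1 e1"
    then show "vapply G2 (\<lambda>g h. h = \<phi> g) S \<in> boundaries G2 d2 deg2 s2 e2" using F[OF Bsub] B by auto
  next
    fix T assume "T \<in> cycles G2 d2 deg2 e2"
    then obtain S where S: "S \<in> cycles G1 d1 deg1 e1" "T = \<phi> ` S" using Z by blast
    then show "\<exists>S\<in>cycles G1 d1 deg1 e1. vapply G2 (\<lambda>g h. h = \<phi> g) S - T \<union> (T - vapply G2 (\<lambda>g h. h = \<phi> g) S) \<in> boundaries G2 d2 deg2 s2 e2"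
      using F[OF sub] zero by (intro bexI[of _ S]) auto
  next
    fix S assume S: "S \<in> cycles G1 d1 deg1 e1" "vapply G2 (\<lambda>g h. h = \<phi> g) S \<in> boundaries G2 d2 deg2 s2 e2"
    then obtain S' where S': "S' \<in> boundaries G1 d1 deg1 s1 e1" "\<phi> ` S = \<phi> ` S'" using F[OF sub] B by auto
    then have "S = S'" using inj_on_image_eq_iff[OF inj sub[OF S(1)] Bsub[OF S'(1)]] by simp
    then show "S \<in> boundaries G1 d1 deg1 s1 e1" using S'(1) by simp
  qed
qed

theorem theorem9p4:
  fixes D :: "slice list" and k :: nat and ori :: "node \<Rightarrow> bool"
  assumes "valid_diagram D"
    and "k \<le> 1"
    and "oriented D ori"
    and "extends_closure D ori k"
  shows "(\<forall>g\<in>GK D k. \<forall>g''\<in>GK D k. even (card {g'\<in>GK D k. dK D g g' \<and> dK D g' g''}))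
    \<and> (\<forall>g\<in>GK D k. \<forall>g'\<in>GK D k. dK D g g' \<longrightarrow> bidegK D ori g' = (fst (bidegK D ori g) + 1, snd (bidegK D ori g) + 1))
    \<and> (\<forall>g\<in>GK D k. \<forall>g'\<in>GK D k. \<not> dK3 D g g')
    \<and> (\<exists>F. chain_iso (GK D k) (dK D) (GKh D k) (dKh D k) F
          \<and> (\<forall>g\<in>GK D k. \<forall>h\<in>GKh D k. F g h \<longrightarrow>
               bidegKh D ori k h = (fst (bidegK D ori g) - snd (bidegK D ori g), snd (bidegK D ori g))))
    \<and> (\<forall>r s. homology_iso (GK D k) (dK D) (bidegK D ori) (1, 1) (r, s)
                          (GKh D k) (dKh D k) (bidegKh D ori k) (0, 1) (r - s, s))"
proof (intro conjI ballI impI allI)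
  note D = assms(1) and k = assms(2)
  let ?\<phi> = "khgen_of D k"
  have bij: "bij_betw ?\<phi> (GK D k) (GKh D k)" by (rule khgen_of_bij[OF D k])
  have inj: "inj_on ?\<phi> (GK D k)" and im: "?\<phi> ` GK D k = GKh D k" using bij by (auto simp: bij_betw_def)
  have in_GKh: "?\<phi> g \<in> GKh D k" if "g \<in> GK D k" for g using that im by blast
  note deg = khgen_of_degree[OF D k, of _ ori]
  fix g assume g: "g \<in> GK D k"
  {
    fix g'' assume g'': "g'' \<in> GK D k"
    \<comment> \<open>The bijection carries intermediate generators to intermediate generators, so
      the two parity counts coincide.\<close>
    have "{g' \<in> GK D k. dK D g g' \<and> dK D g' g''} =
        {g' \<in> GK D k. dKh D k (?\<phi> g) (?\<phi> g') \<and> dKh D k (?\<phi> g') (?\<phi> g'')}"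
      using dK_dKh[OF D k g] dK_dKh[OF D k _ g''] by blast
    then have "?\<phi> ` {g' \<in> GK D k. dK D g g' \<and> dK D g' g''} = {h' \<in> GKh D k. dKh D k (?\<phi> g) h' \<and> dKh D k h' (?\<phi> g'')}"
      unfolding im[symmetric] by (simp only:) blast
    moreover have "inj_on ?\<phi> {g' \<in> GK D k. dK D g g' \<and> dK D g' g''}" by (rule inj_on_subset[OF inj]) blast
    ultimately have "card {g' \<in> GK D k. dK D g g' \<and> dK D g' g''} = card {h' \<in> GKh D k. dKh D k (?\<phi> g) h' \<and> dKh D k h' (?\<phi> g'')}"
      using card_image by fastforce
    then show "even (card {g' \<in> GK D k. dK D g g' \<and> dK D g' g''})"
      using dKh_square[OF D in_GKh[OF g] in_GKh[OF g'']] by simp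
  }
  fix g' assume g': "g' \<in> GK D k"
  show "\<not> dK3 D g g'" by (simp add: dK3_def terms3_empty)
  \<comment> \<open>The Khovanov differential has bidegree (0, 1) in (q, h) = (r - s, s); since s
    grows by 1 and r - s is fixed, r grows by 1 as well.\<close>
  assume "dK D g g'"
  then have "dKh D k (?\<phi> g) (?\<phi> g')" using dK_dKh[OF D k g g'] by simp
  from dKh_degree[OF D in_GKh[OF g] in_GKh[OF g'] this, of ori]
  show "bidegK D ori g' = (fst (bidegK D ori g) + 1, snd (bidegK D ori g) + 1)"
    unfolding deg[OF g] deg[OF g'] by (simp add: prod_eq_iff)
next
  note D = assms(1) and k = assms(2)
  have "chain_iso (GK D k) (dK D) (GKh D k) (dKh D k) (\<lambda>g h. h = khgen_of D k g)"
    by (rule bij_chain_iso[OF khgen_of_bij[OF D k]]) (rule dK_dKh[OF D k])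
  then show "\<exists>F. chain_iso (GK D k) (dK D) (GKh D k) (dKh D k) F
          \<and> (\<forall>g\<in>GK D k. \<forall>h\<in>GKh D k. F g h \<longrightarrow>
               bidegKh D ori k h = (fst (bidegK D ori g) - snd (bidegK D ori g), snd (bidegK D ori g)))"
    using khgen_of_degree[OF D k] by (intro exI[of _ "\<lambda>g h. h = khgen_of D k g"]) blast
next
  note D = assms(1) and k = assms(2)
  fix r s :: int
  show "homology_iso (GK D k) (dK D) (bidegK D ori) (1, 1) (r, s)
    (GKh D k) (dKh D k) (bidegKh D ori k) (0, 1) (r - s, s)"
  proof (rule bij_homology_iso[OF khgen_of_bij[OF D k]])
    show "dK D g g' \<longleftrightarrow> dKh D k (khgen_of D k g) (khgen_of D k g')" if "g \<in> GK D k" "g' \<in> GK D k" for g g'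
      using dK_dKh[OF D k that] .
  qed (auto simp: khgen_of_degree[OF D k] prod_eq_iff)
qed

end
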